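(* Let $\Lambda$ be a cofinal, finite, locally convex $k$-graph. Suppose that $\Lambda$ contains a cycle with an entrance. Then $C^*(\Lambda)$ is properly infinite and has stable rank $\infty$.
   Context: A $k$-graph ($k\ge1$) is a nonempty countable small category $\Lambda$ with a functor $d:\Lambda\to\mathbb{N}^k$ such that whenever $d(\lambda)=m+n$ there are unique $\mu,\nu\in\Lambda$ with $d(\mu)=m$, $d(\nu)=n$, $\lambda=\mu\nu$. $\Lambda^n:=d^{-1}(n)$; $\Lambda^0$ (the vertices) is identified with the objects; $r(\lambda),s(\lambda)$ are the codomain and domain of $\lambda$; $e_1,\dots,e_k$ are the generators of $\mathbb{N}^k$. For $v\in\Lambda^0$, $E\subseteq\Lambda$: $vE=\{\nu\in E: r(\nu)=v\}$. For $n\in\mathbb{N}^k$, $\Lambda^{\le n}:=\{\lambda: d(\lambda)\le n,\ s(\lambda)\Lambda^{e_i}=\emptyset \text{ whenever } d(\lambda)+e_i\le n\}$. $\Lambda$ is finite if $|\Lambda^n|<\infty$ for all $n$; locally convex if for all $i\ne j$, $\lambda\in\Lambda^{e_i}$, $\mu\in\Lambda^{e_j}$ with $r(\lambda)=r(\mu)$, the sets $s(\lambda)\Lambda^{e_j}$ and $s(\mu)\Lambda^{e_i}$ are nonempty. $\Lambda$ is cofinal if for all $v,w\in\Lambda^0$ there is $n\in\mathbb{N}^k$ with $s(w\Lambda^{\le n})\subseteq s(v\Lambda)$. For $m\le n\le d(\lambda)$, $\lambda(m,n)$ is the unique element of $\Lambda^{n-m}$ with $\lambda=\lambda'\lambda(m,n)\lambda''$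 where $d(\lambda')=m$, $d(\lambda'')=d(\lambda)-n$. The same notation is used for (possibly infinite) paths of degree $m\in(\mathbb{N}\cup\{\infty\})^k$, i.e. degree-preserving functors $x:\{(p,q)\in\mathbb{N}^k\times\mathbb{N}^k:p\le q\le m\}\to\Lambda$ (where $(p,q)$ has range $p$, source $q$, degree $q-p$). A cycle is $\lambda\in\Lambda\setminus\Lambda^0$ with $r(\lambda)=s(\lambda)$; $\lambda^\infty=\lambda\lambda\lambda\cdots$ is the path with $d(\lambda^\infty)_i=\infty$ if $d(\lambda)_i>0$, $d(\lambda^\infty)_i=0$ if $d(\lambda)_i=0$, and $\lambda^\infty(n\,d(\lambda),(n+1)d(\lambda))=\lambda$ for all $n\in\mathbb{N}$. The cycle $\lambda$ has an entrance if there is $\tau\in r(\lambda)\Lambda$ with $d(\tau)\le d(\lambda^\infty)$ and $\tau\ne\lambda^\infty(0,d(\tau))$. $C^*(\Lambda)$ is the universal $C^*$-algebra generated by $\{s_\lambda:\lambda\in\Lambda\}$ subject to: the $s_v$, $v\in\Lambda^0$, are mutually orthogonal projections; $s_\mu s_\nu=s_{\mu\nu}$ if $s(\mu)=r(\nu)$; $s_\lambda^*s_\lambda=s_{s(\lambda)}$; $s_v=\sum_{\lambda\in v\Lambda^{\le n}}s_\lambda s_\lambda^*$ for all $v\in\Lambda^0$, $n\in\mathbb{N}^k$. It is unital here since $\Lambda^0$ is finite. A unital $C^*$-algebra $A$ is properly infinite if $1\oplus1\oplus r\sim1$ for some projection $r$ in some matrix algebra over $A$, where $a\oplus b=\mathrm{diag}(a,b)$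 and $\sim$ is Murray–von Neumann equivalence between projections in (possibly different size) matrix algebras over $A$. Stable rank: $Lg_n(A)=\{(x_i)\in A^n:\exists (y_i)\in A^n,\ \sum_i y_ix_i=1\}$, and $sr(A)$ is the smallest $n\ge1$ such that $Lg_n(A)$ is dense in $A^n$, or $\infty$ if there is none. *)

theory Defs
  imports "HOL-Analysis.Analysis" "HOL-Algebra.Module" "HOL-Library.Extended_Nat" "HOL-Library.FuncSet"
begin

section \<open>$k$-graphs\<close>

text \<open>
  Small categories are single-sorted: an object is identified with its identity morphism, so
  \<open>rng\<close> (codomain) and \<open>src\<close> (domain) take values in the morphisms. \<open>cmp \<Lambda> \<mu> \<nu>\<close> is the
  composite \<open>\<mu>\<nu>\<close>, meaningful when \<open>src \<mu> = rng \<nu>\<close>. The monoid of degrees is \<open>nat ^ 'k\<close>, ordered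
  componentwise, so \<open>k = CARD('k)\<close> is an arbitrary positive number.
\<close>

record 'p small_cat =
  Mor :: "'p set"
  rng :: "'p \<Rightarrow> 'p"
  src :: "'p \<Rightarrow> 'p"
  cmp :: "'p \<Rightarrow> 'p \<Rightarrow> 'p"

record ('p, 'k) kgraph = "'p small_cat" +
  deg :: "'p \<Rightarrow> nat ^ 'k"

locale small_category =
  fixes C :: "('p, 'm) small_cat_scheme"
  assumes rng_closed: "f \<in> Mor C \<Longrightarrow> rng C f \<in> Mor C"
    and src_closed: "f \<in> Mor C \<Longrightarrow> src C f \<in> Mor C"
    and rng_rng: "f \<in> Mor C \<Longrightarrow> rng C (rng C f) = rng C f"
    and src_rng: "f \<in> Mor C \<Longrightarrow> src C (rng C f) = rng C f"
    and rng_src: "f \<in> Mor C \<Longrightarrow> rng C (src C f) = src C f"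
    and src_src: "f \<in> Mor C \<Longrightarrow> src C (src C f) = src C f"
    and cmp_closed: "\<lbrakk>f \<in> Mor C; g \<in> Mor C; src C f = rng C g\<rbrakk> \<Longrightarrow> cmp C f g \<in> Mor C"
    and rng_cmp: "\<lbrakk>f \<in> Mor C; g \<in> Mor C; src C f = rng C g\<rbrakk> \<Longrightarrow> rng C (cmp C f g) = rng C f"
    and src_cmp: "\<lbrakk>f \<in> Mor C; g \<in> Mor C; src C f = rng C g\<rbrakk> \<Longrightarrow> src C (cmp C f g) = src C g"
    and cmp_id_left: "f \<in> Mor C \<Longrightarrow> cmp C (rng C f) f = f"
    and cmp_id_right: "f \<in> Mor C \<Longrightarrow> cmp C f (src C f) = f"
    and cmp_assoc: "\<lbrakk>f \<in> Mor C; g \<in> Mor C; h \<in> Mor C; src C f = rng C g; src C g = rng C h\<rbrakk>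
      \<Longrightarrow> cmp C (cmp C f g) h = cmp C f (cmp C g h)"

locale k_graph = small_category \<Lambda> for \<Lambda> :: "('p, 'k::finite) kgraph" +
  assumes nonempty: "Mor \<Lambda> \<noteq> {}"
    and countable: "countable (Mor \<Lambda>)"
    and deg_id: "\<kappa> \<in> Mor \<Lambda> \<Longrightarrow> deg \<Lambda> (src \<Lambda> \<kappa>) = 0"
    and deg_cmp: "\<lbrakk>\<mu> \<in> Mor \<Lambda>; \<nu> \<in> Mor \<Lambda>; src \<Lambda> \<mu> = rng \<Lambda> \<nu>\<rbrakk>
      \<Longrightarrow> deg \<Lambda> (cmp \<Lambda> \<mu> \<nu>) = deg \<Lambda> \<mu> + deg \<Lambda> \<nu>"
    and factorization: "\<lbrakk>\<kappa> \<in> Mor \<Lambda>; deg \<Lambda> \<kappa> = m + n\<rbrakk>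
      \<Longrightarrow> \<exists>!(\<mu>, \<nu>). \<mu> \<in> Mor \<Lambda> \<and> \<nu> \<in> Mor \<Lambda> \<and> src \<Lambda> \<mu> = rng \<Lambda> \<nu> \<and>
            deg \<Lambda> \<mu> = m \<and> deg \<Lambda> \<nu> = n \<and> \<kappa> = cmp \<Lambda> \<mu> \<nu>"

definition paths_deg :: "('p, 'k::finite) kgraph \<Rightarrow> nat ^ 'k \<Rightarrow> 'p set" where
  "paths_deg \<Lambda> n = {\<kappa> \<in> Mor \<Lambda>. deg \<Lambda> \<kappa> = n}"

text \<open>By unique factorization the paths of degree 0 are exactly the identity morphisms.\<close>

abbreviation vertices :: "('p, 'k::finite) kgraph \<Rightarrow> 'p set" where
  "vertices \<Lambda> \<equiv> paths_deg \<Lambda> 0"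

text \<open>\<open>with_range \<Lambda> v E\<close> is \<open>vE\<close>.\<close>

definition with_range :: "('p, 'k::finite) kgraph \<Rightarrow> 'p \<Rightarrow> 'p set \<Rightarrow> 'p set" where
  "with_range \<Lambda> v E = {\<nu> \<in> E. rng \<Lambda> \<nu> = v}"

definition gen :: "'k::finite \<Rightarrow> nat ^ 'k" where
  "gen i = axis i 1"

definition paths_le :: "('p, 'k::finite) kgraph \<Rightarrow> nat ^ 'k \<Rightarrow> 'p set" where
  "paths_le \<Lambda> n = {\<kappa> \<in> Mor \<Lambda>. deg \<Lambda> \<kappa> \<le> n \<and>
     (\<forall>i. deg \<Lambda> \<kappa> + gen i \<le> n \<longrightarrow> with_range \<Lambda> (src \<Lambda> \<kappa>) (paths_deg \<Lambda> (gen i)) = {})}"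

definition finite_kgraph :: "('p, 'k::finite) kgraph \<Rightarrow> bool" where
  "finite_kgraph \<Lambda> \<longleftrightarrow> (\<forall>n. finite (paths_deg \<Lambda> n))"

definition locally_convex :: "('p, 'k::finite) kgraph \<Rightarrow> bool" where
  "locally_convex \<Lambda> \<longleftrightarrow>
     (\<forall>i j. i \<noteq> j \<longrightarrow> (\<forall>\<kappa> \<in> paths_deg \<Lambda> (gen i). \<forall>\<mu> \<in> paths_deg \<Lambda> (gen j).
        rng \<Lambda> \<kappa> = rng \<Lambda> \<mu> \<longrightarrow>
          with_range \<Lambda> (src \<Lambda> \<kappa>) (paths_deg \<Lambda> (gen j)) \<noteq> {} \<and>
          with_range \<Lambda> (src \<Lambda> \<mu>) (paths_deg \<Lambda> (gen i)) \<noteq> {}))"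

definition kgraph_cofinal :: "('p, 'k::finite) kgraph \<Rightarrow> bool" where
  "kgraph_cofinal \<Lambda> \<longleftrightarrow> (\<forall>v \<in> vertices \<Lambda>. \<forall>w \<in> vertices \<Lambda>. \<exists>n.
     src \<Lambda> ` with_range \<Lambda> w (paths_le \<Lambda> n) \<subseteq> src \<Lambda> ` with_range \<Lambda> v (Mor \<Lambda>))"

abbreviation vec_enat :: "nat ^ 'k::finite \<Rightarrow> enat ^ 'k" where
  "vec_enat n \<equiv> (\<chi> i. enat (n $ i))"

definition Omega :: "enat ^ 'k::finite \<Rightarrow> ((nat ^ 'k) \<times> (nat ^ 'k)) set" where
  "Omega m = {(p, q). p \<le> q \<and> vec_enat q \<le> m}"

text \<open>
  Degree-preserving functors \<open>Omega m \<rightarrow> \<Lambda>\<close>; the object \<open>p\<close> of \<open>Omega m\<close> is the identity \<open>(p, p)\<close>.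
  Extensionality makes such a functor determined by its values on \<open>Omega m\<close>.
\<close>

definition is_path :: "('p, 'k::finite) kgraph \<Rightarrow> enat ^ 'k \<Rightarrow> ((nat ^ 'k) \<times> (nat ^ 'k) \<Rightarrow> 'p) \<Rightarrow> bool" where
  "is_path \<Lambda> m x \<longleftrightarrow>
     x \<in> extensional (Omega m) \<and>
     (\<forall>p q. (p, q) \<in> Omega m \<longrightarrow>
        x (p, q) \<in> Mor \<Lambda> \<and> deg \<Lambda> (x (p, q)) = q - p \<and>
        rng \<Lambda> (x (p, q)) = x (p, p) \<and> src \<Lambda> (x (p, q)) = x (q, q)) \<and>
     (\<forall>p q t. (p, q) \<in> Omega m \<and> (q, t) \<in> Omega m \<longrightarrow>
        x (p, t) = cmp \<Lambda> (x (p, q)) (x (q, t)))"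

definition is_cycle :: "('p, 'k::finite) kgraph \<Rightarrow> 'p \<Rightarrow> bool" where
  "is_cycle \<Lambda> \<kappa> \<longleftrightarrow> \<kappa> \<in> Mor \<Lambda> - vertices \<Lambda> \<and> rng \<Lambda> \<kappa> = src \<Lambda> \<kappa>"

definition inf_power_deg :: "('p, 'k::finite) kgraph \<Rightarrow> 'p \<Rightarrow> enat ^ 'k" where
  "inf_power_deg \<Lambda> \<kappa> = (\<chi> i. if deg \<Lambda> \<kappa> $ i > 0 then \<infinity> else 0)"

definition inf_power :: "('p, 'k::finite) kgraph \<Rightarrow> 'p \<Rightarrow> ((nat ^ 'k) \<times> (nat ^ 'k) \<Rightarrow> 'p)" where
  "inf_power \<Lambda> \<kappa> = (THE x. is_path \<Lambda> (inf_power_deg \<Lambda> \<kappa>) x \<and>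
     (\<forall>n::nat. x (n *s deg \<Lambda> \<kappa>, (n + 1) *s deg \<Lambda> \<kappa>) = \<kappa>))"

definition has_entrance :: "('p, 'k::finite) kgraph \<Rightarrow> 'p \<Rightarrow> bool" where
  "has_entrance \<Lambda> \<kappa> \<longleftrightarrow> (\<exists>\<tau> \<in> with_range \<Lambda> (rng \<Lambda> \<kappa>) (Mor \<Lambda>).
     vec_enat (deg \<Lambda> \<tau>) \<le> inf_power_deg \<Lambda> \<kappa> \<and> \<tau> \<noteq> inf_power \<Lambda> \<kappa> (0, deg \<Lambda> \<tau>))"

section \<open>$C^*$-algebras\<close>

definition complex_ring :: "complex ring" where
  "complex_ring = \<lparr>carrier = UNIV, monoid.mult = (*), one = 1, zero = 0, add = (+)\<rparr>"

record 'a cstar = "(complex, 'a) module" +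
  adj :: "'a \<Rightarrow> 'a"
  nrm :: "'a \<Rightarrow> real"

text \<open>
  $C^*$-algebras need not be unital here. The record field \<open>one\<close>, inherited from \<open>monoid\<close>, is left
  unconstrained and never used; see \<open>is_unit_of\<close> below.
\<close>

locale cstar_algebra = Module.module complex_ring A for A :: "'a cstar" (structure) +
  assumes mult_closed: "\<lbrakk>x \<in> carrier A; y \<in> carrier A\<rbrakk> \<Longrightarrow> x \<otimes> y \<in> carrier A"
    and mult_assoc: "\<lbrakk>x \<in> carrier A; y \<in> carrier A; z \<in> carrier A\<rbrakk> \<Longrightarrow> (x \<otimes> y) \<otimes> z = x \<otimes> (y \<otimes> z)"
    and distrib_right: "\<lbrakk>x \<in> carrier A; y \<in> carrier A; z \<in> carrier A\<rbrakk>
      \<Longrightarrow> (x \<oplus> y) \<otimes> z = x \<otimes> z \<oplus> y \<otimes> z"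
    and distrib_left: "\<lbrakk>x \<in> carrier A; y \<in> carrier A; z \<in> carrier A\<rbrakk>
      \<Longrightarrow> z \<otimes> (x \<oplus> y) = z \<otimes> x \<oplus> z \<otimes> y"
    and smult_mult_left: "\<lbrakk>x \<in> carrier A; y \<in> carrier A\<rbrakk> \<Longrightarrow> (c \<odot> x) \<otimes> y = c \<odot> (x \<otimes> y)"
    and smult_mult_right: "\<lbrakk>x \<in> carrier A; y \<in> carrier A\<rbrakk> \<Longrightarrow> x \<otimes> (c \<odot> y) = c \<odot> (x \<otimes> y)"
    and adj_closed: "x \<in> carrier A \<Longrightarrow> adj A x \<in> carrier A"
    and adj_adj: "x \<in> carrier A \<Longrightarrow> adj A (adj A x) = x"
    and adj_add: "\<lbrakk>x \<in> carrier A; y \<in> carrier A\<rbrakk> \<Longrightarrow> adj A (x \<oplus> y) = adj A x \<oplus> adj A y"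
    and adj_smult: "x \<in> carrier A \<Longrightarrow> adj A (c \<odot> x) = cnj c \<odot> adj A x"
    and adj_mult: "\<lbrakk>x \<in> carrier A; y \<in> carrier A\<rbrakk> \<Longrightarrow> adj A (x \<otimes> y) = adj A y \<otimes> adj A x"
    and nrm_nonneg: "x \<in> carrier A \<Longrightarrow> 0 \<le> nrm A x"
    and nrm_eq_0_iff: "x \<in> carrier A \<Longrightarrow> nrm A x = 0 \<longleftrightarrow> x = \<zero>"
    and nrm_add: "\<lbrakk>x \<in> carrier A; y \<in> carrier A\<rbrakk> \<Longrightarrow> nrm A (x \<oplus> y) \<le> nrm A x + nrm A y"
    and nrm_smult: "x \<in> carrier A \<Longrightarrow> nrm A (c \<odot> x) = cmod c * nrm A x"
    and nrm_mult: "\<lbrakk>x \<in> carrier A; y \<in> carrier A\<rbrakk> \<Longrightarrow> nrm A (x \<otimes> y) \<le> nrm A x * nrm A y"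
    and cstar_identity: "x \<in> carrier A \<Longrightarrow> nrm A (adj A x \<otimes> x) = (nrm A x)\<^sup>2"
    and complete: "\<lbrakk>\<And>n. f n \<in> carrier A;
        \<And>e. 0 < e \<Longrightarrow> \<exists>N. \<forall>m\<ge>N. \<forall>n\<ge>N. nrm A (f m \<ominus> f n) < e\<rbrakk>
      \<Longrightarrow> \<exists>a \<in> carrier A. (\<lambda>n::nat. nrm A (f n \<ominus> a)) \<longlonglongrightarrow> 0"

definition closed_star_subalgebra :: "'a cstar \<Rightarrow> 'a set \<Rightarrow> bool" where
  "closed_star_subalgebra A S \<longleftrightarrow>
     S \<subseteq> carrier A \<and> \<zero>\<^bsub>A\<^esub> \<in> S \<and>
     (\<forall>x\<in>S. \<forall>y\<in>S. x \<oplus>\<^bsub>A\<^esub> y \<in> S \<and> x \<otimes>\<^bsub>A\<^esub> y \<in> S) \<and>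
     (\<forall>c. \<forall>x\<in>S. c \<odot>\<^bsub>A\<^esub> x \<in> S) \<and>
     (\<forall>x\<in>S. adj A x \<in> S) \<and>
     (\<forall>f a. (\<forall>n::nat. f n \<in> S) \<and> a \<in> carrier A \<and> (\<lambda>n. nrm A (f n \<ominus>\<^bsub>A\<^esub> a)) \<longlonglongrightarrow> 0 \<longrightarrow> a \<in> S)"

definition star_hom :: "'a cstar \<Rightarrow> 'b cstar \<Rightarrow> ('a \<Rightarrow> 'b) \<Rightarrow> bool" where
  "star_hom A B \<phi> \<longleftrightarrow>
     \<phi> \<in> carrier A \<rightarrow> carrier B \<and>
     (\<forall>x\<in>carrier A. \<forall>y\<in>carrier A.
        \<phi> (x \<oplus>\<^bsub>A\<^esub> y) = \<phi> x \<oplus>\<^bsub>B\<^esub> \<phi> y \<and> \<phi> (x \<otimes>\<^bsub>A\<^esub> y) = \<phi> x \<otimes>\<^bsub>B\<^esub> \<phi> y) \<and>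
     (\<forall>c. \<forall>x\<in>carrier A. \<phi> (c \<odot>\<^bsub>A\<^esub> x) = c \<odot>\<^bsub>B\<^esub> \<phi> x) \<and>
     (\<forall>x\<in>carrier A. \<phi> (adj A x) = adj B (\<phi> x))"

section \<open>The $C^*$-algebra of a $k$-graph\<close>

definition CK_family :: "('p, 'k::finite) kgraph \<Rightarrow> 'a cstar \<Rightarrow> ('p \<Rightarrow> 'a) \<Rightarrow> bool" where
  "CK_family \<Lambda> A s \<longleftrightarrow>
     (\<forall>\<kappa>\<in>Mor \<Lambda>. s \<kappa> \<in> carrier A) \<and>
     (\<forall>v\<in>vertices \<Lambda>. s v \<otimes>\<^bsub>A\<^esub> s v = s v \<and> adj A (s v) = s v) \<and>
     (\<forall>v\<in>vertices \<Lambda>. \<forall>w\<in>vertices \<Lambda>. v \<noteq> w \<longrightarrow> s v \<otimes>\<^bsub>A\<^esub> s w = \<zero>\<^bsub>A\<^esub>) \<and>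
     (\<forall>\<mu>\<in>Mor \<Lambda>. \<forall>\<nu>\<in>Mor \<Lambda>. src \<Lambda> \<mu> = rng \<Lambda> \<nu> \<longrightarrow> s \<mu> \<otimes>\<^bsub>A\<^esub> s \<nu> = s (cmp \<Lambda> \<mu> \<nu>)) \<and>
     (\<forall>\<kappa>\<in>Mor \<Lambda>. adj A (s \<kappa>) \<otimes>\<^bsub>A\<^esub> s \<kappa> = s (src \<Lambda> \<kappa>)) \<and>
     (\<forall>v\<in>vertices \<Lambda>. \<forall>n.
        s v = finsum A (\<lambda>\<kappa>. s \<kappa> \<otimes>\<^bsub>A\<^esub> adj A (s \<kappa>)) (with_range \<Lambda> v (paths_le \<Lambda> n)))"

text \<open>
  \<open>is_graph_algebra \<Lambda> A s\<close>: the pair \<open>(A, s)\<close> is (a model of) $C^*(\Lambda)$, the universal $C^*$-algebra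
  generated by a family satisfying the relations. The homomorphism in the last clause is unique
  because \<open>s\<close> generates \<open>A\<close> and *-homomorphisms are continuous.

  HOL cannot quantify over types inside a formula, so the test algebras \<open>B\<close> range over all
  $C^*$-algebras carried by a subset of \<open>nat \<Rightarrow> nat \<Rightarrow> complex\<close>, with arbitrary operations. Nothing
  is lost: as \<open>\<Lambda>\<close> is countable, a family \<open>t\<close> in any $C^*$-algebra generates a separable
  subalgebra, which has at most continuum many elements and so is isomorphic to such a \<open>B\<close>. (Fixing
  the type of \<open>A\<close> itself instead would be wrong: on a one-element type the zero algebra would
  qualify.)
\<close>

definition is_graph_algebra :: "('p, 'k::finite) kgraph \<Rightarrow> 'a cstar \<Rightarrow> ('p \<Rightarrow> 'a) \<Rightarrow> bool" where
  "is_graph_algebra \<Lambda> A s \<longleftrightarrow>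
     cstar_algebra A \<and> CK_family \<Lambda> A s \<and>
     (\<forall>S. closed_star_subalgebra A S \<and> s ` Mor \<Lambda> \<subseteq> S \<longrightarrow> S = carrier A) \<and>
     (\<forall>(B :: (nat \<Rightarrow> nat \<Rightarrow> complex) cstar) t. cstar_algebra B \<and> CK_family \<Lambda> B t \<longrightarrow>
        (\<exists>\<phi>. star_hom A B \<phi> \<and> (\<forall>\<kappa>\<in>Mor \<Lambda>. \<phi> (s \<kappa>) = t \<kappa>)))"

section \<open>Proper infiniteness and stable rank\<close>

definition is_unit_of :: "'a cstar \<Rightarrow> 'a \<Rightarrow> bool" where
  "is_unit_of A e \<longleftrightarrow> e \<in> carrier A \<and> (\<forall>x\<in>carrier A. e \<otimes>\<^bsub>A\<^esub> x = x \<and> x \<otimes>\<^bsub>A\<^esub> e = x)"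

definition unital :: "'a cstar \<Rightarrow> bool" where
  "unital A \<longleftrightarrow> (\<exists>e. is_unit_of A e)"

definition unit_of :: "'a cstar \<Rightarrow> 'a" where
  "unit_of A = (THE e. is_unit_of A e)"

text \<open>Matrices over \<open>A\<close> are extensional functions on index pairs, so equality is entrywise.\<close>

definition mats :: "'a cstar \<Rightarrow> nat \<Rightarrow> nat \<Rightarrow> (nat \<times> nat \<Rightarrow> 'a) set" where
  "mats A m n = ({..<m} \<times> {..<n}) \<rightarrow>\<^sub>E carrier A"

text \<open>\<open>mat_mul A l m n\<close> multiplies an \<open>l \<times> m\<close> by an \<open>m \<times> n\<close> matrix;
  \<open>mat_adj A m n\<close> is the adjoint of an \<open>m \<times> n\<close> matrix.\<close>

definition mat_mul :: "'a cstar \<Rightarrow> nat \<Rightarrow> nat \<Rightarrow> nat \<Rightarrow>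
    (nat \<times> nat \<Rightarrow> 'a) \<Rightarrow> (nat \<times> nat \<Rightarrow> 'a) \<Rightarrow> (nat \<times> nat \<Rightarrow> 'a)" where
  "mat_mul A l m n X Y =
     restrict (\<lambda>(i, j). finsum A (\<lambda>k. X (i, k) \<otimes>\<^bsub>A\<^esub> Y (k, j)) {..<m}) ({..<l} \<times> {..<n})"

definition mat_adj :: "'a cstar \<Rightarrow> nat \<Rightarrow> nat \<Rightarrow> (nat \<times> nat \<Rightarrow> 'a) \<Rightarrow> (nat \<times> nat \<Rightarrow> 'a)" where
  "mat_adj A m n X = restrict (\<lambda>(i, j). adj A (X (j, i))) ({..<n} \<times> {..<m})"

definition mat_diag :: "'a cstar \<Rightarrow> nat \<Rightarrow> nat \<Rightarrow>
    (nat \<times> nat \<Rightarrow> 'a) \<Rightarrow> (nat \<times> nat \<Rightarrow> 'a) \<Rightarrow> (nat \<times> nat \<Rightarrow> 'a)" where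
  "mat_diag A m n X Y =
     restrict (\<lambda>(i, j). if i < m \<and> j < m then X (i, j)
                        else if m \<le> i \<and> m \<le> j then Y (i - m, j - m) else \<zero>\<^bsub>A\<^esub>)
       ({..<m + n} \<times> {..<m + n})"

definition mat_proj :: "'a cstar \<Rightarrow> nat \<Rightarrow> (nat \<times> nat \<Rightarrow> 'a) \<Rightarrow> bool" where
  "mat_proj A n P \<longleftrightarrow> P \<in> mats A n n \<and> mat_mul A n n n P P = P \<and> mat_adj A n n P = P"

definition mvn_equiv :: "'a cstar \<Rightarrow> nat \<Rightarrow> (nat \<times> nat \<Rightarrow> 'a) \<Rightarrow> nat \<Rightarrow> (nat \<times> nat \<Rightarrow> 'a) \<Rightarrow> bool" where
  "mvn_equiv A m P n Q \<longleftrightarrow> mat_proj A m P \<and> mat_proj A n Q \<and>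
     (\<exists>V \<in> mats A n m. mat_mul A m n m (mat_adj A n m V) V = P \<and>
                       mat_mul A n m n V (mat_adj A n m V) = Q)"

definition one_mat :: "'a cstar \<Rightarrow> (nat \<times> nat \<Rightarrow> 'a)" where
  "one_mat A = restrict (\<lambda>_. unit_of A) ({..<1} \<times> {..<1})"

definition properly_infinite :: "'a cstar \<Rightarrow> bool" where
  "properly_infinite A \<longleftrightarrow> unital A \<and>
     (\<exists>n\<ge>1. \<exists>R. mat_proj A n R \<and>
        mvn_equiv A (1 + 1 + n) (mat_diag A (1 + 1) n (mat_diag A 1 1 (one_mat A) (one_mat A)) R)
                  1 (one_mat A))"

definition Lg :: "'a cstar \<Rightarrow> nat \<Rightarrow> (nat \<Rightarrow> 'a) set" where
  "Lg A n = {x \<in> {..<n} \<rightarrow>\<^sub>E carrier A. \<exists>y \<in> {..<n} \<rightarrow>\<^sub>E carrier A.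
     finsum A (\<lambda>i. y i \<otimes>\<^bsub>A\<^esub> x i) {..<n} = unit_of A}"

definition Lg_dense :: "'a cstar \<Rightarrow> nat \<Rightarrow> bool" where
  "Lg_dense A n \<longleftrightarrow> (\<forall>x \<in> {..<n} \<rightarrow>\<^sub>E carrier A. \<forall>\<epsilon>>0. \<exists>z \<in> Lg A n.
     \<forall>i<n. nrm A (z i \<ominus>\<^bsub>A\<^esub> x i) < \<epsilon>)"

text \<open>Meaningful for unital \<open>A\<close> only.\<close>

definition stable_rank :: "'a cstar \<Rightarrow> enat" where
  "stable_rank A = (if \<exists>n\<ge>1. Lg_dense A n then enat (LEAST n. 1 \<le> n \<and> Lg_dense A n) else \<infinity>)"

end

theory Submission
  imports Defs
begin

text \<open>
  Let \<open>v\<close> be the base of a cycle with an entrance. A power \<open>a\<close> of the cycle and the entrance \<open>t\<close>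
  differ in their initial segments of degree \<open>d(t)\<close>, so \<open>s\<^sub>t\<^sup>* s\<^sub>a = 0\<close> and the elements
  \<open>s\<^sub>a\<^sup>i s\<^sub>t\<close> have orthogonal ranges. By cofinality every vertex projection is a finite sum of
  projections \<open>s\<^sub>\<mu> s\<^sub>\<mu>\<^sup>*\<close> for which there is a path \<open>\<beta>\<^sub>\<mu>\<close> from \<open>s(\<mu>)\<close> to \<open>s(t)\<close>. Summing
  \<open>s\<^sub>a\<^sup>i s\<^sub>t s\<^sub>\<beta> s\<^sub>\<mu>\<^sup>*\<close> over all \<open>\<mu>\<close>, with a different exponent \<open>i\<close> for each \<open>\<mu>\<close>, gives an isometry, and
  disjoint sets of exponents give infinitely many isometries with orthogonal ranges. Two of them
  witness proper infiniteness; if the algebra is nonzero, any \<open>n + 1\<close> of them obstruct the density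
  of the left invertible columns of length \<open>n\<close>.

  The algebra is nonzero because the paths that eventually agree with a shift of one fixed
  boundary path form an orthonormal basis of a representation. The orthogonality
  of distinct ranges is not among the defining relations; it holds because projections that sum
  to a projection are orthogonal. General positivity in $C^*$-algebras is avoided here: it suffices
  that the unit of a corner is an extreme point of its unit ball.
\<close>

section \<open>Factorizations and infinite powers\<close>

text \<open>\<open>A\<close> is known only through its relations and its universal property. The
  relations also hold in the zero algebra, so nonvanishing cannot be derived from them; it has to be
  imported from one concrete representation. Proper infiniteness follows from the relations and
  generation alone, whereas the stable rank needs nonvanishing as well. For this a single orbit of
  boundary paths is enough: it is countable, so its basis can be indexed by natural numbers, and no
  space of all infinite paths has to be built.

  The representation is where local convexity is used. The vertex relation is required for every
  \<open>n\<close>, so a long path that is maximal below some bound must begin with one that is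
  maximal below any smaller \<open>n\<close>. Without local convexity a direction could be open
  halfway along the path and be lost further on.

  Cofinality is applied to the vertex \<open>src \<Lambda> t\<close> rather than to
  \<open>v\<close>, because the connecting paths are appended to \<open>t\<close>.\<close>

context k_graph
begin

lemma deg_rng [simp]: "f \<in> Mor \<Lambda> \<Longrightarrow> deg \<Lambda> (rng \<Lambda> f) = 0"
  by (metis deg_id rng_closed src_rng)

lemma deg_src [simp]: "f \<in> Mor \<Lambda> \<Longrightarrow> deg \<Lambda> (src \<Lambda> f) = 0"
  by (rule deg_id)

lemma rng_vertex [simp]: "f \<in> Mor \<Lambda> \<Longrightarrow> rng \<Lambda> f \<in> vertices \<Lambda>"
  and src_vertex [simp]: "f \<in> Mor \<Lambda> \<Longrightarrow> src \<Lambda> f \<in> vertices \<Lambda>"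
  by (auto simp: paths_deg_def rng_closed src_closed)

lemma factor_exists:
  assumes "f \<in> Mor \<Lambda>" "deg \<Lambda> f = m + n"
  obtains g h where "g \<in> Mor \<Lambda>" "h \<in> Mor \<Lambda>" "src \<Lambda> g = rng \<Lambda> h" "deg \<Lambda> g = m" "deg \<Lambda> h = n"
    "f = cmp \<Lambda> g h"
  using factorization[OF assms] by blast

lemma factor_exists_le:
  assumes "f \<in> Mor \<Lambda>" "m \<le> deg \<Lambda> f"
  obtains g h where "g \<in> Mor \<Lambda>" "h \<in> Mor \<Lambda>" "src \<Lambda> g = rng \<Lambda> h" "deg \<Lambda> g = m"
    "deg \<Lambda> h = deg \<Lambda> f - m" "f = cmp \<Lambda> g h"
proof -
  have "deg \<Lambda> f = m + (deg \<Lambda> f - m)"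
    using assms(2) by (auto simp: vec_eq_iff less_eq_vec_def)
  from factor_exists[OF assms(1) this] show ?thesis using that by blast
qed

text \<open>Comparing the degrees of the first factors is enough: degrees add up, and addition in
  \<open>nat ^ 'k\<close> can be cancelled.\<close>

lemma factor_unique:
  assumes "g \<in> Mor \<Lambda>" "h \<in> Mor \<Lambda>" "src \<Lambda> g = rng \<Lambda> h"
    and "g' \<in> Mor \<Lambda>" "h' \<in> Mor \<Lambda>" "src \<Lambda> g' = rng \<Lambda> h'"
    and eq: "cmp \<Lambda> g h = cmp \<Lambda> g' h'" and deg: "deg \<Lambda> g = deg \<Lambda> g'"
  shows "g = g' \<and> h = h'"
proof -
  have "deg \<Lambda> g + deg \<Lambda> h = deg \<Lambda> g' + deg \<Lambda> h'"
    using assms deg_cmp by metis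
  then have "deg \<Lambda> h = deg \<Lambda> h'"
    using deg by simp
  with factorization[OF cmp_closed[OF assms(1-3)] deg_cmp[OF assms(1-3)]] assms
  show ?thesis by (metis (mono_tags, lifting) case_prodI old.prod.inject)
qed

lemma cancel_left:
  assumes "g \<in> Mor \<Lambda>" "h \<in> Mor \<Lambda>" "src \<Lambda> g = rng \<Lambda> h" "h' \<in> Mor \<Lambda>" "src \<Lambda> g = rng \<Lambda> h'"
    and "cmp \<Lambda> g h = cmp \<Lambda> g h'"
  shows "h = h'"
  using factor_unique[of g h g h'] assms by auto

text \<open>Vertices are given by their degree alone. Both
  \<open>cmp \<Lambda> (rng \<Lambda> v) v\<close> and
  \<open>cmp \<Lambda> v (src \<Lambda> v)\<close> factor \<open>v\<close> into two paths of degree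
  0, so unique factorization makes \<open>v\<close> an identity morphism.\<close>

lemma vertex_id:
  assumes "v \<in> vertices \<Lambda>"
  shows "v \<in> Mor \<Lambda>" "deg \<Lambda> v = 0" "rng \<Lambda> v = v" "src \<Lambda> v = v"
proof -
  show v: "v \<in> Mor \<Lambda>" "deg \<Lambda> v = 0" using assms by (auto simp: paths_deg_def)
  have "cmp \<Lambda> (rng \<Lambda> v) v = cmp \<Lambda> v (src \<Lambda> v)"
    using v by (simp add: cmp_id_left cmp_id_right)
  then have "rng \<Lambda> v = v \<and> v = src \<Lambda> v"
    using v by (intro factor_unique) (auto simp: rng_closed src_closed src_rng rng_src)
  then show "rng \<Lambda> v = v" "src \<Lambda> v = v" by auto
qed

section \<open>Segments of a path\<close>

definition composable :: "'p \<Rightarrow> 'p \<Rightarrow> bool" where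
  "composable f g \<longleftrightarrow> f \<in> Mor \<Lambda> \<and> g \<in> Mor \<Lambda> \<and> src \<Lambda> f = rng \<Lambda> g"

text \<open>This is the path usually written \<open>f(p, q)\<close>. As a relation it can be
  extended and concatenated without carrying the side condition that \<open>q\<close> is at most the
  degree of \<open>f\<close>.\<close>

definition segment :: "'p \<Rightarrow> nat ^ 'k \<Rightarrow> nat ^ 'k \<Rightarrow> 'p \<Rightarrow> bool" where
  "segment f p q g \<longleftrightarrow> p \<le> q \<and> (\<exists>h h'. composable h g \<and> composable g h' \<and>
     deg \<Lambda> h = p \<and> deg \<Lambda> g = q - p \<and> f = cmp \<Lambda> h (cmp \<Lambda> g h'))"

lemma segment_unique:
  assumes "segment f p q g" "segment f p q g'"
  shows "g = g'"
proof -
  from assms obtain h k h' k' where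
    *: "composable h g" "composable g k" "composable h' g'" "composable g' k'"
    "deg \<Lambda> h = p" "deg \<Lambda> h' = p" "deg \<Lambda> g = q - p" "deg \<Lambda> g' = q - p"
    "cmp \<Lambda> h (cmp \<Lambda> g k) = cmp \<Lambda> h' (cmp \<Lambda> g' k')"
    unfolding segment_def by metis
  have "h = h' \<and> cmp \<Lambda> g k = cmp \<Lambda> g' k'"
    using * by (intro factor_unique) (auto simp: composable_def cmp_closed rng_cmp)
  then show ?thesis using factor_unique[of g k g' k'] * by (auto simp: composable_def)
qed

lemma segment_exists:
  assumes f: "f \<in> Mor \<Lambda>" and "p \<le> q" "q \<le> deg \<Lambda> f"
  shows "\<exists>g. segment f p q g"
proof -
  obtain g h where gh: "g \<in> Mor \<Lambda>" "h \<in> Mor \<Lambda>" "src \<Lambda> g = rng \<Lambda> h" "deg \<Lambda> g = q" "f = cmp \<Lambda> g h"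
    using factor_exists_le[OF f assms(3)] by metis
  obtain k l where kl: "k \<in> Mor \<Lambda>" "l \<in> Mor \<Lambda>" "src \<Lambda> k = rng \<Lambda> l" "deg \<Lambda> k = p"
    "deg \<Lambda> l = q - p" "g = cmp \<Lambda> k l"
    using factor_exists_le[OF gh(1), of p] assms(2) gh(4) by metis
  have "src \<Lambda> l = rng \<Lambda> h" using gh kl src_cmp by metis
  then have "f = cmp \<Lambda> k (cmp \<Lambda> l h)"
    using gh kl cmp_assoc by metis
  then show ?thesis
    using assms gh kl \<open>src \<Lambda> l = rng \<Lambda> h\<close> unfolding segment_def composable_def by blast
qed

lemma segment_closed: "segment f p q g \<Longrightarrow> g \<in> Mor \<Lambda> \<and> deg \<Lambda> g = q - p \<and> p \<le> q"
  by (auto simp: segment_def composable_def)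

lemma segment_extend:
  assumes "segment f p q g" "composable f h"
  shows "segment (cmp \<Lambda> f h) p q g"
proof -
  from assms obtain k l where *: "composable k g" "composable g l" "deg \<Lambda> k = p" "deg \<Lambda> g = q - p"
    "f = cmp \<Lambda> k (cmp \<Lambda> g l)" "p \<le> q" unfolding segment_def by metis
  have gl: "composable k (cmp \<Lambda> g l)" "composable (cmp \<Lambda> g l) h" "composable l h"
    using * assms by (auto simp: composable_def cmp_closed rng_cmp src_cmp)
  then have "composable g (cmp \<Lambda> l h)" using * by (auto simp: composable_def cmp_closed rng_cmp)
  moreover have "cmp \<Lambda> f h = cmp \<Lambda> k (cmp \<Lambda> g (cmp \<Lambda> l h))"
    using * gl by (auto simp: composable_def cmp_assoc)
  ultimately show ?thesis using * unfolding segment_def by metis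
qed

lemma segment_rng:
  assumes "segment f p q g"
  shows "segment f p p (rng \<Lambda> g)"
proof -
  from assms obtain k l where *: "composable k g" "composable g l" "deg \<Lambda> k = p"
    "f = cmp \<Lambda> k (cmp \<Lambda> g l)" unfolding segment_def by metis
  have "composable k (rng \<Lambda> g)" "composable (rng \<Lambda> g) (cmp \<Lambda> g l)"
    "cmp \<Lambda> (rng \<Lambda> g) (cmp \<Lambda> g l) = cmp \<Lambda> g l" "deg \<Lambda> (rng \<Lambda> g) = p - p"
    using * by (auto simp: composable_def cmp_closed rng_cmp rng_closed rng_rng src_rng)
      (metis cmp_closed cmp_id_left rng_cmp)
  then show ?thesis using * unfolding segment_def by (metis order_refl)
qed

lemma segment_src:
  assumes "segment f p q g"
  shows "segment f q q (src \<Lambda> g)"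
proof -
  from assms obtain k l where *: "composable k g" "composable g l" "deg \<Lambda> k = p" "deg \<Lambda> g = q - p"
    "f = cmp \<Lambda> k (cmp \<Lambda> g l)" "p \<le> q" unfolding segment_def by metis
  have "composable (cmp \<Lambda> k g) (src \<Lambda> g)" "composable (src \<Lambda> g) l"
    using * by (auto simp: composable_def cmp_closed src_cmp src_closed rng_src src_src
        rng_closed rng_rng src_rng)
  moreover have "f = cmp \<Lambda> (cmp \<Lambda> k g) (cmp \<Lambda> (src \<Lambda> g) l)"
    using * by (auto simp: composable_def cmp_assoc cmp_id_left)
  moreover have "deg \<Lambda> (cmp \<Lambda> k g) = q"
    using * by (auto simp: composable_def deg_cmp vec_eq_iff less_eq_vec_def)
  moreover have "deg \<Lambda> (src \<Lambda> g) = q - q" using * by (auto simp: composable_def)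
  ultimately show ?thesis unfolding segment_def by (metis order_refl)
qed

lemma segment_cmp:
  assumes "segment f p q g" "segment f q t h"
  shows "segment f p t (cmp \<Lambda> g h)"
proof -
  from assms(1) obtain k l where *: "composable k g" "composable g l" "deg \<Lambda> k = p" "deg \<Lambda> g = q - p"
    "f = cmp \<Lambda> k (cmp \<Lambda> g l)" "p \<le> q" unfolding segment_def by metis
  from assms(2) obtain k' l' where **: "composable k' h" "composable h l'" "deg \<Lambda> k' = q" "deg \<Lambda> h = t - q"
    "f = cmp \<Lambda> k' (cmp \<Lambda> h l')" "q \<le> t" unfolding segment_def by metis
  \<comment> \<open>Both factorizations cut \<open>f\<close> at degree \<open>q\<close>, so their
    initial parts agree and what follows \<open>g\<close> begins with \<open>h\<close>.\<close>
  have "cmp \<Lambda> k g = k' \<and> l = cmp \<Lambda> h l'"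
  proof (rule factor_unique)
    show "cmp \<Lambda> (cmp \<Lambda> k g) l = cmp \<Lambda> k' (cmp \<Lambda> h l')"
      using * ** by (auto simp: composable_def cmp_assoc)
    show "deg \<Lambda> (cmp \<Lambda> k g) = deg \<Lambda> k'"
      using * ** by (auto simp: composable_def deg_cmp vec_eq_iff less_eq_vec_def)
  qed (use * ** in \<open>auto simp: composable_def cmp_closed rng_cmp src_cmp\<close>)
  then have l: "l = cmp \<Lambda> h l'" by simp
  have gh: "composable g h" using * ** l by (auto simp: composable_def rng_cmp)
  then have "f = cmp \<Lambda> k (cmp \<Lambda> (cmp \<Lambda> g h) l')"
    using * ** l by (auto simp: composable_def cmp_assoc)
  moreover have "composable k (cmp \<Lambda> g h)" "composable (cmp \<Lambda> g h) l'"
    using gh * ** by (auto simp: composable_def cmp_closed rng_cmp src_cmp)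
  moreover have "deg \<Lambda> (cmp \<Lambda> g h) = t - p"
    using gh * ** by (auto simp: composable_def deg_cmp vec_eq_iff less_eq_vec_def)
  ultimately show ?thesis using * ** unfolding segment_def by (metis order_trans)
qed

section \<open>Powers of a cycle and its infinite power\<close>

primrec path_power :: "'p \<Rightarrow> nat \<Rightarrow> 'p" where
  "path_power f 0 = rng \<Lambda> f"
| "path_power f (Suc n) = cmp \<Lambda> (path_power f n) f"

lemma path_power:
  assumes "is_cycle \<Lambda> f"
  shows "path_power f n \<in> Mor \<Lambda>" "rng \<Lambda> (path_power f n) = rng \<Lambda> f"
    "src \<Lambda> (path_power f n) = rng \<Lambda> f" "deg \<Lambda> (path_power f n) = n *s deg \<Lambda> f"
proof -
  have f: "f \<in> Mor \<Lambda>" "src \<Lambda> f = rng \<Lambda> f" using assms by (auto simp: is_cycle_def)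
  have "path_power f n \<in> Mor \<Lambda> \<and> rng \<Lambda> (path_power f n) = rng \<Lambda> f \<and>
    src \<Lambda> (path_power f n) = rng \<Lambda> f \<and> deg \<Lambda> (path_power f n) = n *s deg \<Lambda> f"
    by (induction n)
      (use f in \<open>auto simp: rng_closed rng_rng src_rng cmp_closed rng_cmp src_cmp deg_cmp vec_eq_iff\<close>)
  then show "path_power f n \<in> Mor \<Lambda>" "rng \<Lambda> (path_power f n) = rng \<Lambda> f"
    "src \<Lambda> (path_power f n) = rng \<Lambda> f" "deg \<Lambda> (path_power f n) = n *s deg \<Lambda> f"
    by auto
qed

text \<open>The sum of the coordinates of \<open>q\<close> is a multiplier that serves all
  coordinates at once: where \<open>f\<close> has degree 0 the hypothesis forces \<open>q\<close> to
  vanish, and elsewhere the multiplier is multiplied by at least 1.\<close>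

lemma le_multiple_deg:
  assumes "vec_enat q \<le> inf_power_deg \<Lambda> f"
  shows "\<exists>n. q \<le> n *s deg \<Lambda> f"
proof -
  have "q $ i \<le> (\<Sum>j\<in>UNIV. q $ j) * deg \<Lambda> f $ i" for i
  proof (cases "deg \<Lambda> f $ i")
    case 0
    have "enat (q $ i) \<le> inf_power_deg \<Lambda> f $ i" using assms by (auto simp: less_eq_vec_def)
    with 0 show ?thesis by (auto simp: inf_power_deg_def zero_enat_def)
  next
    case (Suc m)
    have "q $ i \<le> (\<Sum>j\<in>UNIV. q $ j)" by (rule member_le_sum) auto
    with Suc show ?thesis by (simp add: trans_le_add1)
  qed
  then have "q \<le> (\<Sum>j\<in>UNIV. q $ j) *s deg \<Lambda> f" by (auto simp: less_eq_vec_def)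
  then show ?thesis by blast
qed

lemma multiple_le_inf_power_deg: "vec_enat (n *s deg \<Lambda> f) \<le> inf_power_deg \<Lambda> f"
  by (auto simp: less_eq_vec_def inf_power_deg_def zero_enat_def)

lemma path_power_segment_mono:
  assumes "is_cycle \<Lambda> f" "segment (path_power f n) p q g" "n \<le> m"
  shows "segment (path_power f m) p q g"
  using assms(3)
proof (induction m rule: dec_induct)
  case base
  then show ?case using assms by simp
next
  case (step m)
  have "composable (path_power f m) f"
    using path_power[OF assms(1)] assms(1) by (auto simp: composable_def is_cycle_def)
  with step show ?case by (simp add: segment_extend)
qed

lemma path_power_segment_unique:
  assumes "is_cycle \<Lambda> f" "segment (path_power f n) p q g" "segment (path_power f m) p q h"
  shows "g = h"
  using path_power_segment_mono[OF assms(1)] assms segment_unique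
  by (metis max.cobounded1 max.cobounded2)

text \<open>\<open>inf_power\<close> is a definite description, so nothing is known about it before
  existence and uniqueness are shown. Segments of high powers are compatible and glue to a path.
  Conversely, the prescribed blocks force any such path to have the powers of \<open>f\<close> as
  initial pieces, whose segments determine all its values.\<close>

lemma inf_power_segment:
  assumes cyc: "is_cycle \<Lambda> f"
  shows "\<exists>!x. is_path \<Lambda> (inf_power_deg \<Lambda> f) x \<and>
      (\<forall>n::nat. x (n *s deg \<Lambda> f, (n + 1) *s deg \<Lambda> f) = f)" (is "\<exists>!x. ?Q x")
    and "p \<le> q \<Longrightarrow> q \<le> n *s deg \<Lambda> f \<Longrightarrow> segment (path_power f n) p q (inf_power \<Lambda> f (p, q))"
proof -
  let ?d = "deg \<Lambda> f" and ?m = "inf_power_deg \<Lambda> f"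
  note pp = path_power[OF cyc]
  have f: "f \<in> Mor \<Lambda>" "src \<Lambda> f = rng \<Lambda> f" using cyc by (auto simp: is_cycle_def)
  \<comment> \<open>The description does not depend on the power used, by
    \<open>path_power_segment_unique\<close>.\<close>
  define x where "x = restrict (\<lambda>(p, q). THE g. \<exists>n. segment (path_power f n) p q g) (Omega ?m)"
  have xI: "x (p, q) = g" if "segment (path_power f n) p q g" "(p, q) \<in> Omega ?m" for p q n g
    unfolding x_def using that path_power_segment_unique[OF cyc] by auto
  have ex: "\<exists>n g. segment (path_power f n) p q g" if "(p, q) \<in> Omega ?m" for p q
    using that le_multiple_deg[of q f] segment_exists[of "path_power f n" p q for n] pp
    by (fastforce simp: Omega_def)
  have xseg: "\<exists>n. segment (path_power f n) p q (x (p, q))" if "(p, q) \<in> Omega ?m" for p q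
    using ex[OF that] xI[OF _ that] by metis
  have Om: "(p, p) \<in> Omega ?m" "(q, q) \<in> Omega ?m" if "(p, q) \<in> Omega ?m" for p q
    using that by (auto simp: Omega_def less_eq_vec_def) (meson enat_ord_simps(1) order_trans)
  have xQ: "?Q x"
    unfolding is_path_def
  proof (intro conjI allI impI)
    show "x \<in> extensional (Omega ?m)" by (simp add: x_def)
    fix p q assume pq: "(p, q) \<in> Omega ?m"
    obtain n where n: "segment (path_power f n) p q (x (p, q))" using xseg[OF pq] by blast
    show "x (p, q) \<in> Mor \<Lambda>" "deg \<Lambda> (x (p, q)) = q - p" using segment_closed[OF n] by auto
    show "rng \<Lambda> (x (p, q)) = x (p, p)" "src \<Lambda> (x (p, q)) = x (q, q)"
      using xI[OF segment_rng[OF n]] xI[OF segment_src[OF n]] Om[OF pq] by auto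
  next
    fix p q t assume pqt: "(p, q) \<in> Omega ?m \<and> (q, t) \<in> Omega ?m"
    then obtain n n' where n: "segment (path_power f n) p q (x (p, q))"
      "segment (path_power f n') q t (x (q, t))" using xseg by blast
    have "segment (path_power f (max n n')) p t (cmp \<Lambda> (x (p, q)) (x (q, t)))"
      by (rule segment_cmp) (rule path_power_segment_mono[OF cyc], use n in auto)+
    moreover have "(p, t) \<in> Omega ?m" using pqt by (auto simp: Omega_def)
    ultimately show "x (p, t) = cmp \<Lambda> (x (p, q)) (x (q, t))" by (rule xI)
  next
    fix n :: nat
    \<comment> \<open>The last block of the power has nothing after it, so the identity at its
      source serves as the remainder that \<open>segment\<close> asks for.\<close>
    have "cmp \<Lambda> (path_power f n) (cmp \<Lambda> f (src \<Lambda> f)) = path_power f (Suc n)"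
      using cmp_id_right[OF f(1)] by simp
    moreover have "composable (path_power f n) f" "composable f (src \<Lambda> f)"
      using pp f by (auto simp: composable_def rng_closed rng_rng)
    moreover have "n *s ?d \<le> (n + 1) *s ?d" "?d = (n + 1) *s ?d - n *s ?d"
      by (auto simp: less_eq_vec_def vec_eq_iff)
    ultimately have "segment (path_power f (Suc n)) (n *s ?d) ((n + 1) *s ?d) f"
      unfolding segment_def using pp by metis
    moreover have "(n *s ?d, (n + 1) *s ?d) \<in> Omega ?m"
      using multiple_le_inf_power_deg[of "n + 1" f] by (auto simp: Omega_def less_eq_vec_def)
    ultimately show "x (n *s ?d, (n + 1) *s ?d) = f" by (rule xI)
  qed
  have seg: "segment (path_power f n) p q (y (p, q))" if y: "?Q y" and "p \<le> q" "q \<le> n *s ?d" for y p q n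
  proof -
    have yc: "y (p, t) = cmp \<Lambda> (y (p, q)) (y (q, t))" if "(p, q) \<in> Omega ?m" "(q, t) \<in> Omega ?m" for p q t
      using y that unfolding is_path_def by blast
    have ym: "y (p, q) \<in> Mor \<Lambda>" "deg \<Lambda> (y (p, q)) = q - p" "rng \<Lambda> (y (p, q)) = y (p, p)"
      "src \<Lambda> (y (p, q)) = y (q, q)" if "(p, q) \<in> Omega ?m" for p q
      using y that unfolding is_path_def by blast+
    have O: "(p, q) \<in> Omega ?m" if "p \<le> q" "q \<le> n *s ?d" for p q n
      using that multiple_le_inf_power_deg[of n f] unfolding Omega_def less_eq_vec_def
      by simp (meson enat_ord_simps(1) order_trans)
    have yf: "y (n *s ?d, (n + 1) *s ?d) = f" for n using y by blast
    \<comment> \<open>The blocks are concatenated by functoriality; the empty power is read off as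
      the range of block 0.\<close>
    have y0: "y (0, k *s ?d) = path_power f k" for k
    proof (induction k)
      case 0
      have "rng \<Lambda> (y (0, 1 *s ?d)) = y (0, 0)" by (rule ym(3), rule O[of _ _ 1]) (auto simp: less_eq_vec_def)
      moreover have "y (0, 1 *s ?d) = f" using yf[of 0] by (simp add: vec_eq_iff)
      ultimately show ?case by simp
    next
      case (Suc k)
      have "y (0, (k + 1) *s ?d) = cmp \<Lambda> (y (0, k *s ?d)) (y (k *s ?d, (k + 1) *s ?d))"
        by (rule yc, rule O[of _ _ k], auto simp: less_eq_vec_def,
            rule O[of _ _ "Suc k"], auto simp: less_eq_vec_def)
      then show ?case using Suc yf[of k] by simp
    qed
    have "path_power f n = cmp \<Lambda> (y (0, p)) (y (p, n *s ?d))"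
      unfolding y0[symmetric]
      by (rule yc; rule O[of _ _ n]) (use that in \<open>auto simp: less_eq_vec_def intro: order_trans\<close>)
    also have "y (p, n *s ?d) = cmp \<Lambda> (y (p, q)) (y (q, n *s ?d))"
      by (rule yc; rule O[of _ _ n]) (use that in \<open>auto simp: less_eq_vec_def intro: order_trans\<close>)
    finally have eq: "path_power f n = cmp \<Lambda> (y (0, p)) (cmp \<Lambda> (y (p, q)) (y (q, n *s ?d)))" .
    have "(0, p) \<in> Omega ?m" "(p, q) \<in> Omega ?m" "(q, n *s ?d) \<in> Omega ?m"
      by (rule O[of _ _ n]; use that in \<open>force simp: less_eq_vec_def intro: order_trans\<close>)+
    then have "composable (y (0, p)) (y (p, q))" "composable (y (p, q)) (y (q, n *s ?d))"
      "deg \<Lambda> (y (0, p)) = p" "deg \<Lambda> (y (p, q)) = q - p"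
      using ym by (auto simp: composable_def vec_eq_iff)
    then show ?thesis unfolding segment_def using eq that(2) by blast
  qed
  show ex1: "\<exists>!x. ?Q x"
  proof (rule ex1I)
    show "?Q x" by (rule xQ)
    fix y assume y: "?Q y"
    show "y = x"
    proof (rule extensionalityI)
      show "y \<in> extensional (Omega ?m)" "x \<in> extensional (Omega ?m)"
        using y xQ by (auto simp: is_path_def)
      fix pq assume pq: "pq \<in> Omega ?m"
      obtain p q where [simp]: "pq = (p, q)" by force
      obtain n where "q \<le> n *s ?d" using le_multiple_deg pq by (auto simp: Omega_def)
      then have "segment (path_power f n) p q (y (p, q))"
        using seg[OF y] pq by (auto simp: Omega_def)
      then show "y pq = x pq" using xI pq by auto
    qed
  qed
  have "?Q (inf_power \<Lambda> f)" unfolding inf_power_def by (rule theI'[OF ex1])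
  then show "p \<le> q \<Longrightarrow> q \<le> n *s ?d \<Longrightarrow> segment (path_power f n) p q (inf_power \<Lambda> f (p, q))"
    using seg by blast
qed

text \<open>This replaces the infinite path by a finite one: \<open>a\<close> is a power of the
  cycle long enough to be cut at the degree of \<open>t\<close>, and \<open>b\<close> is its initial
  piece there, which the entrance \<open>t\<close> is known to avoid.\<close>

lemma entrance_branching:
  assumes cyc: "is_cycle \<Lambda> f" and "has_entrance \<Lambda> f"
  obtains a t b c where "a \<in> Mor \<Lambda>" "rng \<Lambda> a = rng \<Lambda> f" "src \<Lambda> a = rng \<Lambda> f" "t \<in> Mor \<Lambda>" "rng \<Lambda> t = rng \<Lambda> f"
    "b \<in> Mor \<Lambda>" "c \<in> Mor \<Lambda>" "src \<Lambda> b = rng \<Lambda> c" "a = cmp \<Lambda> b c" "deg \<Lambda> b = deg \<Lambda> t" "b \<noteq> t"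
proof -
  obtain t where t: "t \<in> Mor \<Lambda>" "rng \<Lambda> t = rng \<Lambda> f" "vec_enat (deg \<Lambda> t) \<le> inf_power_deg \<Lambda> f"
    "t \<noteq> inf_power \<Lambda> f (0, deg \<Lambda> t)"
    using assms by (auto simp: has_entrance_def with_range_def)
  obtain n where n: "deg \<Lambda> t \<le> n *s deg \<Lambda> f" using le_multiple_deg[OF t(3)] by blast
  let ?b = "inf_power \<Lambda> f (0, deg \<Lambda> t)"
  have "segment (path_power f n) 0 (deg \<Lambda> t) ?b"
    using inf_power_segment(2)[OF cyc _ n] by (auto simp: less_eq_vec_def)
  then obtain h c where *: "composable h ?b" "composable ?b c" "deg \<Lambda> h = 0" "deg \<Lambda> ?b = deg \<Lambda> t"
    "path_power f n = cmp \<Lambda> h (cmp \<Lambda> ?b c)"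
    unfolding segment_def by (auto simp: vec_eq_iff)
  \<comment> \<open>A path of degree 0 is an identity, so the segment starting at 0 is a genuine
    initial factor.\<close>
  have h: "h = rng \<Lambda> ?b" using * vertex_id[of h] by (auto simp: composable_def paths_deg_def)
  have "path_power f n = cmp \<Lambda> ?b c"
    using * cmp_id_left[of "cmp \<Lambda> ?b c"] by (simp add: h composable_def cmp_closed rng_cmp)
  with * t show ?thesis
    by (intro that[of "path_power f n" t ?b c] path_power[OF cyc]) (auto simp: composable_def)
qed

end

section \<open>Bounded operators on $\ell^2$\<close>

abbreviation l2n :: "('i \<Rightarrow> complex) \<Rightarrow> 'i set \<Rightarrow> real" where
  "l2n x F \<equiv> L2_set (\<lambda>i. cmod (x i)) F"

text \<open>Bounded operators are coded as infinite matrices, because the universal property only tests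
  algebras carried by \<open>nat \<Rightarrow> nat \<Rightarrow> complex\<close>. Boundedness is tested on finitely supported
  vectors.\<close>

definition bounded_by :: "(nat \<Rightarrow> nat \<Rightarrow> complex) \<Rightarrow> real \<Rightarrow> bool" where
  "bounded_by M C \<longleftrightarrow> 0 \<le> C \<and> (\<forall>F G x y. finite F \<longrightarrow> finite G \<longrightarrow>
     cmod (\<Sum>i\<in>F. \<Sum>j\<in>G. y i * M i j * x j) \<le> C * l2n y F * l2n x G)"

definition l2_ops :: "(nat \<Rightarrow> nat \<Rightarrow> complex) set" where
  "l2_ops = {M. \<exists>C. bounded_by M C}"

definition op_norm :: "(nat \<Rightarrow> nat \<Rightarrow> complex) \<Rightarrow> real" where
  "op_norm M = Inf {C. bounded_by M C}"

text \<open>For bounded matrices each series converges absolutely, because rows and columns are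
  square summable (\<open>mat_comp_sums\<close>). For other matrices the value carries no
  meaning.\<close>

definition mat_comp :: "(nat \<Rightarrow> nat \<Rightarrow> complex) \<Rightarrow> (nat \<Rightarrow> nat \<Rightarrow> complex) \<Rightarrow> nat \<Rightarrow> nat \<Rightarrow> complex" where
  "mat_comp M N = (\<lambda>i j. \<Sum>k. M i k * N k j)"

definition mat_star :: "(nat \<Rightarrow> nat \<Rightarrow> complex) \<Rightarrow> nat \<Rightarrow> nat \<Rightarrow> complex" where
  "mat_star M = (\<lambda>i j. cnj (M j i))"

lemma bounded_byD:
  assumes "bounded_by M C" "finite F" "finite G"
  shows "cmod (\<Sum>i\<in>F. \<Sum>j\<in>G. y i * M i j * x j) \<le> C * l2n y F * l2n x G"
  using assms unfolding bounded_by_def by blast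

lemma sum_le_l2n: "cmod (\<Sum>i\<in>F. x i * y i) \<le> l2n x F * l2n y F"
proof -
  have "cmod (\<Sum>i\<in>F. x i * y i) \<le> (\<Sum>i\<in>F. \<bar>cmod (x i)\<bar> * \<bar>cmod (y i)\<bar>)"
    by (rule order_trans[OF norm_sum]) (simp add: norm_mult)
  also have "\<dots> \<le> l2n x F * l2n y F" by (rule L2_set_mult_ineq)
  finally show ?thesis .
qed

text \<open>The passage from forms to vectors tests the form against the conjugate of the image
  vector itself: this gives the square of its norm on the left and one factor of its norm on the
  right.\<close>

lemma bounded_by_iff:
  "bounded_by M C \<longleftrightarrow> 0 \<le> C \<and> (\<forall>F G x. finite F \<longrightarrow> finite G \<longrightarrow>
     l2n (\<lambda>i. \<Sum>j\<in>G. M i j * x j) F \<le> C * l2n x G)" (is "_ \<longleftrightarrow> 0 \<le> C \<and> ?R")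
proof (intro iffI conjI allI impI)
  assume M: "bounded_by M C"
  then show "0 \<le> C" by (simp add: bounded_by_def)
  fix F G :: "nat set" and x assume fin: "finite F" "finite G"
  define w where "w = (\<lambda>i. \<Sum>j\<in>G. M i j * x j)"
  have "complex_of_real ((l2n w F)\<^sup>2) = (\<Sum>i\<in>F. cnj (w i) * w i)"
    by (simp add: L2_set_def sum_nonneg complex_norm_square mult.commute del: of_real_power)
  also have "\<dots> = (\<Sum>i\<in>F. \<Sum>j\<in>G. cnj (w i) * M i j * x j)"
    by (simp add: w_def sum_distrib_left mult.assoc)
  finally have "(l2n w F)\<^sup>2 = cmod (\<Sum>i\<in>F. \<Sum>j\<in>G. cnj (w i) * M i j * x j)"
    by (metis abs_of_nonneg norm_of_real zero_le_power2)
  also have "\<dots> \<le> C * l2n w F * l2n x G"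
    using bounded_byD[OF M fin, of "\<lambda>i. cnj (w i)" x] by simp
  finally have "l2n w F * l2n w F \<le> l2n w F * (C * l2n x G)"
    by (simp add: power2_eq_square mult_ac)
  moreover have "0 \<le> l2n w F" "0 \<le> C * l2n x G" using \<open>0 \<le> C\<close> by auto
  ultimately show "l2n w F \<le> C * l2n x G"
    by (metis mult_left_le_imp_le order_le_less)
next
  assume R: "0 \<le> C \<and> ?R"
  show "bounded_by M C" unfolding bounded_by_def
  proof (intro conjI allI impI)
    fix F G :: "nat set" and x y assume fin: "finite F" "finite G"
    have "cmod (\<Sum>i\<in>F. \<Sum>j\<in>G. y i * M i j * x j) = cmod (\<Sum>i\<in>F. y i * (\<Sum>j\<in>G. M i j * x j))"
      by (simp add: sum_distrib_left mult.assoc)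
    also have "\<dots> \<le> l2n y F * l2n (\<lambda>i. \<Sum>j\<in>G. M i j * x j) F" by (rule sum_le_l2n)
    also have "\<dots> \<le> l2n y F * (C * l2n x G)" using R fin by (intro mult_left_mono) auto
    finally show "cmod (\<Sum>i\<in>F. \<Sum>j\<in>G. y i * M i j * x j) \<le> C * l2n y F * l2n x G"
      by (simp add: mult_ac)
  qed (use R in auto)
qed

lemma bounded_by_apply:
  assumes "bounded_by M C" "finite F" "finite G"
  shows "l2n (\<lambda>i. \<Sum>j\<in>G. M i j * x j) F \<le> C * l2n x G"
  using assms by (simp add: bounded_by_iff)

lemma bounded_by_star: "bounded_by M C \<Longrightarrow> bounded_by (mat_star M) C"
  unfolding bounded_by_def
proof (elim conjE, intro conjI allI impI)
  fix F G :: "nat set" and x y :: "nat \<Rightarrow> complex"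
  assume H: "\<forall>F G x y. finite F \<longrightarrow> finite G \<longrightarrow>
     cmod (\<Sum>i\<in>F. \<Sum>j\<in>G. y i * M i j * x j) \<le> C * l2n y F * l2n x G" and fin: "finite F" "finite G"
  have "cnj (\<Sum>i\<in>F. \<Sum>j\<in>G. y i * mat_star M i j * x j) =
      (\<Sum>i\<in>F. \<Sum>j\<in>G. cnj (x j) * M j i * cnj (y i))"
    by (simp add: mat_star_def cnj_sum mult_ac)
  also have "\<dots> = (\<Sum>j\<in>G. \<Sum>i\<in>F. cnj (x j) * M j i * cnj (y i))" by (rule sum.swap)
  finally have "cmod (\<Sum>i\<in>F. \<Sum>j\<in>G. y i * mat_star M i j * x j) =
      cmod (\<Sum>j\<in>G. \<Sum>i\<in>F. cnj (x j) * M j i * cnj (y i))" by (metis complex_mod_cnj)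
  also have "\<dots> \<le> C * l2n (\<lambda>i. cnj (x i)) G * l2n (\<lambda>i. cnj (y i)) F"
    using H[rule_format, of G F "\<lambda>i. cnj (x i)" "\<lambda>i. cnj (y i)"] fin by blast
  finally show "cmod (\<Sum>i\<in>F. \<Sum>j\<in>G. y i * mat_star M i j * x j) \<le> C * l2n y F * l2n x G"
    by (simp add: mult_ac)
qed auto

lemma mat_star_star [simp]: "mat_star (mat_star M) = M"
  by (simp add: mat_star_def)

lemma bounded_by_add:
  assumes "bounded_by M C" "bounded_by N D"
  shows "bounded_by (\<lambda>i j. M i j + N i j) (C + D)"
  unfolding bounded_by_def
proof (intro conjI allI impI)
  show "0 \<le> C + D" using assms by (simp add: bounded_by_def)
  fix F G :: "nat set" and x y assume fin: "finite F" "finite G"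
  have "(\<Sum>i\<in>F. \<Sum>j\<in>G. y i * (M i j + N i j) * x j) =
    (\<Sum>i\<in>F. \<Sum>j\<in>G. y i * M i j * x j) + (\<Sum>i\<in>F. \<Sum>j\<in>G. y i * N i j * x j)"
    by (simp add: sum.distrib algebra_simps)
  then show "cmod (\<Sum>i\<in>F. \<Sum>j\<in>G. y i * (M i j + N i j) * x j) \<le> (C + D) * l2n y F * l2n x G"
    using bounded_byD[OF assms(1) fin, of y x] bounded_byD[OF assms(2) fin, of y x]
      norm_triangle_ineq[of "\<Sum>i\<in>F. \<Sum>j\<in>G. y i * M i j * x j" "\<Sum>i\<in>F. \<Sum>j\<in>G. y i * N i j * x j"]
    by (simp add: algebra_simps)
qed

lemma bounded_by_smult:
  assumes "bounded_by M C"
  shows "bounded_by (\<lambda>i j. c * M i j) (cmod c * C)"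
  unfolding bounded_by_def
proof (intro conjI allI impI)
  show "0 \<le> cmod c * C" using assms by (simp add: bounded_by_def)
  fix F G :: "nat set" and x y assume fin: "finite F" "finite G"
  have "(\<Sum>i\<in>F. \<Sum>j\<in>G. y i * (c * M i j) * x j) = c * (\<Sum>i\<in>F. \<Sum>j\<in>G. y i * M i j * x j)"
    by (simp add: sum_distrib_left mult_ac)
  then show "cmod (\<Sum>i\<in>F. \<Sum>j\<in>G. y i * (c * M i j) * x j) \<le> cmod c * C * l2n y F * l2n x G"
    using mult_left_mono[OF bounded_byD[OF assms fin, of y x], of "cmod c"]
    by (simp add: norm_mult mult_ac)
qed

lemma entry_le:
  assumes "bounded_by M C"
  shows "cmod (M i j) \<le> C"
  using bounded_byD[OF assms, of "{i}" "{j}" "\<lambda>_. 1" "\<lambda>_. 1"] by simp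

text \<open>The infimum is attained, since for fixed finite sets and vectors the bound is a closed
  condition on \<open>C\<close>. When the product of the vector norms is zero one cannot divide by
  it, but then any admissible \<open>C\<close> shows that the form vanishes.\<close>

lemma bounded_by_op_norm:
  assumes "M \<in> l2_ops"
  shows "bounded_by M (op_norm M)"
  unfolding bounded_by_def
proof (intro conjI allI impI)
  have ne: "{C. bounded_by M C} \<noteq> {}" using assms by (auto simp: l2_ops_def)
  show "0 \<le> op_norm M" unfolding op_norm_def
    by (rule cInf_greatest[OF ne]) (auto simp: bounded_by_def)
  fix F G :: "nat set" and x y assume fin: "finite F" "finite G"
  let ?p = "l2n y F * l2n x G" and ?s = "cmod (\<Sum>i\<in>F. \<Sum>j\<in>G. y i * M i j * x j)"
  have le: "?s \<le> C * ?p" if "bounded_by M C" for C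
    using bounded_byD[OF that fin, of y x] by (simp add: mult.assoc)
  have p: "0 \<le> ?p" by simp
  have "?s \<le> op_norm M * ?p"
  proof (cases "?p = 0")
    case True
    then show ?thesis using ne le by auto
  next
    case False
    then have "?s / ?p \<le> op_norm M" unfolding op_norm_def
    proof (intro cInf_greatest[OF ne])
      fix C assume "C \<in> {C. bounded_by M C}"
      moreover have "0 < ?p" using False p by linarith
      ultimately show "?s / ?p \<le> C" using le by (simp add: pos_divide_le_eq)
    qed
    moreover have "0 < ?p" using False p by linarith
    ultimately show ?thesis by (simp add: pos_divide_le_eq)
  qed
  then show "?s \<le> op_norm M * l2n y F * l2n x G" by (simp add: mult.assoc)
qed

lemma op_norm_le: "bounded_by M C \<Longrightarrow> op_norm M \<le> C"
  unfolding op_norm_def by (rule cInf_lower) (auto simp: bdd_below_def bounded_by_def)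

lemma op_norm_nonneg: "M \<in> l2_ops \<Longrightarrow> 0 \<le> op_norm M"
  using bounded_by_op_norm by (auto simp: bounded_by_def)

lemma l2_opsI: "bounded_by M C \<Longrightarrow> M \<in> l2_ops"
  by (auto simp: l2_ops_def)

lemma l2n_column:
  assumes "bounded_by M C" "finite F"
  shows "l2n (\<lambda>i. M i j) F \<le> C"
  using bounded_by_apply[OF assms, of "{j}" "\<lambda>_. 1"] by simp

lemma l2n_row:
  assumes "bounded_by M C" "finite F"
  shows "l2n (\<lambda>j. M i j) F \<le> C"
  using l2n_column[OF bounded_by_star[OF assms(1)] assms(2), of i] by (simp add: mat_star_def)

section \<open>Products of bounded matrices\<close>

lemma summable_l2_mult:
  assumes "\<And>n. l2n f {..<n} \<le> C" "\<And>n. l2n g {..<n} \<le> D"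
  shows "summable (\<lambda>k. f k * g k :: complex)"
proof (rule summable_norm_cancel, rule summableI_nonneg_bounded)
  fix n
  have "(\<Sum>k<n. cmod (f k * g k)) = (\<Sum>k<n. \<bar>cmod (f k)\<bar> * \<bar>cmod (g k)\<bar>)"
    by (simp add: norm_mult)
  also have "\<dots> \<le> l2n f {..<n} * l2n g {..<n}" by (rule L2_set_mult_ineq)
  also have "\<dots> \<le> C * D"
    using assms by (intro mult_mono) (auto intro: order_trans[OF L2_set_nonneg])
  finally show "(\<Sum>k<n. cmod (f k * g k)) \<le> C * D" .
qed simp

lemma mat_comp_sums:
  assumes "M \<in> l2_ops" "N \<in> l2_ops"
  shows "(\<lambda>k. M i k * N k j) sums mat_comp M N i j"
  unfolding mat_comp_def
  by (rule summable_sums, rule summable_l2_mult)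
    (use l2n_row[OF bounded_by_op_norm[OF assms(1)]] l2n_column[OF bounded_by_op_norm[OF assms(2)]] in auto)

text \<open>Truncating the inner index turns the form of a product into a finite pairing of
  \<open>y M\<close> with \<open>N x\<close>. Norm estimates for products are proved for these
  pairings and then passed to the limit.\<close>

lemma mat_comp_form_limit:
  assumes "M \<in> l2_ops" "N \<in> l2_ops"
  shows "(\<lambda>n. \<Sum>k<n. (\<Sum>i\<in>F. y i * M i k) * (\<Sum>j\<in>G. N k j * x j))
    \<longlonglongrightarrow> (\<Sum>i\<in>F. \<Sum>j\<in>G. y i * mat_comp M N i j * x j)"
proof -
  have "(\<lambda>n. \<Sum>i\<in>F. \<Sum>j\<in>G. y i * (\<Sum>k<n. M i k * N k j) * x j)
    \<longlonglongrightarrow> (\<Sum>i\<in>F. \<Sum>j\<in>G. y i * mat_comp M N i j * x j)"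
    using mat_comp_sums[OF assms] unfolding sums_def by (intro tendsto_intros)
  moreover have "(\<Sum>i\<in>F. \<Sum>j\<in>G. y i * (\<Sum>k<n. M i k * N k j) * x j) =
    (\<Sum>k<n. (\<Sum>i\<in>F. y i * M i k) * (\<Sum>j\<in>G. N k j * x j))" for n
  proof -
    have "(\<Sum>k<n. (\<Sum>i\<in>F. y i * M i k) * (\<Sum>j\<in>G. N k j * x j)) =
        (\<Sum>k<n. \<Sum>i\<in>F. \<Sum>j\<in>G. y i * (M i k * N k j) * x j)"
      by (simp only: sum_product) (intro sum.cong refl, simp only: mult_ac)
    also have "\<dots> = (\<Sum>i\<in>F. \<Sum>k<n. \<Sum>j\<in>G. y i * (M i k * N k j) * x j)" by (rule sum.swap)
    also have "\<dots> = (\<Sum>i\<in>F. \<Sum>j\<in>G. \<Sum>k<n. y i * (M i k * N k j) * x j)"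
      by (intro sum.cong refl sum.swap)
    finally show ?thesis by (simp add: sum_distrib_left sum_distrib_right)
  qed
  ultimately show ?thesis by simp
qed

lemma bounded_by_transpose:
  assumes "bounded_by M C"
  shows "bounded_by (\<lambda>i j. M j i) C"
  unfolding bounded_by_def
proof (intro conjI allI impI)
  show "0 \<le> C" using assms by (simp add: bounded_by_def)
  fix F G :: "nat set" and x y :: "nat \<Rightarrow> complex" assume fin: "finite F" "finite G"
  have "(\<Sum>i\<in>F. \<Sum>j\<in>G. y i * M j i * x j) = (\<Sum>j\<in>G. \<Sum>i\<in>F. x j * M j i * y i)"
    by (subst sum.swap) (simp only: mult_ac)
  then show "cmod (\<Sum>i\<in>F. \<Sum>j\<in>G. y i * M j i * x j) \<le> C * l2n y F * l2n x G"
    using bounded_byD[OF assms fin(2,1), of x y] by (simp add: mult_ac)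
qed

lemma bounded_by_transpose_apply:
  assumes "bounded_by M C" "finite F" "finite G"
  shows "l2n (\<lambda>j. \<Sum>i\<in>G. y i * M i j) F \<le> C * l2n y G"
  using bounded_by_apply[OF bounded_by_transpose[OF assms(1)] assms(2,3), of y]
  by (simp add: mult.commute)

lemma bounded_by_mat_comp:
  assumes "bounded_by M C" "bounded_by N D"
  shows "bounded_by (mat_comp M N) (C * D)"
  unfolding bounded_by_def
proof (intro conjI allI impI)
  have CD: "0 \<le> C" "0 \<le> D" using assms by (auto simp: bounded_by_def)
  then show "0 \<le> C * D" by simp
  fix F G :: "nat set" and x y assume fin: "finite F" "finite G"
  show "cmod (\<Sum>i\<in>F. \<Sum>j\<in>G. y i * mat_comp M N i j * x j) \<le> C * D * l2n y F * l2n x G"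
  proof (rule LIMSEQ_le_const2)
    show "(\<lambda>n. cmod (\<Sum>k<n. (\<Sum>i\<in>F. y i * M i k) * (\<Sum>j\<in>G. N k j * x j)))
      \<longlonglongrightarrow> cmod (\<Sum>i\<in>F. \<Sum>j\<in>G. y i * mat_comp M N i j * x j)"
      by (intro tendsto_norm mat_comp_form_limit l2_opsI[OF assms(1)] l2_opsI[OF assms(2)])
    have "cmod (\<Sum>k<n. (\<Sum>i\<in>F. y i * M i k) * (\<Sum>j\<in>G. N k j * x j)) \<le> C * D * l2n y F * l2n x G" for n
    proof -
      have "cmod (\<Sum>k<n. (\<Sum>i\<in>F. y i * M i k) * (\<Sum>j\<in>G. N k j * x j))
        \<le> l2n (\<lambda>k. \<Sum>i\<in>F. y i * M i k) {..<n} * l2n (\<lambda>k. \<Sum>j\<in>G. N k j * x j) {..<n}"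
        by (rule sum_le_l2n)
      also have "\<dots> \<le> (C * l2n y F) * (D * l2n x G)"
        using CD fin by (intro mult_mono bounded_by_apply bounded_by_transpose_apply assms) auto
      finally show ?thesis by (simp add: mult_ac)
    qed
    then show "\<exists>N'. \<forall>n\<ge>N'. cmod (\<Sum>k<n. (\<Sum>i\<in>F. y i * M i k) * (\<Sum>j\<in>G. N k j * x j))
      \<le> C * D * l2n y F * l2n x G" by blast
  qed
qed

lemma l2_tail:
  fixes f :: "nat \<Rightarrow> complex"
  assumes "\<And>n. l2n f {..<n} \<le> C" "0 < e"
  shows "\<exists>N. \<forall>m\<ge>N. \<forall>n. l2n f {m..<n} < e"
proof -
  have "summable (\<lambda>k. (cmod (f k))\<^sup>2)"
  proof (rule summableI_nonneg_bounded)
    fix n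
    have "(\<Sum>k<n. (cmod (f k))\<^sup>2) = (l2n f {..<n})\<^sup>2" by (simp add: L2_set_def sum_nonneg)
    also have "\<dots> \<le> C\<^sup>2" using assms(1) by (intro power_mono) auto
    finally show "(\<Sum>k<n. (cmod (f k))\<^sup>2) \<le> C\<^sup>2" .
  qed simp
  moreover have "0 < e\<^sup>2" using assms(2) by simp
  ultimately obtain N where N: "norm (\<Sum>k=m..<n. (cmod (f k))\<^sup>2) < e\<^sup>2" if "m \<ge> N" for m n
    unfolding summable_Cauchy by blast
  have "l2n f {m..<n} < e" if "m \<ge> N" for m n
  proof -
    have "(\<Sum>k=m..<n. (cmod (f k))\<^sup>2) < e\<^sup>2" using N[OF that, of n] by (simp add: sum_nonneg)
    then have "sqrt (\<Sum>k=m..<n. (cmod (f k))\<^sup>2) < sqrt (e\<^sup>2)" by (rule real_sqrt_less_mono)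
    then show ?thesis using assms(2) by (simp add: L2_set_def)
  qed
  then show ?thesis by blast
qed

text \<open>The double sum need not converge absolutely, so each iterated sum is compared with the
  square partial sums.\<close>

lemma iterated_sum_square_limit:
  assumes N: "bounded_by N C" and a: "\<And>n. l2n a {..<n} \<le> A" and b: "\<And>n. l2n b {..<n} \<le> B"
    and c: "\<And>k. (\<lambda>l. a l * N l k) sums c k"
  shows "(\<lambda>m. (\<Sum>k<m. c k * b k) - (\<Sum>l<m. \<Sum>k<m. a l * N l k * b k)) \<longlonglongrightarrow> 0"
proof (rule LIMSEQ_I)
  fix e :: real assume e: "0 < e"
  have C: "0 \<le> C" and B: "0 \<le> B"
    using N b[of 0] by (auto simp: bounded_by_def)
  \<comment> \<open>Chosen so that \<open>C * d * B\<close> is below \<open>e\<close>; the added 1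
    covers the case where \<open>C * B\<close> is zero.\<close>
  define d where "d = e / (2 * (C * B + 1))"
  have "0 < d" using e C B by (simp add: d_def add_nonneg_pos)
  then obtain m0 where m0: "\<And>m n. m \<ge> m0 \<Longrightarrow> l2n a {m..<n} < d" using l2_tail[OF a] by blast
  \<comment> \<open>With \<open>m\<close> fixed, \<open>c k\<close> is itself a limit of sums over
    \<open>l < n\<close>. The excess over the square is the form of \<open>N\<close> on the tail of
    \<open>a\<close> beyond \<open>m\<close>, which is small uniformly in \<open>n\<close>.\<close>
  have "norm ((\<Sum>k<m. c k * b k) - (\<Sum>l<m. \<Sum>k<m. a l * N l k * b k)) \<le> C * d * B" if "m \<ge> m0" for m
  proof (rule LIMSEQ_le_const2)
    have "(\<lambda>n. (\<Sum>k<m. (\<Sum>l<n. a l * N l k) * b k) - (\<Sum>l<m. \<Sum>k<m. a l * N l k * b k))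
      \<longlonglongrightarrow> (\<Sum>k<m. c k * b k) - (\<Sum>l<m. \<Sum>k<m. a l * N l k * b k)"
      using c unfolding sums_def by (intro tendsto_intros)
    moreover have "(\<Sum>k<m. (\<Sum>l<n. a l * N l k) * b k) = (\<Sum>l<n. \<Sum>k<m. a l * N l k * b k)" for n
      by (simp add: sum_distrib_right) (rule sum.swap)
    ultimately have L: "(\<lambda>n. (\<Sum>l<n. \<Sum>k<m. a l * N l k * b k) - (\<Sum>l<m. \<Sum>k<m. a l * N l k * b k))
      \<longlonglongrightarrow> (\<Sum>k<m. c k * b k) - (\<Sum>l<m. \<Sum>k<m. a l * N l k * b k)" by simp
    show "(\<lambda>n. norm ((\<Sum>l<n. \<Sum>k<m. a l * N l k * b k) - (\<Sum>l<m. \<Sum>k<m. a l * N l k * b k)))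
      \<longlonglongrightarrow> norm ((\<Sum>k<m. c k * b k) - (\<Sum>l<m. \<Sum>k<m. a l * N l k * b k))"
      by (rule tendsto_norm[OF L])
    have "norm ((\<Sum>l<n. \<Sum>k<m. a l * N l k * b k) - (\<Sum>l<m. \<Sum>k<m. a l * N l k * b k)) \<le> C * d * B"
      if "n \<ge> m" for n
    proof -
      have "(\<Sum>l<n. \<Sum>k<m. a l * N l k * b k) - (\<Sum>l<m. \<Sum>k<m. a l * N l k * b k)
        = (\<Sum>l\<in>{m..<n}. \<Sum>k<m. a l * N l k * b k)"
        using that sum_diff_nat_ivl[of 0 m n "\<lambda>l. \<Sum>k<m. a l * N l k * b k"]
        by (simp add: atLeast0LessThan)
      moreover have "norm (\<Sum>l\<in>{m..<n}. \<Sum>k<m. a l * N l k * b k) \<le> C * l2n a {m..<n} * l2n b {..<m}"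
        by (rule bounded_byD[OF N]) auto
      moreover have "C * l2n a {m..<n} * l2n b {..<m} \<le> C * d * B"
        using m0[OF \<open>m \<ge> m0\<close>, of n] b[of m] C \<open>0 < d\<close> by (intro mult_mono) auto
      ultimately show ?thesis by simp
    qed
    then show "\<exists>n0. \<forall>n\<ge>n0. norm ((\<Sum>l<n. \<Sum>k<m. a l * N l k * b k) - (\<Sum>l<m. \<Sum>k<m. a l * N l k * b k))
      \<le> C * d * B" by blast
  qed
  moreover have "C * d * B < e"
  proof -
    have p: "0 < C * B + 1" using C B by (simp add: add_nonneg_pos)
    have "C * d * B = C * B * d" by simp
    also have "\<dots> \<le> (C * B + 1) * d" using \<open>0 < d\<close> by (simp add: distrib_right)
    also have "\<dots> = e / 2" using p by (simp add: d_def field_simps)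
    finally show ?thesis using e by simp
  qed
  ultimately have "norm ((\<Sum>k<m. c k * b k) - (\<Sum>l<m. \<Sum>k<m. a l * N l k * b k) - 0) < e" if "m \<ge> m0" for m
    using that order_le_less_trans by (simp only: diff_zero) blast
  then show "\<exists>m0. \<forall>m\<ge>m0. norm ((\<Sum>k<m. c k * b k) - (\<Sum>l<m. \<Sum>k<m. a l * N l k * b k) - 0) < e"
    by blast
qed

lemma mat_comp_closed: "M \<in> l2_ops \<Longrightarrow> N \<in> l2_ops \<Longrightarrow> mat_comp M N \<in> l2_ops"
  using bounded_by_mat_comp[OF bounded_by_op_norm bounded_by_op_norm] l2_opsI by blast

lemma mat_comp_assoc:
  assumes "M \<in> l2_ops" "N \<in> l2_ops" "P \<in> l2_ops"
  shows "mat_comp (mat_comp M N) P = mat_comp M (mat_comp N P)"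
proof (intro ext)
  fix i j
  note bM = bounded_by_op_norm[OF assms(1)] and bN = bounded_by_op_norm[OF assms(2)]
    and bP = bounded_by_op_norm[OF assms(3)]
  let ?Q = "\<lambda>m. \<Sum>l<m. \<Sum>k<m. M i l * N l k * P k j"
  have "(\<lambda>m. (\<Sum>k<m. mat_comp M N i k * P k j) - ?Q m) \<longlonglongrightarrow> 0"
    by (rule iterated_sum_square_limit[OF bN l2n_row[OF bM] l2n_column[OF bP]])
      (auto intro: mat_comp_sums assms)
  moreover have "(\<lambda>m. \<Sum>k<m. mat_comp M N i k * P k j) \<longlonglongrightarrow> mat_comp (mat_comp M N) P i j"
    using mat_comp_sums[OF mat_comp_closed[OF assms(1,2)] assms(3)] by (simp add: sums_def)
  ultimately have 1: "?Q \<longlonglongrightarrow> mat_comp (mat_comp M N) P i j"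
    using tendsto_diff by fastforce
  \<comment> \<open>In the other bracketing the inner sum runs over the second index of
    \<open>N\<close>, so the same lemma is applied to the transpose of \<open>N\<close> with the
    roles of row and column exchanged.\<close>
  have "(\<lambda>m. (\<Sum>k<m. mat_comp N P k j * M i k) - (\<Sum>l<m. \<Sum>k<m. P l j * N k l * M i k)) \<longlonglongrightarrow> 0"
    by (rule iterated_sum_square_limit[OF bounded_by_transpose[OF bN] l2n_column[OF bP] l2n_row[OF bM]])
      (auto simp: mult.commute[of "P _ _"] intro: mat_comp_sums assms)
  moreover have "(\<Sum>l<m. \<Sum>k<m. P l j * N k l * M i k) = ?Q m" for m
    by (subst sum.swap) (simp only: mult_ac)
  moreover have "(\<lambda>m. \<Sum>k<m. mat_comp N P k j * M i k) \<longlonglongrightarrow> mat_comp M (mat_comp N P) i j"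
    using mat_comp_sums[OF assms(1) mat_comp_closed[OF assms(2,3)]] by (simp add: sums_def mult.commute)
  ultimately have 2: "?Q \<longlonglongrightarrow> mat_comp M (mat_comp N P) i j"
    using tendsto_diff by fastforce
  show "mat_comp (mat_comp M N) P i j = mat_comp M (mat_comp N P) i j"
    by (rule LIMSEQ_unique[OF 1 2])
qed

text \<open>The squared norm of \<open>M x\<close> is the form of \<open>mat_star M\<close> times
  \<open>M\<close> at \<open>x\<close>. This is the hard half of the \<open>C*\<close>-identity.
  Partial sums over \<open>F\<close> are dominated by the full series because its terms are
  nonnegative.\<close>

lemma bounded_by_star_comp_self:
  assumes M: "M \<in> l2_ops" and C: "bounded_by (mat_comp (mat_star M) M) C"
  shows "bounded_by M (sqrt C)"
  unfolding bounded_by_iff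
proof (intro conjI allI impI)
  show "0 \<le> sqrt C" using C by (simp add: bounded_by_def)
  fix F G :: "nat set" and x assume fin: "finite F" "finite G"
  have sM: "mat_star M \<in> l2_ops" using M bounded_by_star l2_ops_def by blast
  let ?w = "\<lambda>k. \<Sum>j\<in>G. M k j * x j"
  let ?v = "\<Sum>i\<in>G. \<Sum>j\<in>G. cnj (x i) * mat_comp (mat_star M) M i j * x j"
  have "(\<lambda>n. \<Sum>k<n. (\<Sum>i\<in>G. cnj (x i) * mat_star M i k) * ?w k) \<longlonglongrightarrow> ?v"
    by (rule mat_comp_form_limit[OF sM M])
  moreover have "(\<Sum>i\<in>G. cnj (x i) * mat_star M i k) * ?w k = complex_of_real ((cmod (?w k))\<^sup>2)" for k
  proof -
    have "(\<Sum>i\<in>G. cnj (x i) * mat_star M i k) = cnj (?w k)" by (simp add: mat_star_def mult.commute)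
    then show ?thesis by (metis complex_norm_square mult.commute)
  qed
  ultimately have "(\<lambda>n. \<Sum>k<n. complex_of_real ((cmod (?w k))\<^sup>2)) \<longlonglongrightarrow> ?v" by simp
  from tendsto_norm[OF this]
  have L: "(\<lambda>n. \<Sum>k<n. (cmod (?w k))\<^sup>2) \<longlonglongrightarrow> cmod ?v"
    by (simp add: sum_nonneg flip: of_real_sum of_real_power)
  obtain n0 where n0: "F \<subseteq> {..<n0}" using fin(1) finite_nat_iff_bounded by blast
  have "(l2n ?w F)\<^sup>2 = (\<Sum>k\<in>F. (cmod (?w k))\<^sup>2)" by (simp add: L2_set_def sum_nonneg)
  also have "\<dots> \<le> cmod ?v"
  proof (rule LIMSEQ_le_const[OF L], intro exI allI impI)
    fix n assume "n0 \<le> n"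
    then have "F \<subseteq> {..<n}" using n0 by auto
    then show "(\<Sum>k\<in>F. (cmod (?w k))\<^sup>2) \<le> (\<Sum>k<n. (cmod (?w k))\<^sup>2)"
      by (intro sum_mono2) auto
  qed
  also have "\<dots> \<le> C * l2n x G * l2n x G"
    using bounded_byD[OF C fin(2) fin(2), of "\<lambda>i. cnj (x i)" x] by simp
  finally have "sqrt ((l2n ?w F)\<^sup>2) \<le> sqrt (C * (l2n x G)\<^sup>2)"
    by (intro real_sqrt_le_mono) (simp add: power2_eq_square mult_ac)
  then show "l2n ?w F \<le> sqrt C * l2n x G" by (simp add: real_sqrt_mult)
qed

text \<open>Entries are dominated by the norm, so the limit is taken entrywise. A bound on forms
  involves finitely many entries at a time and therefore passes from \<open>f n - f m\<close> to
  \<open>f n - a\<close>, which upgrades entrywise convergence to convergence in norm.\<close>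

lemma l2_ops_complete:
  assumes f: "\<And>n. f n \<in> l2_ops"
    and cauchy: "\<And>e. 0 < e \<Longrightarrow> \<exists>N. \<forall>m\<ge>N. \<forall>n\<ge>N. op_norm (\<lambda>i j. f m i j - f n i j) < e"
  shows "\<exists>a\<in>l2_ops. (\<lambda>n::nat. op_norm (\<lambda>i j. f n i j - a i j)) \<longlonglongrightarrow> 0"
proof -
  have diff: "(\<lambda>i j. M i j - N i j) \<in> l2_ops" if "M \<in> l2_ops" "N \<in> l2_ops" for M N
    using l2_opsI[OF bounded_by_add[OF bounded_by_op_norm[OF that(1)] bounded_by_smult[OF bounded_by_op_norm[OF that(2)], of "-1"]]]
    by simp
  have "Cauchy (\<lambda>n. f n i j)" for i j
  proof (rule CauchyI)
    fix e :: real assume "0 < e"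
    then obtain N where N: "\<forall>m\<ge>N. \<forall>n\<ge>N. op_norm (\<lambda>i j. f m i j - f n i j) < e" using cauchy by blast
    have "cmod (f m i j - f n i j) < e" if "m \<ge> N" "n \<ge> N" for m n
      using entry_le[OF bounded_by_op_norm[OF diff[OF f[of m] f[of n]]], of i j] N that by force
    then show "\<exists>N. \<forall>m\<ge>N. \<forall>n\<ge>N. norm (f m i j - f n i j) < e" by blast
  qed
  then have conv: "(\<lambda>n. f n i j) \<longlonglongrightarrow> lim (\<lambda>n. f n i j)" for i j
    using Cauchy_convergent convergent_LIMSEQ_iff by blast
  define a where "a = (\<lambda>i j. lim (\<lambda>n. f n i j))"
  have a: "(\<lambda>n. f n i j) \<longlonglongrightarrow> a i j" for i j
    using conv by (simp add: a_def)
  have lim: "\<exists>N. \<forall>n\<ge>N. bounded_by (\<lambda>i j. f n i j - a i j) e" if e: "0 < e" for e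
  proof -
    obtain N where N: "\<forall>m\<ge>N. \<forall>n\<ge>N. op_norm (\<lambda>i j. f m i j - f n i j) < e" using cauchy e by blast
    have "bounded_by (\<lambda>i j. f n i j - a i j) e" if n: "n \<ge> N" for n
      unfolding bounded_by_def
    proof (intro conjI allI impI)
      fix F G :: "nat set" and x y assume fin: "finite F" "finite G"
      show "cmod (\<Sum>i\<in>F. \<Sum>j\<in>G. y i * (f n i j - a i j) * x j) \<le> e * l2n y F * l2n x G"
      proof (rule LIMSEQ_le_const2)
        show "(\<lambda>m. cmod (\<Sum>i\<in>F. \<Sum>j\<in>G. y i * (f n i j - f m i j) * x j))
          \<longlonglongrightarrow> cmod (\<Sum>i\<in>F. \<Sum>j\<in>G. y i * (f n i j - a i j) * x j)"
          by (intro tendsto_intros a)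
        have "cmod (\<Sum>i\<in>F. \<Sum>j\<in>G. y i * (f n i j - f m i j) * x j) \<le> e * l2n y F * l2n x G"
          if "m \<ge> N" for m
        proof -
          have "op_norm (\<lambda>i j. f n i j - f m i j) * (l2n y F * l2n x G) \<le> e * (l2n y F * l2n x G)"
            using N n that by (intro mult_right_mono) (auto simp: less_imp_le)
          then show ?thesis
            using bounded_byD[OF bounded_by_op_norm[OF diff[OF f f]] fin, of y n m x]
            by (simp add: mult.assoc)
        qed
        then show "\<exists>M. \<forall>m\<ge>M. cmod (\<Sum>i\<in>F. \<Sum>j\<in>G. y i * (f n i j - f m i j) * x j)
          \<le> e * l2n y F * l2n x G" by blast
      qed
    qed (use e in simp)
    then show ?thesis by blast
  qed
  obtain n1 where "bounded_by (\<lambda>i j. f n1 i j - a i j) 1" using lim[of 1] by auto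
  then have "(\<lambda>i j. f n1 i j - a i j) \<in> l2_ops" by (rule l2_opsI)
  from diff[OF f[of n1] this] have "a \<in> l2_ops" by simp
  moreover have "(\<lambda>n. op_norm (\<lambda>i j. f n i j - a i j)) \<longlonglongrightarrow> 0"
  proof (rule LIMSEQ_I)
    fix e :: real assume "0 < e"
    then obtain N where N: "\<forall>n\<ge>N. bounded_by (\<lambda>i j. f n i j - a i j) (e / 2)" using lim[of "e / 2"] by auto
    have "norm (op_norm (\<lambda>i j. f n i j - a i j) - 0) < e" if "n \<ge> N" for n
      using op_norm_le N that op_norm_nonneg[OF diff[OF f \<open>a \<in> l2_ops\<close>], of n] \<open>0 < e\<close> by force
    then show "\<exists>N. \<forall>n\<ge>N. norm (op_norm (\<lambda>i j. f n i j - a i j) - 0) < e" by blast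
  qed
  ultimately show ?thesis by blast
qed

section \<open>The \<open>C*\<close>-algebra of bounded matrices\<close>

definition l2_algebra :: "(nat \<Rightarrow> nat \<Rightarrow> complex) cstar" where
  "l2_algebra = \<lparr>carrier = l2_ops, monoid.mult = mat_comp, one = (\<lambda>i j. 0), zero = (\<lambda>i j. 0),
     add = (\<lambda>M N i j. M i j + N i j), smult = (\<lambda>c M i j. c * M i j), adj = mat_star, nrm = op_norm\<rparr>"

lemma l2_algebra_simps [simp]:
  "carrier l2_algebra = l2_ops" "M \<otimes>\<^bsub>l2_algebra\<^esub> N = mat_comp M N"
  "\<zero>\<^bsub>l2_algebra\<^esub> = (\<lambda>i j. 0)" "M \<oplus>\<^bsub>l2_algebra\<^esub> N = (\<lambda>i j. M i j + N i j)"
  "c \<odot>\<^bsub>l2_algebra\<^esub> M = (\<lambda>i j. c * M i j)" "adj l2_algebra M = mat_star M"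
  "nrm l2_algebra M = op_norm M"
  by (simp_all add: l2_algebra_def)

lemma cring_complex_ring: "cring complex_ring"
proof (rule cringI)
  show "abelian_group complex_ring"
    by (rule abelian_groupI)
      (auto simp: complex_ring_def algebra_simps intro: exI[of _ "- x" for x] simp flip: eq_neg_iff_add_eq_0)
  show "comm_monoid complex_ring"
    by (rule comm_monoidI) (auto simp: complex_ring_def algebra_simps)
qed (auto simp: complex_ring_def algebra_simps)

lemma cstar_algebra_l2_algebra: "cstar_algebra l2_algebra"
proof -
  have add: "(\<lambda>i j. M i j + N i j) \<in> l2_ops" if "M \<in> l2_ops" "N \<in> l2_ops" for M N
    using l2_opsI[OF bounded_by_add[OF bounded_by_op_norm[OF that(1)] bounded_by_op_norm[OF that(2)]]] .
  have smult: "(\<lambda>i j. c * M i j) \<in> l2_ops" if "M \<in> l2_ops" for M c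
    using l2_opsI[OF bounded_by_smult[OF bounded_by_op_norm[OF that]]] .
  have star: "mat_star M \<in> l2_ops" if "M \<in> l2_ops" for M
    using l2_opsI[OF bounded_by_star[OF bounded_by_op_norm[OF that]]] .
  have zero: "(\<lambda>i j. 0) \<in> l2_ops"
    by (rule l2_opsI[of _ 0]) (simp add: bounded_by_def)
  note comp = mat_comp_closed mat_comp_sums
  have ab: "abelian_group l2_algebra"
  proof (rule abelian_groupI)
    fix M assume "M \<in> carrier l2_algebra"
    then show "\<exists>N\<in>carrier l2_algebra. N \<oplus>\<^bsub>l2_algebra\<^esub> M = \<zero>\<^bsub>l2_algebra\<^esub>"
      using smult[of M "-1"] by (auto intro!: bexI[of _ "\<lambda>i j. - M i j"])
  qed (auto simp: add zero algebra_simps)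
  interpret abelian_group l2_algebra by (rule ab)
  have mod: "Module.module complex_ring l2_algebra"
    by (rule moduleI[OF cring_complex_ring ab]) (auto simp: complex_ring_def smult algebra_simps)
  have neg: "\<ominus>\<^bsub>l2_algebra\<^esub> M = (\<lambda>i j. - M i j)" if "M \<in> l2_ops" for M
    using smult[OF that, of "-1"] that by (intro minus_equality) auto
  have diff: "M \<ominus>\<^bsub>l2_algebra\<^esub> N = (\<lambda>i j. M i j - N i j)" if "N \<in> l2_ops" for M N
    using that by (simp add: a_minus_def neg)
  show ?thesis
  proof (rule cstar_algebra.intro[OF mod], unfold_locales)
    fix M N P c
    assume M: "M \<in> carrier l2_algebra" and N: "N \<in> carrier l2_algebra"
    note M' = M[simplified] and N' = N[simplified]
    note MN = mat_comp_sums[OF M' N']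
    show "M \<otimes>\<^bsub>l2_algebra\<^esub> N \<in> carrier l2_algebra" using M' N' mat_comp_closed by simp
    show "c \<odot>\<^bsub>l2_algebra\<^esub> M \<otimes>\<^bsub>l2_algebra\<^esub> N = c \<odot>\<^bsub>l2_algebra\<^esub> (M \<otimes>\<^bsub>l2_algebra\<^esub> N)"
      using sums_unique[OF sums_mult[OF MN]] by (simp add: mat_comp_def mult.assoc fun_eq_iff)
    show "M \<otimes>\<^bsub>l2_algebra\<^esub> (c \<odot>\<^bsub>l2_algebra\<^esub> N) = c \<odot>\<^bsub>l2_algebra\<^esub> (M \<otimes>\<^bsub>l2_algebra\<^esub> N)"
      using sums_unique[OF sums_mult[OF MN]] by (simp add: mat_comp_def mult.left_commute fun_eq_iff)
    show "adj l2_algebra (M \<oplus>\<^bsub>l2_algebra\<^esub> N) = adj l2_algebra M \<oplus>\<^bsub>l2_algebra\<^esub> adj l2_algebra N"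
      by (simp add: mat_star_def)
    show "adj l2_algebra (M \<otimes>\<^bsub>l2_algebra\<^esub> N) = adj l2_algebra N \<otimes>\<^bsub>l2_algebra\<^esub> adj l2_algebra M"
    proof -
      have "(\<lambda>k. cnj (M j k * N k i)) sums cnj (mat_comp M N j i)" for i j
        using MN by (simp only: sums_cnj)
      then show ?thesis
        by (simp add: mat_comp_def mat_star_def fun_eq_iff mult.commute sums_unique)
    qed
    show "nrm l2_algebra (M \<oplus>\<^bsub>l2_algebra\<^esub> N) \<le> nrm l2_algebra M + nrm l2_algebra N"
      using op_norm_le[OF bounded_by_add[OF bounded_by_op_norm[OF M'] bounded_by_op_norm[OF N']]] by simp
    show "nrm l2_algebra (M \<otimes>\<^bsub>l2_algebra\<^esub> N) \<le> nrm l2_algebra M * nrm l2_algebra N"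
      using op_norm_le[OF bounded_by_mat_comp[OF bounded_by_op_norm[OF M'] bounded_by_op_norm[OF N']]] by simp
    assume P: "P \<in> carrier l2_algebra"
    note P' = P[simplified]
    show "M \<otimes>\<^bsub>l2_algebra\<^esub> N \<otimes>\<^bsub>l2_algebra\<^esub> P = M \<otimes>\<^bsub>l2_algebra\<^esub> (N \<otimes>\<^bsub>l2_algebra\<^esub> P)"
      using mat_comp_assoc M' N' P' by simp
    show "(M \<oplus>\<^bsub>l2_algebra\<^esub> N) \<otimes>\<^bsub>l2_algebra\<^esub> P =
      M \<otimes>\<^bsub>l2_algebra\<^esub> P \<oplus>\<^bsub>l2_algebra\<^esub> N \<otimes>\<^bsub>l2_algebra\<^esub> P"
      using sums_unique[OF sums_add[OF mat_comp_sums[OF M' P'] mat_comp_sums[OF N' P']]]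
      by (simp add: mat_comp_def distrib_right fun_eq_iff)
    show "P \<otimes>\<^bsub>l2_algebra\<^esub> (M \<oplus>\<^bsub>l2_algebra\<^esub> N) =
      P \<otimes>\<^bsub>l2_algebra\<^esub> M \<oplus>\<^bsub>l2_algebra\<^esub> P \<otimes>\<^bsub>l2_algebra\<^esub> N"
      using sums_unique[OF sums_add[OF mat_comp_sums[OF P' M'] mat_comp_sums[OF P' N']]]
      by (simp add: mat_comp_def distrib_left fun_eq_iff)
  next
    fix M c assume M: "M \<in> carrier l2_algebra"
    note M' = M[simplified]
    show "adj l2_algebra M \<in> carrier l2_algebra" using star M' by simp
    show "adj l2_algebra (adj l2_algebra M) = M" by simp
    show "adj l2_algebra (c \<odot>\<^bsub>l2_algebra\<^esub> M) = cnj c \<odot>\<^bsub>l2_algebra\<^esub> adj l2_algebra M"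
      by (simp add: mat_star_def)
    show "0 \<le> nrm l2_algebra M" using op_norm_nonneg M' by simp
    show "(nrm l2_algebra M = 0) = (M = \<zero>\<^bsub>l2_algebra\<^esub>)"
    proof
      assume "nrm l2_algebra M = 0"
      then show "M = \<zero>\<^bsub>l2_algebra\<^esub>" using entry_le[OF bounded_by_op_norm[OF M']] by (auto simp: fun_eq_iff)
    next
      assume "M = \<zero>\<^bsub>l2_algebra\<^esub>"
      then have "bounded_by M 0" by (simp add: bounded_by_def)
      then show "nrm l2_algebra M = 0" using op_norm_le op_norm_nonneg[OF M'] by force
    qed
    have le: "op_norm (\<lambda>i j. c * M i j) \<le> cmod c * op_norm M" if "M \<in> l2_ops" for M c
      using op_norm_le[OF bounded_by_smult[OF bounded_by_op_norm[OF that]]] .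
    show "nrm l2_algebra (c \<odot>\<^bsub>l2_algebra\<^esub> M) = cmod c * nrm l2_algebra M"
    proof (cases "c = 0")
      case True
      have "op_norm (\<lambda>i j. 0) \<le> 0" by (rule op_norm_le) (simp add: bounded_by_def)
      then show ?thesis using True op_norm_nonneg[OF zero] by simp
    next
      case False
      \<comment> \<open>The reverse inequality is the easy one applied to the scalar
        \<open>inverse c\<close>.\<close>
      have "op_norm M = op_norm (\<lambda>i j. inverse c * (c * M i j))" using False by (simp add: mult.assoc[symmetric])
      also have "\<dots> \<le> inverse (cmod c) * op_norm (\<lambda>i j. c * M i j)"
        using le[OF smult[OF M'], of "inverse c" c] by (simp add: norm_inverse)
      finally have "cmod c * op_norm M \<le> op_norm (\<lambda>i j. c * M i j)"
        using False by (simp add: field_simps)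
      then show ?thesis using le[OF M', of c] by simp
    qed
    have sle: "op_norm (mat_star M) \<le> op_norm M" using op_norm_le[OF bounded_by_star[OF bounded_by_op_norm[OF M']]] .
    let ?c = "op_norm (mat_comp (mat_star M) M)"
    have "?c \<le> op_norm (mat_star M) * op_norm M"
      using op_norm_le[OF bounded_by_mat_comp[OF bounded_by_op_norm[OF star[OF M']] bounded_by_op_norm[OF M']]] .
    also have "\<dots> \<le> op_norm M * op_norm M" by (rule mult_right_mono[OF sle op_norm_nonneg[OF M']])
    finally have 1: "?c \<le> (op_norm M)\<^sup>2" by (simp add: power2_eq_square)
    have cc: "mat_comp (mat_star M) M \<in> l2_ops" using mat_comp_closed star M' by blast
    have "op_norm M \<le> sqrt ?c"
      by (rule op_norm_le[OF bounded_by_star_comp_self[OF M' bounded_by_op_norm[OF cc]]])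
    then have "(op_norm M)\<^sup>2 \<le> ?c"
      using op_norm_nonneg[OF cc] op_norm_nonneg[OF M'] by (metis power_mono real_sqrt_pow2)
    with 1 show "nrm l2_algebra (adj l2_algebra M \<otimes>\<^bsub>l2_algebra\<^esub> M) = (nrm l2_algebra M)\<^sup>2" by simp
  next
    fix f :: "nat \<Rightarrow> _"
    assume f: "\<And>n. f n \<in> carrier l2_algebra"
      and c: "\<And>e. 0 < e \<Longrightarrow> \<exists>N. \<forall>m\<ge>N. \<forall>n\<ge>N. nrm l2_algebra (f m \<ominus>\<^bsub>l2_algebra\<^esub> f n) < e"
    have f': "f n \<in> l2_ops" for n using f by simp
    have "\<exists>a\<in>l2_ops. (\<lambda>n. op_norm (\<lambda>i j. f n i j - a i j)) \<longlonglongrightarrow> 0"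
      by (rule l2_ops_complete[OF f']) (use c diff[OF f'] in simp)
    then show "\<exists>a\<in>carrier l2_algebra. (\<lambda>n. nrm l2_algebra (f n \<ominus>\<^bsub>l2_algebra\<^esub> a)) \<longlonglongrightarrow> 0"
      using diff by fastforce
  qed
qed

section \<open>Partial isometries that permute basis vectors\<close>

definition rel_mat :: "(nat \<times> nat) set \<Rightarrow> nat \<Rightarrow> nat \<Rightarrow> complex" where
  "rel_mat R = (\<lambda>i j. of_bool ((i, j) \<in> R))"

text \<open>For a partial injection both projections are injective on its finite part
  \<open>S\<close>, so Cauchy-Schwarz over the pairs in \<open>S\<close> meets every coordinate of
  either vector at most once.\<close>

lemma rel_mat_closed:
  assumes "single_valued R" "single_valued (R\<inverse>)"
  shows "rel_mat R \<in> l2_ops"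
proof (rule l2_opsI[of _ 1])
  show "bounded_by (rel_mat R) 1" unfolding bounded_by_def
  proof (intro conjI allI impI)
    fix F G :: "nat set" and x y :: "nat \<Rightarrow> complex" assume fin: "finite F" "finite G"
    define S where "S = R \<inter> F \<times> G"
    have S: "finite S" using fin by (simp add: S_def)
    have "(\<Sum>i\<in>F. \<Sum>j\<in>G. y i * rel_mat R i j * x j) = (\<Sum>(i,j)\<in>F \<times> G. y i * rel_mat R i j * x j)"
      by (rule sum.cartesian_product)
    also have "\<dots> = (\<Sum>(i,j)\<in>S. y i * x j)"
      using fin by (intro sum.mono_neutral_cong_right) (auto simp: S_def rel_mat_def)
    finally have "cmod (\<Sum>i\<in>F. \<Sum>j\<in>G. y i * rel_mat R i j * x j) \<le> l2n (\<lambda>p. y (fst p)) S * l2n (\<lambda>p. x (snd p)) S"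
      using sum_le_l2n[of "\<lambda>p. y (fst p)" "\<lambda>p. x (snd p)" S] by (simp add: case_prod_beta)
    also have "\<dots> \<le> l2n y F * l2n x G"
    proof (intro mult_mono)
      have "inj_on fst S" "inj_on snd S"
        using assms by (auto simp: S_def inj_on_def single_valued_def)
      then have "l2n (\<lambda>p. y (fst p)) S = l2n y (fst ` S)" "l2n (\<lambda>p. x (snd p)) S = l2n x (snd ` S)"
        by (simp_all add: L2_set_def sum.reindex)
      moreover have "l2n y (fst ` S) \<le> l2n y F" "l2n x (snd ` S) \<le> l2n x G"
        unfolding L2_set_def using fin by (auto intro!: real_sqrt_le_mono sum_mono2 simp: S_def)
      ultimately show "l2n (\<lambda>p. y (fst p)) S \<le> l2n y F" "l2n (\<lambda>p. x (snd p)) S \<le> l2n x G" by auto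
    qed auto
    finally show "cmod (\<Sum>i\<in>F. \<Sum>j\<in>G. y i * rel_mat R i j * x j) \<le> 1 * l2n y F * l2n x G" by simp
  qed simp
qed

lemma rel_mat_star: "mat_star (rel_mat R) = rel_mat (R\<inverse>)"
  by (simp add: mat_star_def rel_mat_def fun_eq_iff)

text \<open>Single-valuedness leaves at most one nonzero term in each series, so the product again
  has entries 0 and 1.\<close>

lemma rel_mat_comp:
  assumes "single_valued R"
  shows "mat_comp (rel_mat R) (rel_mat S) = rel_mat (R O S)"
proof (intro ext)
  fix i j
  show "mat_comp (rel_mat R) (rel_mat S) i j = rel_mat (R O S) i j"
  proof (cases "\<exists>k. (i, k) \<in> R")
    case True
    then obtain k where k: "(i, k) \<in> R" by blast
    then have u: "(i, l) \<in> R \<longleftrightarrow> l = k" for l using assms by (auto simp: single_valued_def)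
    have "mat_comp (rel_mat R) (rel_mat S) i j = (\<Sum>l\<in>{k}. rel_mat R i l * rel_mat S l j)"
      unfolding mat_comp_def by (rule suminf_finite) (auto simp: rel_mat_def u)
    then show ?thesis by (auto simp: rel_mat_def u)
  next
    case False
    then show ?thesis by (auto simp: mat_comp_def rel_mat_def)
  qed
qed

lemma rel_mat_finsum:
  assumes "finite F" "disjoint_family_on R F"
    and "\<And>a. a \<in> F \<Longrightarrow> single_valued (R a) \<and> single_valued ((R a)\<inverse>)"
  shows "finsum l2_algebra (\<lambda>a. rel_mat (R a)) F = rel_mat (\<Union>a\<in>F. R a)"
proof -
  interpret cstar_algebra l2_algebra by (rule cstar_algebra_l2_algebra)
  show ?thesis
    using assms
  proof (induction F rule: finite_induct)
    case empty
    then show ?case by (simp add: rel_mat_def)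
  next
    case (insert a F)
    have d: "R a \<inter> (\<Union>b\<in>F. R b) = {}" using insert.hyps insert.prems(1)
      by (auto simp: disjoint_family_on_def)
    have "finsum l2_algebra (\<lambda>a. rel_mat (R a)) (insert a F) =
      rel_mat (R a) \<oplus>\<^bsub>l2_algebra\<^esub> finsum l2_algebra (\<lambda>a. rel_mat (R a)) F"
      using insert by (intro finsum_insert) (auto intro: rel_mat_closed)
    also have "finsum l2_algebra (\<lambda>a. rel_mat (R a)) F = rel_mat (\<Union>b\<in>F. R b)"
      using insert by (auto simp: disjoint_family_on_def)
    finally show ?case using d by (auto simp: rel_mat_def fun_eq_iff)
  qed
qed

section \<open>A nonzero Cuntz--Krieger family\<close>

lemma gen_le_iff: "a + gen i \<le> b \<longleftrightarrow> a \<le> b \<and> a $ i < b $ i" for a b :: "nat ^ 'k::finite"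
proof
  assume le: "a + gen i \<le> b"
  have "a $ j + (if j = i then 1 else 0) \<le> b $ j" for j
  proof -
    have "(a + gen i) $ j \<le> b $ j" using le unfolding less_eq_vec_def by blast
    then show ?thesis by (cases "j = i") (simp_all add: gen_def axis_def)
  qed
  from this[of i] add_leD1[OF this] show "a \<le> b \<and> a $ i < b $ i"
    by (auto simp: less_eq_vec_def)
next
  assume "a \<le> b \<and> a $ i < b $ i"
  then show "a + gen i \<le> b" by (auto simp: less_eq_vec_def gen_def axis_def)
qed

context k_graph
begin

section \<open>Paths that are maximal below a given degree\<close>

definition has_edge :: "'p \<Rightarrow> 'k \<Rightarrow> bool" where
  "has_edge v i \<longleftrightarrow> (\<exists>f\<in>Mor \<Lambda>. rng \<Lambda> f = v \<and> deg \<Lambda> f = gen i)"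

lemma has_edge_iff: "with_range \<Lambda> v (paths_deg \<Lambda> (gen i)) \<noteq> {} \<longleftrightarrow> has_edge v i"
  by (auto simp: with_range_def paths_deg_def has_edge_def)

lemma paths_le_iff:
  "f \<in> paths_le \<Lambda> n \<longleftrightarrow> f \<in> Mor \<Lambda> \<and> deg \<Lambda> f \<le> n \<and>
     (\<forall>i. deg \<Lambda> f $ i < n $ i \<longrightarrow> \<not> has_edge (src \<Lambda> f) i)"
  unfolding paths_le_def gen_le_iff by (auto simp flip: has_edge_iff)

lemma has_edge_rng:
  assumes "f \<in> Mor \<Lambda>" "0 < deg \<Lambda> f $ i"
  obtains g h where "g \<in> Mor \<Lambda>" "h \<in> Mor \<Lambda>" "src \<Lambda> g = rng \<Lambda> h" "f = cmp \<Lambda> g h" "deg \<Lambda> g = gen i"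
    "deg \<Lambda> f = gen i + deg \<Lambda> h" "rng \<Lambda> g = rng \<Lambda> f" "src \<Lambda> h = src \<Lambda> f" "has_edge (rng \<Lambda> f) i"
proof -
  have "gen i \<le> deg \<Lambda> f" using assms(2) gen_le_iff[of 0 i "deg \<Lambda> f"] by (auto simp: less_eq_vec_def)
  then obtain g h where gh: "g \<in> Mor \<Lambda>" "h \<in> Mor \<Lambda>" "src \<Lambda> g = rng \<Lambda> h" "f = cmp \<Lambda> g h" "deg \<Lambda> g = gen i"
    using factor_exists_le[OF assms(1)] by metis
  then show ?thesis using that[of g h] deg_cmp rng_cmp src_cmp by (auto simp: has_edge_def)
qed

text \<open>Local convexity carries an edge in direction \<open>i\<close> across one edge in another
  direction. Induction on the total length of \<open>f\<close> peels off its first edge and carries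
  the \<open>i\<close>-edge across the whole path.\<close>

lemma locally_convex_walk:
  assumes "locally_convex \<Lambda>" "f \<in> Mor \<Lambda>" "deg \<Lambda> f $ i = 0" "has_edge (rng \<Lambda> f) i"
  shows "has_edge (src \<Lambda> f) i"
  using assms(2-)
proof (induction "\<Sum>j\<in>UNIV. deg \<Lambda> f $ j" arbitrary: f rule: less_induct)
  case less
  show ?case
  proof (cases "\<exists>j. 0 < deg \<Lambda> f $ j")
    case False
    then have "f \<in> vertices \<Lambda>" using less by (auto simp: paths_deg_def vec_eq_iff)
    then show ?thesis using less vertex_id by simp
  next
    case True
    then obtain j where j: "0 < deg \<Lambda> f $ j" by blast
    then obtain g h where gh: "g \<in> Mor \<Lambda>" "h \<in> Mor \<Lambda>" "src \<Lambda> g = rng \<Lambda> h" "deg \<Lambda> g = gen j"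
      "deg \<Lambda> f = gen j + deg \<Lambda> h" "rng \<Lambda> g = rng \<Lambda> f" "src \<Lambda> h = src \<Lambda> f"
      using has_edge_rng[OF less.prems(1)] by metis
    have "j \<noteq> i" using j less.prems by auto
    obtain e where "e \<in> paths_deg \<Lambda> (gen i)" "rng \<Lambda> e = rng \<Lambda> g"
      using less.prems gh by (auto simp: has_edge_def paths_deg_def)
    then have "has_edge (src \<Lambda> g) i"
      using assms(1) gh \<open>j \<noteq> i\<close> unfolding locally_convex_def has_edge_iff
      by (metis (mono_tags, lifting) mem_Collect_eq paths_deg_def)
    moreover have "(\<Sum>k\<in>UNIV. deg \<Lambda> h $ k) < (\<Sum>k\<in>UNIV. deg \<Lambda> f $ k)"
      using gh by (intro sum_strict_mono_ex1) (auto simp: gen_def axis_def intro: exI[of _ j])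
    moreover have "deg \<Lambda> h $ i = 0" using less.prems gh by simp
    ultimately show ?thesis using less.hyps[of h] gh by simp
  qed
qed

text \<open>Suppose the composite is short in direction \<open>i\<close> while its source still has
  an \<open>i\<close>-edge. Then \<open>g\<close> is full in that direction, so \<open>f\<close> is
  the short one and its source has no \<open>i\<close>-edge. But unique factorization moves the
  \<open>i\<close>-edge from the end of \<open>g\<close> to its front, which is that same
  vertex.\<close>

lemma paths_le_cmp:
  assumes f: "f \<in> paths_le \<Lambda> m" and g: "g \<in> paths_le \<Lambda> n" and fg: "src \<Lambda> f = rng \<Lambda> g"
  shows "cmp \<Lambda> f g \<in> paths_le \<Lambda> (m + n)"
proof -
  have M: "f \<in> Mor \<Lambda>" "g \<in> Mor \<Lambda>" and le: "deg \<Lambda> f \<le> m" "deg \<Lambda> g \<le> n" using f g by (auto simp: paths_le_iff)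
  have "\<not> has_edge (src \<Lambda> g) i" if "deg \<Lambda> f $ i + deg \<Lambda> g $ i < m $ i + n $ i" for i
  proof
    assume e: "has_edge (src \<Lambda> g) i"
    then have "deg \<Lambda> g $ i = n $ i" using g le by (auto simp: paths_le_iff less_eq_vec_def order_less_le)
    then have r: "\<not> has_edge (rng \<Lambda> g) i" using that f fg by (auto simp: paths_le_iff)
    obtain h where h: "h \<in> Mor \<Lambda>" "rng \<Lambda> h = src \<Lambda> g" "deg \<Lambda> h = gen i" using e by (auto simp: has_edge_def)
    have "0 < deg \<Lambda> (cmp \<Lambda> g h) $ i" using h M by (simp add: deg_cmp gen_def axis_def)
    then have "has_edge (rng \<Lambda> (cmp \<Lambda> g h)) i"
      using has_edge_rng[of "cmp \<Lambda> g h" i] h M cmp_closed by metis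
    then show False using r h M by (simp add: rng_cmp)
  qed
  then show ?thesis using M le fg unfolding paths_le_iff
    by (auto simp: cmp_closed deg_cmp src_cmp less_eq_vec_def add_mono)
qed

lemma paths_le_self: "f \<in> Mor \<Lambda> \<Longrightarrow> f \<in> paths_le \<Lambda> (deg \<Lambda> f)"
  by (auto simp: paths_le_iff)

text \<open>Among the paths of degree at most \<open>n\<close> with range \<open>v\<close>, one of
  maximal total length cannot be extended within \<open>n\<close>.\<close>

lemma paths_le_nonempty:
  assumes v: "v \<in> vertices \<Lambda>"
  shows "\<exists>f\<in>paths_le \<Lambda> n. rng \<Lambda> f = v"
proof -
  let ?S = "{f \<in> Mor \<Lambda>. rng \<Lambda> f = v \<and> deg \<Lambda> f \<le> n}"
  have "(\<Sum>i\<in>UNIV. deg \<Lambda> f $ i) < Suc (\<Sum>i\<in>UNIV. n $ i)" if "f \<in> ?S" for f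
    using that by (auto simp: less_eq_vec_def less_Suc_eq_le intro: sum_mono)
  moreover have "v \<in> ?S" using vertex_id[OF v] by (auto simp: less_eq_vec_def)
  ultimately obtain f where f: "f \<in> ?S"
    and max: "\<And>g. g \<in> ?S \<Longrightarrow> (\<Sum>i\<in>UNIV. deg \<Lambda> g $ i) \<le> (\<Sum>i\<in>UNIV. deg \<Lambda> f $ i)"
    using ex_has_greatest_nat[of "\<lambda>f. f \<in> ?S" v "\<lambda>f. \<Sum>i\<in>UNIV. deg \<Lambda> f $ i" "Suc (\<Sum>i\<in>UNIV. n $ i)"]
    by blast
  have "\<not> has_edge (src \<Lambda> f) i" if "deg \<Lambda> f $ i < n $ i" for i
  proof
    assume "has_edge (src \<Lambda> f) i"
    then obtain h where h: "h \<in> Mor \<Lambda>" "rng \<Lambda> h = src \<Lambda> f" "deg \<Lambda> h = gen i" by (auto simp: has_edge_def)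
    have d: "deg \<Lambda> (cmp \<Lambda> f h) = deg \<Lambda> f + gen i" using h f by (simp add: deg_cmp)
    then have "cmp \<Lambda> f h \<in> ?S" using h f that by (auto simp: cmp_closed rng_cmp gen_le_iff)
    from max[OF this] show False
      by (simp add: d sum.distrib) (auto simp: gen_def axis_def split: if_splits)
  qed
  then show ?thesis using f by (auto simp: paths_le_iff)
qed

text \<open>The cut is made at the coordinatewise minimum of \<open>n\<close> and the degree of
  \<open>f\<close>. If the first piece is short of \<open>n\<close> in direction \<open>i\<close>,
  the second piece does not move in that direction, so an \<open>i\<close>-edge at the cut would
  walk to the source of \<open>f\<close> and contradict the maximality of \<open>f\<close>.\<close>

lemma paths_le_prefix:
  assumes lc: "locally_convex \<Lambda>" and f: "f \<in> paths_le \<Lambda> m" and "n \<le> m"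
  obtains g h where "g \<in> paths_le \<Lambda> n" "h \<in> Mor \<Lambda>" "src \<Lambda> g = rng \<Lambda> h" "f = cmp \<Lambda> g h"
proof -
  define k where "k = (\<chi> i. min (n $ i) (deg \<Lambda> f $ i))"
  have fM: "f \<in> Mor \<Lambda>" using f by (auto simp: paths_le_iff)
  have k: "k $ i = min (n $ i) (deg \<Lambda> f $ i)" for i by (simp add: k_def)
  have "k \<le> deg \<Lambda> f" by (auto simp: less_eq_vec_def k)
  from factor_exists_le[OF fM this] obtain g h where gh: "g \<in> Mor \<Lambda>" "h \<in> Mor \<Lambda>" "src \<Lambda> g = rng \<Lambda> h" "deg \<Lambda> g = k" "f = cmp \<Lambda> g h"
    by blast
  have "deg \<Lambda> f = k + deg \<Lambda> h" using gh deg_cmp by metis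
  then have d: "deg \<Lambda> f $ i = k $ i + deg \<Lambda> h $ i" for i by simp
  have "\<not> has_edge (src \<Lambda> g) i" if "deg \<Lambda> g $ i < n $ i" for i
  proof
    assume e: "has_edge (src \<Lambda> g) i"
    have "k $ i < n $ i" using that gh(4) by metis
    then have "deg \<Lambda> f $ i = k $ i" using k[of i] by linarith
    with \<open>k $ i < n $ i\<close> d[of i] have "deg \<Lambda> h $ i = 0" "deg \<Lambda> f $ i < n $ i" by linarith+
    then have "has_edge (src \<Lambda> f) i"
      using locally_convex_walk[OF lc, of h i] gh e by (simp add: src_cmp)
    moreover have "deg \<Lambda> f $ i < m $ i"
      using \<open>deg \<Lambda> f $ i < n $ i\<close> assms(3) by (auto simp: less_eq_vec_def intro: less_le_trans)
    ultimately show False using f by (auto simp: paths_le_iff)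
  qed
  then have "g \<in> paths_le \<Lambda> n" using gh by (auto simp: paths_le_iff less_eq_vec_def k)
  then show ?thesis using that gh by blast
qed

text \<open>Unique factorization alone does not suffice, as elements of
  \<open>paths_le \<Lambda> n\<close> may have different degrees. If \<open>f\<close> were shorter
  than \<open>g\<close> in direction \<open>i\<close>, then \<open>h\<close> would contain an
  \<open>i\<close>-edge, which can be moved to its front, although \<open>f\<close> stopped short of
  \<open>n\<close> there.\<close>

lemma paths_le_unique:
  assumes "f \<in> paths_le \<Lambda> n" "g \<in> paths_le \<Lambda> n"
    and "h \<in> Mor \<Lambda>" "src \<Lambda> f = rng \<Lambda> h" "h' \<in> Mor \<Lambda>" "src \<Lambda> g = rng \<Lambda> h'"
    and eq: "cmp \<Lambda> f h = cmp \<Lambda> g h'"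
  shows "f = g"
proof -
  have no_less: "\<not> deg \<Lambda> f $ i < deg \<Lambda> g $ i"
    if H: "f \<in> paths_le \<Lambda> n" "g \<in> paths_le \<Lambda> n" "h \<in> Mor \<Lambda>" "src \<Lambda> f = rng \<Lambda> h" "h' \<in> Mor \<Lambda>"
      "src \<Lambda> g = rng \<Lambda> h'" "cmp \<Lambda> f h = cmp \<Lambda> g h'" for f g h h' i
  proof
    assume l: "deg \<Lambda> f $ i < deg \<Lambda> g $ i"
    have "f \<in> Mor \<Lambda>" "g \<in> Mor \<Lambda>" using H by (auto simp: paths_le_iff)
    then have "deg \<Lambda> f + deg \<Lambda> h = deg \<Lambda> g + deg \<Lambda> h'" using H deg_cmp by metis
    then have "deg \<Lambda> f $ i + deg \<Lambda> h $ i = deg \<Lambda> g $ i + deg \<Lambda> h' $ i" by (metis vector_add_component)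
    then have "0 < deg \<Lambda> h $ i" using l by linarith
    then have "has_edge (src \<Lambda> f) i" using has_edge_rng H by metis
    moreover have "deg \<Lambda> f $ i < n $ i" using l H(2) by (auto simp: paths_le_iff less_eq_vec_def intro: less_le_trans)
    ultimately show False using H(1) by (auto simp: paths_le_iff)
  qed
  have "deg \<Lambda> f = deg \<Lambda> g"
    using no_less[OF assms] no_less[OF assms(2,1,5,6,3,4) eq[symmetric]]
    by (auto simp: vec_eq_iff intro: antisym not_less_iff_gr_or_eq[THEN iffD1] simp: not_less)
  then show ?thesis using factor_unique[of f h g h'] assms by (auto simp: paths_le_iff)
qed

lemma finite_paths_le:
  assumes "finite_kgraph \<Lambda>"
  shows "finite (paths_le \<Lambda> n)"
proof -
  have "finite {m :: nat ^ 'k. m \<le> n}"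
  proof (rule finite_subset)
    show "{m. m \<le> n} \<subseteq> vec_lambda ` (PiE UNIV (\<lambda>i. {..n $ i}))"
      by (auto simp: less_eq_vec_def image_iff intro!: bexI[of _ "vec_nth x" for x])
    show "finite (vec_lambda ` (PiE UNIV (\<lambda>i. {..n $ i})))"
      by (intro finite_imageI finite_PiE) auto
  qed
  then have "finite (\<Union>m\<in>{m. m \<le> n}. paths_deg \<Lambda> m)"
    using assms by (auto simp: finite_kgraph_def)
  then show ?thesis by (rule rev_finite_subset) (auto simp: paths_le_def paths_deg_def)
qed

end

text \<open>Here \<open>1\<close> is the vector with all coordinates 1, so every \<open>g n\<close>
  advances by one edge in each direction as long as possible. The infinite product of the
  \<open>g n\<close> plays the role of a boundary path and is handled only through its finite
  pieces.\<close>

locale boundary_path = k_graph \<Lambda> for \<Lambda> :: "('p, 'k::finite) kgraph" +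
  fixes g :: "nat \<Rightarrow> 'p"
  assumes g_le: "g n \<in> paths_le \<Lambda> 1"
    and g_src: "src \<Lambda> (g n) = rng \<Lambda> (g (Suc n))"
    and lc: "locally_convex \<Lambda>"
begin

lemma g_Mor: "g n \<in> Mor \<Lambda>"
  using g_le by (auto simp: paths_le_def)

primrec tail_path :: "nat \<Rightarrow> nat \<Rightarrow> 'p" where
  "tail_path j 0 = rng \<Lambda> (g j)"
| "tail_path j (Suc n) = cmp \<Lambda> (tail_path j n) (g (j + n))"

lemma tail_path: "tail_path j n \<in> paths_le \<Lambda> (n *s 1)" "rng \<Lambda> (tail_path j n) = rng \<Lambda> (g j)"
    "src \<Lambda> (tail_path j n) = rng \<Lambda> (g (j + n))"
proof -
  have "tail_path j n \<in> paths_le \<Lambda> (n *s 1) \<and> rng \<Lambda> (tail_path j n) = rng \<Lambda> (g j) \<and>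
    src \<Lambda> (tail_path j n) = rng \<Lambda> (g (j + n))"
  proof (induction n)
    case 0
    then show ?case using g_Mor by (auto simp: paths_le_iff rng_closed rng_rng src_rng less_eq_vec_def)
  next
    case (Suc n)
    have "(Suc n) *s 1 = n *s 1 + (1 :: nat ^ 'k)" by (simp add: vec_eq_iff)
    then show ?case using Suc g_Mor g_src paths_le_cmp[OF _ g_le, of "tail_path j n" "n *s 1" "j + n"]
      by (auto simp: paths_le_iff rng_cmp src_cmp)
  qed
  then show "tail_path j n \<in> paths_le \<Lambda> (n *s 1)" "rng \<Lambda> (tail_path j n) = rng \<Lambda> (g j)"
    "src \<Lambda> (tail_path j n) = rng \<Lambda> (g (j + n))" by auto
qed

lemma tail_path_Mor: "tail_path j n \<in> Mor \<Lambda>"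
  using tail_path(1) by (auto simp: paths_le_def)

lemma tail_path_add: "tail_path j (m + n) = cmp \<Lambda> (tail_path j m) (tail_path (j + m) n)"
proof (induction n)
  case 0
  show ?case using cmp_id_right[OF tail_path_Mor, of j m] by (simp add: tail_path(3))
next
  case (Suc n)
  then show ?case using tail_path_Mor g_Mor by (simp add: cmp_assoc tail_path add.assoc)
qed

text \<open>A pair \<open>(f, j)\<close> stands for the infinite path \<open>f g\<^sub>j g\<^sub>j\<^sub>+\<^sub>1 \<dots>\<close>; \<open>tails\<close> identifies two
  pairs when they agree after appending enough of the \<open>g\<close>'s.\<close>

definition pairs :: "('p \<times> nat) set" where
  "pairs = {(f, j). f \<in> Mor \<Lambda> \<and> src \<Lambda> f = rng \<Lambda> (g j)}"

text \<open>The number \<open>n\<close> is an absolute index into \<open>g\<close>, not a count of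
  steps: for \<open>n\<close> at least \<open>j\<close>, the pair \<open>(f, j)\<close> is continued
  up to, but not including, \<open>g n\<close>. Two pairs advanced to the same \<open>n\<close> thus
  end at the same vertex.\<close>

definition advance :: "'p \<times> nat \<Rightarrow> nat \<Rightarrow> 'p" where
  "advance x n = cmp \<Lambda> (fst x) (tail_path (snd x) (n - snd x))"

definition tails :: "'p \<times> nat \<Rightarrow> 'p \<times> nat \<Rightarrow> bool" where
  "tails x y \<longleftrightarrow> (\<exists>n\<ge>max (snd x) (snd y). advance x n = advance y n)"

lemma advance:
  assumes "x \<in> pairs" "snd x \<le> n"
  shows "advance x n \<in> Mor \<Lambda>" "rng \<Lambda> (advance x n) = rng \<Lambda> (fst x)" "src \<Lambda> (advance x n) = rng \<Lambda> (g n)"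
  using assms tail_path_Mor by (auto simp: advance_def pairs_def cmp_closed rng_cmp src_cmp tail_path)

lemma advance_advance:
  assumes "x \<in> pairs" "snd x \<le> m" "m \<le> n"
  shows "advance x n = cmp \<Lambda> (advance x m) (tail_path m (n - m))"
proof -
  have eq: "n - snd x = (m - snd x) + (n - m)" using assms by simp
  have "tail_path (snd x) (n - snd x) = cmp \<Lambda> (tail_path (snd x) (m - snd x)) (tail_path m (n - m))"
    unfolding eq tail_path_add using assms(2) by simp
  then show ?thesis using assms tail_path_Mor
    by (auto simp: advance_def pairs_def cmp_assoc tail_path)
qed

lemma advance_pair:
  assumes "x \<in> pairs" "snd x \<le> m"
  shows "(advance x m, m) \<in> pairs" "tails x (advance x m, m)"
proof -
  show p: "(advance x m, m) \<in> pairs" using advance[OF assms] by (auto simp: pairs_def)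
  have "advance (advance x m, m) m = advance x m"
    using cmp_id_right[OF advance(1)[OF assms]] advance(3)[OF assms] by (simp add: advance_def[of "(_, _)"])
  then show "tails x (advance x m, m)" using assms unfolding tails_def by (intro exI[of _ m]) auto
qed

lemma tails_later:
  assumes "x \<in> pairs" "y \<in> pairs" "tails x y"
  obtains n0 where "\<And>n. n \<ge> n0 \<Longrightarrow> snd x \<le> n \<and> snd y \<le> n \<and> advance x n = advance y n"
proof -
  obtain m where "m \<ge> max (snd x) (snd y)" "advance x m = advance y m" using assms by (auto simp: tails_def)
  then have "snd x \<le> n \<and> snd y \<le> n \<and> advance x n = advance y n" if "n \<ge> m" for n
    using advance_advance[OF assms(1), of m n] advance_advance[OF assms(2), of m n] that by simp
  then show ?thesis using that by blast
qed

lemma tails_refl: "tails x x"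
  by (auto simp: tails_def)

lemma tails_sym: "tails x y \<Longrightarrow> tails y x"
  by (auto simp: tails_def)

lemma tails_trans:
  assumes "x \<in> pairs" "y \<in> pairs" "z \<in> pairs" "tails x y" "tails y z"
  shows "tails x z"
proof -
  obtain n m where "\<And>k. k \<ge> n \<Longrightarrow> snd x \<le> k \<and> snd y \<le> k \<and> advance x k = advance y k"
    "\<And>k. k \<ge> m \<Longrightarrow> snd y \<le> k \<and> snd z \<le> k \<and> advance y k = advance z k"
    using tails_later assms by metis
  then show ?thesis unfolding tails_def by (intro exI[of _ "max n m"]) auto
qed

lemma tails_rng:
  assumes "x \<in> pairs" "y \<in> pairs" "tails x y"
  shows "rng \<Lambda> (fst x) = rng \<Lambda> (fst y)"
  using tails_later[OF assms] advance(2) assms by (metis order_refl)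

lemma pairs_cmp:
  assumes "(f, j) \<in> pairs" "m \<in> Mor \<Lambda>" "src \<Lambda> m = rng \<Lambda> f"
  shows "(cmp \<Lambda> m f, j) \<in> pairs"
  using assms by (auto simp: pairs_def cmp_closed src_cmp)

lemma advance_cmp:
  assumes "(f, j) \<in> pairs" "m \<in> Mor \<Lambda>" "src \<Lambda> m = rng \<Lambda> f"
  shows "advance (cmp \<Lambda> m f, j) n = cmp \<Lambda> m (advance (f, j) n)"
  using assms tail_path_Mor by (auto simp: pairs_def advance_def cmp_assoc tail_path)

text \<open>Left cancellation makes prepending \<open>m\<close> both well defined and injective on
  classes, which is what turns it into a partial isometry.\<close>

lemma tails_cmp:
  assumes f: "(f, j) \<in> pairs" "m \<in> Mor \<Lambda>" "src \<Lambda> m = rng \<Lambda> f"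
    and f': "(f', j') \<in> pairs" "src \<Lambda> m = rng \<Lambda> f'"
  shows "tails (cmp \<Lambda> m f, j) (cmp \<Lambda> m f', j') \<longleftrightarrow> tails (f, j) (f', j')"
proof -
  have "cmp \<Lambda> m (advance (f, j) n) = cmp \<Lambda> m (advance (f', j') n) \<longleftrightarrow> advance (f, j) n = advance (f', j') n"
    if "max j j' \<le> n" for n
    using cancel_left[OF f(2)] advance[OF f(1), of n] advance[OF f'(1), of n] that f f' by auto
  then show ?thesis
    unfolding tails_def using advance_cmp[OF f] advance_cmp[OF f'(1) f(2) f'(2)] by auto
qed

text \<open>Basis vectors must be natural numbers, so every class is numbered through a chosen
  representative in the countable set \<open>pairs\<close>.\<close>

lemma exists_code: "\<exists>c :: 'p \<times> nat \<Rightarrow> nat. \<forall>x\<in>pairs. \<forall>y\<in>pairs. c x = c y \<longleftrightarrow> tails x y"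
proof -
  have "countable pairs"
    by (rule countable_subset[of _ "Mor \<Lambda> \<times> UNIV"]) (auto simp: pairs_def countable)
  define r where "r x = (SOME y. y \<in> pairs \<and> tails x y)" for x
  have r: "r x \<in> pairs \<and> tails x (r x)" if "x \<in> pairs" for x
    unfolding r_def by (rule someI[of _ x]) (use that tails_refl in auto)
  have "r x = r y \<longleftrightarrow> tails x y" if "x \<in> pairs" "y \<in> pairs" for x y
  proof
    assume "r x = r y"
    then show "tails x y" using r[OF that(1)] r[OF that(2)] tails_trans tails_sym that by metis
  next
    assume "tails x y"
    then have "(\<lambda>z. z \<in> pairs \<and> tails x z) = (\<lambda>z. z \<in> pairs \<and> tails y z)"
      using tails_trans tails_sym that by blast
    then show "r x = r y" by (simp add: r_def)
  qed
  then have "to_nat_on pairs (r x) = to_nat_on pairs (r y) \<longleftrightarrow> tails x y" if "x \<in> pairs" "y \<in> pairs" for x y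
    using to_nat_on_inj[OF \<open>countable pairs\<close>] r that by auto
  then show ?thesis by (intro exI[of _ "\<lambda>x. to_nat_on pairs (r x)"]) auto
qed

text \<open>This is the spanning half of the vertex relation: every class with range
  \<open>v\<close> begins with a member of \<open>paths_le \<Lambda> n\<close>.\<close>

lemma pairs_factor:
  assumes x: "x \<in> pairs"
  obtains m h j where "m \<in> paths_le \<Lambda> n" "rng \<Lambda> m = rng \<Lambda> (fst x)" "(h, j) \<in> pairs" "src \<Lambda> m = rng \<Lambda> h"
    "tails x (cmp \<Lambda> m h, j)"
proof -
  obtain f j where [simp]: "x = (f, j)" by force
  \<comment> \<open>After \<open>d\<close> further terms the path is maximal below a bound that
    dominates \<open>n\<close>. Its own degree need not reach \<open>n\<close>; only the bound
    matters for the cut.\<close>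
  define d where "d = (\<Sum>i\<in>UNIV. n $ i)"
  have f: "f \<in> Mor \<Lambda>" "src \<Lambda> f = rng \<Lambda> (g j)" using x by (auto simp: pairs_def)
  have a: "advance x (j + d) \<in> paths_le \<Lambda> (deg \<Lambda> f + d *s 1)"
    using paths_le_cmp[OF paths_le_self[OF f(1)] tail_path(1), of j d] f by (simp add: advance_def tail_path)
  have "n \<le> deg \<Lambda> f + d *s 1"
    by (auto simp: less_eq_vec_def d_def intro!: trans_le_add2 member_le_sum)
  then obtain m h where mh: "m \<in> paths_le \<Lambda> n" "h \<in> Mor \<Lambda>" "src \<Lambda> m = rng \<Lambda> h" "advance x (j + d) = cmp \<Lambda> m h"
    using paths_le_prefix[OF lc a] by metis
  have mM: "m \<in> Mor \<Lambda>" using mh by (auto simp: paths_le_def)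
  note adv = advance[OF x, of "j + d"] advance_pair[OF x, of "j + d"]
  show ?thesis
  proof (rule that[OF mh(1) _ _ mh(3)])
    show "rng \<Lambda> m = rng \<Lambda> (fst x)" using adv mh mM by (simp add: rng_cmp)
    show "(h, j + d) \<in> pairs" using adv mh mM by (simp add: pairs_def src_cmp)
    show "tails x (cmp \<Lambda> m h, j + d)" using adv mh by simp
  qed
qed

lemma exists_CK_family:
  assumes fin: "finite_kgraph \<Lambda>"
  shows "\<exists>t. CK_family \<Lambda> l2_algebra t \<and> (\<exists>f\<in>Mor \<Lambda>. t f \<noteq> \<zero>\<^bsub>l2_algebra\<^esub>)"
proof -
  obtain c :: "'p \<times> nat \<Rightarrow> nat" where c: "\<And>x y. x \<in> pairs \<Longrightarrow> y \<in> pairs \<Longrightarrow> c x = c y \<longleftrightarrow> tails x y"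
    using exists_code by blast
  \<comment> \<open>\<open>R m\<close> sends the class of \<open>(f, j)\<close> to the class of the
    path with \<open>m\<close> prepended. Row indices come first, hence the image is the first
    component, and \<open>D m\<close> is the set of basis vectors that span the range of
    \<open>m\<close>.\<close>
  define R where "R m = {(c (cmp \<Lambda> m f, j), c (f, j)) | f j. (f, j) \<in> pairs \<and> rng \<Lambda> f = src \<Lambda> m}" for m
  define D where "D m = {c (cmp \<Lambda> m f, j) | f j. (f, j) \<in> pairs \<and> rng \<Lambda> f = src \<Lambda> m}" for m
  have cc: "c (cmp \<Lambda> m f, j) = c (cmp \<Lambda> m f', j') \<longleftrightarrow> c (f, j) = c (f', j')"
    if "m \<in> Mor \<Lambda>" "(f, j) \<in> pairs" "(f', j') \<in> pairs" "rng \<Lambda> f = src \<Lambda> m" "rng \<Lambda> f' = src \<Lambda> m" for m f j f' j'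
    using that c tails_cmp pairs_cmp by metis
  have sv: "single_valued (R m)" "single_valued ((R m)\<inverse>)" if "m \<in> Mor \<Lambda>" for m
    unfolding single_valued_def R_def using cc[OF that] by auto
  have R_cmp: "R m O R n = R (cmp \<Lambda> m n)" if m: "m \<in> Mor \<Lambda>" "n \<in> Mor \<Lambda>" "src \<Lambda> m = rng \<Lambda> n" for m n
  proof (intro equalityI subsetI)
    fix z assume "z \<in> R m O R n"
    then obtain f j h l where *: "z = (c (cmp \<Lambda> m f, j), c (h, l))" "c (f, j) = c (cmp \<Lambda> n h, l)"
      "(f, j) \<in> pairs" "rng \<Lambda> f = src \<Lambda> m" "(h, l) \<in> pairs" "rng \<Lambda> h = src \<Lambda> n" unfolding R_def by force
    then have nh: "(cmp \<Lambda> n h, l) \<in> pairs" "rng \<Lambda> (cmp \<Lambda> n h) = src \<Lambda> m" "h \<in> Mor \<Lambda>"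
      using pairs_cmp[of h l n] m by (auto simp: rng_cmp pairs_def)
    have "c (cmp \<Lambda> m f, j) = c (cmp \<Lambda> m (cmp \<Lambda> n h), l)"
      using cc[OF m(1) *(3) nh(1) *(4) nh(2)] * by simp
    then have "z = (c (cmp \<Lambda> (cmp \<Lambda> m n) h, l), c (h, l))" using * nh m by (simp add: cmp_assoc)
    then show "z \<in> R (cmp \<Lambda> m n)" using * m unfolding R_def by (auto simp: src_cmp)
  next
    fix z assume "z \<in> R (cmp \<Lambda> m n)"
    then obtain h l where *: "z = (c (cmp \<Lambda> (cmp \<Lambda> m n) h, l), c (h, l))" "(h, l) \<in> pairs" "rng \<Lambda> h = src \<Lambda> n"
      using m unfolding R_def by (auto simp: src_cmp)
    then have "h \<in> Mor \<Lambda>" by (auto simp: pairs_def)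
    then have "(c (cmp \<Lambda> (cmp \<Lambda> m n) h, l), c (cmp \<Lambda> n h, l)) \<in> R m"
      unfolding R_def using * m pairs_cmp[of h l n] by (auto simp: cmp_assoc rng_cmp intro!: exI[of _ "cmp \<Lambda> n h"])
    moreover have "(c (cmp \<Lambda> n h, l), c (h, l)) \<in> R n" using * unfolding R_def by auto
    ultimately show "z \<in> R m O R n" using * by auto
  qed
  have R_vertex: "R v = Id_on (D v)" "D v = {c (f, j) | f j. (f, j) \<in> pairs \<and> rng \<Lambda> f = v}" if "v \<in> vertices \<Lambda>" for v
  proof -
    have "cmp \<Lambda> v f = f" if "(f, j) \<in> pairs" "rng \<Lambda> f = v" for f j
      using that cmp_id_left[of f] by (auto simp: pairs_def)
    then show "R v = Id_on (D v)" "D v = {c (f, j) | f j. (f, j) \<in> pairs \<and> rng \<Lambda> f = v}"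
      unfolding R_def D_def vertex_id(4)[OF that] by (auto simp: Id_on_def) metis+
  qed
  have R_conv: "(R m)\<inverse> O R m = R (src \<Lambda> m)" if m: "m \<in> Mor \<Lambda>" for m
  proof -
    have "(R m)\<inverse> O R m = Id_on (Range (R m))"
      using sv(1)[OF m] unfolding single_valued_def by (auto simp: Id_on_def)
    moreover have "Range (R m) = D (src \<Lambda> m)"
      unfolding R_vertex(2)[OF src_vertex[OF m]] unfolding R_def by auto
    ultimately show ?thesis using R_vertex(1)[OF src_vertex[OF m]] by simp
  qed
  have R_conv': "R m O (R m)\<inverse> = Id_on (D m)" if m: "m \<in> Mor \<Lambda>" for m
  proof -
    have "R m O (R m)\<inverse> = Id_on (Domain (R m))"
      using sv(2)[OF m] unfolding single_valued_def by (auto simp: Id_on_def)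
    moreover have "Domain (R m) = D m" unfolding R_def D_def by auto
    ultimately show ?thesis by simp
  qed
  define t where "t m = rel_mat (R m)" for m
  have D_vertex_disjoint: "D v \<inter> D w = {}" if "v \<in> vertices \<Lambda>" "w \<in> vertices \<Lambda>" "v \<noteq> w" for v w
    unfolding R_vertex(2)[OF that(1)] R_vertex(2)[OF that(2)] using c tails_rng that(3) by fastforce
  have "CK_family \<Lambda> l2_algebra t"
    unfolding CK_family_def
  proof (intro conjI ballI allI impI)
    fix m assume m: "m \<in> Mor \<Lambda>"
    show "t m \<in> carrier l2_algebra" using rel_mat_closed sv[OF m] by (simp add: t_def)
    show "adj l2_algebra (t m) \<otimes>\<^bsub>l2_algebra\<^esub> t m = t (src \<Lambda> m)"
      using rel_mat_comp[OF sv(2)[OF m]] R_conv[OF m] by (simp add: t_def rel_mat_star)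
    fix n assume "n \<in> Mor \<Lambda>" "src \<Lambda> m = rng \<Lambda> n"
    then show "t m \<otimes>\<^bsub>l2_algebra\<^esub> t n = t (cmp \<Lambda> m n)"
      using rel_mat_comp[OF sv(1)[OF m]] R_cmp[OF m] by (simp add: t_def)
  next
    fix v assume v: "v \<in> vertices \<Lambda>"
    note vM = vertex_id(1)[OF v]
    show "t v \<otimes>\<^bsub>l2_algebra\<^esub> t v = t v"
      using rel_mat_comp[OF sv(1)[OF vM], of "R v"] R_vertex(1)[OF v] by (simp add: t_def Id_on_def) (auto intro!: arg_cong[of _ _ rel_mat])
    show "adj l2_algebra (t v) = t v" using R_vertex(1)[OF v] by (simp add: t_def rel_mat_star)
    fix w assume w: "w \<in> vertices \<Lambda>" "v \<noteq> w"
    have "R v O R w = {}" using R_vertex(1)[OF v] R_vertex(1)[OF w(1)] D_vertex_disjoint[OF v w] by auto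
    then show "t v \<otimes>\<^bsub>l2_algebra\<^esub> t w = \<zero>\<^bsub>l2_algebra\<^esub>"
      using rel_mat_comp[OF sv(1)[OF vM], of "R w"] by (simp add: t_def) (simp add: rel_mat_def)
  next
    fix v n assume v: "v \<in> vertices \<Lambda>"
    let ?F = "with_range \<Lambda> v (paths_le \<Lambda> n)"
    have F: "m \<in> paths_le \<Lambda> n" "m \<in> Mor \<Lambda>" "rng \<Lambda> m = v" if "m \<in> ?F" for m
      using that by (auto simp: with_range_def paths_le_def)
    have "finsum l2_algebra (\<lambda>m. t m \<otimes>\<^bsub>l2_algebra\<^esub> adj l2_algebra (t m)) ?F =
      finsum l2_algebra (\<lambda>m. rel_mat (Id_on (D m))) ?F"
    proof -
      have "rel_mat (Id_on (D m)) \<in> l2_ops" for m by (rule rel_mat_closed) (auto simp: single_valued_def)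
      moreover have "t m \<otimes>\<^bsub>l2_algebra\<^esub> adj l2_algebra (t m) = rel_mat (Id_on (D m))" if "m \<in> ?F" for m
        using rel_mat_comp[OF sv(1)[OF F(2)[OF that]]] R_conv'[OF F(2)[OF that]] by (simp add: t_def rel_mat_star)
      ultimately show ?thesis
        using cstar_algebra_l2_algebra
        by (intro abelian_monoid.finsum_cong') (auto simp: cstar_algebra_def module_def abelian_group_def)
    qed
    also have "\<dots> = rel_mat (\<Union>m\<in>?F. Id_on (D m))"
    proof (rule rel_mat_finsum)
      show "finite ?F" using finite_paths_le[OF fin] by (auto simp: with_range_def)
      show "disjoint_family_on (\<lambda>m. Id_on (D m)) ?F"
        unfolding disjoint_family_on_def
      \<comment> \<open>A common basis vector would give, after advancing far enough, one finite
        path with two initial pieces in \<open>paths_le \<Lambda> n\<close>.\<close>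
      proof (intro ballI impI, rule ccontr)
        fix m m' assume mm: "m \<in> ?F" "m' \<in> ?F" "m \<noteq> m'" "Id_on (D m) \<inter> Id_on (D m') \<noteq> {}"
        then obtain f j f' j' where *: "c (cmp \<Lambda> m f, j) = c (cmp \<Lambda> m' f', j')" "(f, j) \<in> pairs" "rng \<Lambda> f = src \<Lambda> m"
          "(f', j') \<in> pairs" "rng \<Lambda> f' = src \<Lambda> m'" by (auto simp: D_def)
        note p = pairs_cmp[OF *(2) F(2)[OF mm(1)] *(3)[symmetric]] pairs_cmp[OF *(4) F(2)[OF mm(2)] *(5)[symmetric]]
        then have "tails (cmp \<Lambda> m f, j) (cmp \<Lambda> m' f', j')" using c *(1) by blast
        then obtain n0 where n0: "j \<le> n0" "j' \<le> n0" "advance (cmp \<Lambda> m f, j) n0 = advance (cmp \<Lambda> m' f', j') n0"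
          using tails_later[OF p] by (metis order_refl snd_conv)
        then have "cmp \<Lambda> m (advance (f, j) n0) = cmp \<Lambda> m' (advance (f', j') n0)"
          using advance_cmp[OF *(2) F(2)[OF mm(1)]] advance_cmp[OF *(4) F(2)[OF mm(2)]] * by simp
        then have "m = m'"
          using paths_le_unique[OF F(1)[OF mm(1)] F(1)[OF mm(2)], of "advance (f, j) n0" "advance (f', j') n0"]
            advance[OF *(2), of n0] advance[OF *(4), of n0] n0 * by simp
        then show False using mm by simp
      qed
    qed (auto simp: single_valued_def)
    also have "(\<Union>m\<in>?F. Id_on (D m)) = Id_on (D v)"
    proof -
      have "D m \<subseteq> D v" if "m \<in> ?F" for m
      proof
        fix z assume "z \<in> D m"
        then obtain f j where *: "z = c (cmp \<Lambda> m f, j)" "(f, j) \<in> pairs" "rng \<Lambda> f = src \<Lambda> m" by (auto simp: D_def)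
        then have "f \<in> Mor \<Lambda>" by (simp add: pairs_def)
        then have "(cmp \<Lambda> m f, j) \<in> pairs" "rng \<Lambda> (cmp \<Lambda> m f) = v"
          using * F[OF that] pairs_cmp[of f j m] by (auto simp: rng_cmp)
        then show "z \<in> D v" unfolding R_vertex(2)[OF v] using * by blast
      qed
      moreover have "\<exists>m\<in>?F. z \<in> D m" if "z \<in> D v" for z
      proof -
        obtain f j where f: "z = c (f, j)" "(f, j) \<in> pairs" "rng \<Lambda> f = v"
          using \<open>z \<in> D v\<close> unfolding R_vertex(2)[OF v] by blast
        obtain m h l where m: "m \<in> paths_le \<Lambda> n" "rng \<Lambda> m = v" "(h, l) \<in> pairs" "src \<Lambda> m = rng \<Lambda> h"
          "tails (f, j) (cmp \<Lambda> m h, l)" using pairs_factor[OF f(2)] f(3) by (metis fst_conv)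
        have "m \<in> ?F" using m by (auto simp: with_range_def)
        moreover have "z = c (cmp \<Lambda> m h, l)"
          using c[OF f(2) pairs_cmp[OF m(3) F(2)[OF \<open>m \<in> ?F\<close>] m(4)]] m f by simp
        ultimately show ?thesis using m unfolding D_def by force
      qed
      ultimately show ?thesis by (auto simp: Id_on_def)
    qed
    finally show "t v = finsum l2_algebra (\<lambda>m. t m \<otimes>\<^bsub>l2_algebra\<^esub> adj l2_algebra (t m)) ?F"
      using R_vertex(1)[OF v] by (simp add: t_def)
  qed
  moreover have "t (rng \<Lambda> (g 0)) \<noteq> \<zero>\<^bsub>l2_algebra\<^esub>"
  proof -
    let ?v = "rng \<Lambda> (g 0)"
    have "(?v, 0) \<in> pairs" using g_Mor by (simp add: pairs_def rng_closed src_rng)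
    moreover have "rng \<Lambda> ?v = ?v" using rng_rng[OF g_Mor] .
    ultimately have "c (?v, 0) \<in> D ?v" unfolding R_vertex(2)[OF rng_vertex[OF g_Mor]] by blast
    then have "t ?v (c (?v, 0)) (c (?v, 0)) = 1"
      unfolding t_def R_vertex(1)[OF rng_vertex[OF g_Mor]] by (simp add: rel_mat_def Id_onI)
    then show ?thesis by (metis l2_algebra_simps(3) zero_neq_one)
  qed
  ultimately show ?thesis using g_Mor rng_closed by blast
qed

end

lemma (in k_graph) exists_nonzero_CK_family:
  assumes "finite_kgraph \<Lambda>" "locally_convex \<Lambda>"
  shows "\<exists>t. CK_family \<Lambda> l2_algebra t \<and> (\<exists>f\<in>Mor \<Lambda>. t f \<noteq> \<zero>\<^bsub>l2_algebra\<^esub>)"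
proof -
  have "\<exists>g. \<forall>n. g n \<in> paths_le \<Lambda> 1 \<and> src \<Lambda> (g n) = rng \<Lambda> (g (Suc n))"
  proof (rule dependent_nat_choice)
    show "\<exists>f. f \<in> paths_le \<Lambda> 1" using nonempty paths_le_nonempty rng_vertex by blast
    fix f n assume "f \<in> paths_le \<Lambda> 1"
    then show "\<exists>h. h \<in> paths_le \<Lambda> 1 \<and> src \<Lambda> f = rng \<Lambda> h"
      using paths_le_nonempty[OF src_vertex, of f] by (auto simp: paths_le_def) metis
  qed
  then obtain g where "\<And>n. g n \<in> paths_le \<Lambda> 1" "\<And>n. src \<Lambda> (g n) = rng \<Lambda> (g (Suc n))" by blast
  then interpret boundary_path \<Lambda> g using assms by unfold_locales auto
  show ?thesis by (rule exists_CK_family[OF assms(1)])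
qed

section \<open>Projections in $C^*$-algebras\<close>

lemma complex_ring_simps [simp]:
  "carrier complex_ring = UNIV" "a \<oplus>\<^bsub>complex_ring\<^esub> b = a + b" "a \<otimes>\<^bsub>complex_ring\<^esub> b = a * b"
  "\<one>\<^bsub>complex_ring\<^esub> = 1" "\<zero>\<^bsub>complex_ring\<^esub> = 0"
  by (simp_all add: complex_ring_def)

context cstar_algebra
begin

lemma scale_closed [simp, intro]: "x \<in> carrier A \<Longrightarrow> c \<odot> x \<in> carrier A"
  and scale_add_left: "x \<in> carrier A \<Longrightarrow> (a + b) \<odot> x = a \<odot> x \<oplus> b \<odot> x"
  and scale_add_right: "x \<in> carrier A \<Longrightarrow> y \<in> carrier A \<Longrightarrow> c \<odot> (x \<oplus> y) = c \<odot> x \<oplus> c \<odot> y"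
  and scale_scale: "x \<in> carrier A \<Longrightarrow> a \<odot> (b \<odot> x) = (a * b) \<odot> x"
  and scale_one [simp]: "x \<in> carrier A \<Longrightarrow> 1 \<odot> x = x"
  using smult_closed[of c x] smult_l_distr[of a b x] smult_r_distr[of c x y] smult_assoc1[of a b x] smult_one[of x]
  by auto

declare mult_closed [simp, intro] adj_closed [simp, intro] adj_adj [simp]

lemma scale_zero [simp]: "x \<in> carrier A \<Longrightarrow> 0 \<odot> x = \<zero>"
  using smult_l_null[of x] by simp

lemma scale_minus_one: "x \<in> carrier A \<Longrightarrow> (- 1) \<odot> x = \<ominus> x"
  using scale_add_left[of x "-1" 1] by (intro minus_equality[symmetric]) auto

lemma mult_zero [simp]: "x \<in> carrier A \<Longrightarrow> \<zero> \<otimes> x = \<zero>" "x \<in> carrier A \<Longrightarrow> x \<otimes> \<zero> = \<zero>"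
  using smult_mult_left[of "\<zero>" x 0] smult_mult_right[of x "\<zero>" 0] by auto

lemma adj_zero [simp]: "adj A \<zero> = \<zero>"
  using adj_smult[of "\<zero>" 0] by simp

lemma minus_zero_eq [simp]: "\<ominus> \<zero> = \<zero>"
  using minus_equality[of \<zero> \<zero>] by simp

lemma diff_minus_eq: "x \<in> carrier A \<Longrightarrow> y \<in> carrier A \<Longrightarrow> x \<ominus> \<ominus> y = x \<oplus> y"
  by (simp add: a_minus_def)

lemma mult_minus: "x \<in> carrier A \<Longrightarrow> y \<in> carrier A \<Longrightarrow> (\<ominus> x) \<otimes> y = \<ominus> (x \<otimes> y)"
  "x \<in> carrier A \<Longrightarrow> y \<in> carrier A \<Longrightarrow> x \<otimes> (\<ominus> y) = \<ominus> (x \<otimes> y)"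
  by (simp_all add: smult_mult_left smult_mult_right flip: scale_minus_one)

lemma adj_minus: "x \<in> carrier A \<Longrightarrow> adj A (\<ominus> x) = \<ominus> adj A x"
  by (simp add: adj_smult flip: scale_minus_one)

lemma mult_diff_left: "x \<in> carrier A \<Longrightarrow> y \<in> carrier A \<Longrightarrow> z \<in> carrier A \<Longrightarrow> (x \<ominus> y) \<otimes> z = x \<otimes> z \<ominus> y \<otimes> z"
  and mult_diff_right: "x \<in> carrier A \<Longrightarrow> y \<in> carrier A \<Longrightarrow> z \<in> carrier A \<Longrightarrow> z \<otimes> (x \<ominus> y) = z \<otimes> x \<ominus> z \<otimes> y"
  and adj_diff: "x \<in> carrier A \<Longrightarrow> y \<in> carrier A \<Longrightarrow> adj A (x \<ominus> y) = adj A x \<ominus> adj A y"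
  by (simp_all add: a_minus_def distrib_left distrib_right mult_minus adj_add adj_minus)

lemma nrm_zero [simp]: "nrm A \<zero> = 0"
  by (simp add: nrm_eq_0_iff)

lemma nrm_minus [simp]: "x \<in> carrier A \<Longrightarrow> nrm A (\<ominus> x) = nrm A x"
  by (simp add: nrm_smult flip: scale_minus_one)

lemma nrm_diff: "x \<in> carrier A \<Longrightarrow> y \<in> carrier A \<Longrightarrow> nrm A (x \<ominus> y) \<le> nrm A x + nrm A y"
  using nrm_add[of x "\<ominus> y"] by (simp add: a_minus_def)

lemma nrm_diff_commute: "x \<in> carrier A \<Longrightarrow> y \<in> carrier A \<Longrightarrow> nrm A (x \<ominus> y) = nrm A (y \<ominus> x)"
  using nrm_minus[of "x \<ominus> y"] by (simp add: a_minus_def minus_add a_comm)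

lemma diff_eq_zero_iff: "x \<in> carrier A \<Longrightarrow> y \<in> carrier A \<Longrightarrow> x \<ominus> y = \<zero> \<longleftrightarrow> x = y"
  by (metis add.m_comm a_inv_closed a_minus_def add.inv_closed minus_equality minus_minus r_neg)

lemma diff_add_diff:
  assumes "x \<in> carrier A" "y \<in> carrier A" "z \<in> carrier A"
  shows "(x \<ominus> y) \<oplus> (y \<ominus> z) = x \<ominus> z"
  using assms by (simp add: a_minus_def a_ac r_neg1 r_neg2)

lemma nrm_triangle_diff:
  assumes "x \<in> carrier A" "y \<in> carrier A" "z \<in> carrier A"
  shows "nrm A (x \<ominus> z) \<le> nrm A (x \<ominus> y) + nrm A (y \<ominus> z)"
  using nrm_add[of "x \<ominus> y" "y \<ominus> z"] assms by (simp add: diff_add_diff)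

lemma finsum_mult_left:
  assumes "finite F" "f \<in> F \<rightarrow> carrier A" "y \<in> carrier A"
  shows "y \<otimes> finsum A f F = finsum A (\<lambda>i. y \<otimes> f i) F"
  using assms(1,2) by (induction F) (auto simp: assms(3) Pi_def distrib_left)

lemma finsum_mult_right:
  assumes "finite F" "f \<in> F \<rightarrow> carrier A" "y \<in> carrier A"
  shows "finsum A f F \<otimes> y = finsum A (\<lambda>i. f i \<otimes> y) F"
  using assms(1,2) by (induction F) (auto simp: assms(3) Pi_def distrib_right)

lemma adj_finsum:
  assumes "finite F" "f \<in> F \<rightarrow> carrier A"
  shows "adj A (finsum A f F) = finsum A (\<lambda>i. adj A (f i)) F"
  using assms by (induction F) (auto simp: Pi_def adj_add)

lemma nrm_finsum:
  assumes "finite F" "f \<in> F \<rightarrow> carrier A"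
  shows "nrm A (finsum A f F) \<le> (\<Sum>i\<in>F. nrm A (f i))"
  using assms
proof (induction F)
  case (insert a F)
  then show ?case using nrm_add[of "f a" "finsum A f F"] by (auto simp: Pi_def)
qed simp

lemma finsum_single:
  assumes "finite F" "f \<in> F \<rightarrow> carrier A" "a \<in> F" "\<And>i. i \<in> F \<Longrightarrow> i \<noteq> a \<Longrightarrow> f i = \<zero>"
  shows "finsum A f F = f a"
proof -
  have "finsum A f F = finsum A (\<lambda>i. if a = i then f i else \<zero>) F"
    using assms by (intro finsum_cong') auto
  then show ?thesis using finsum_singleton[of a F f] assms by simp
qed

lemma adj_mult_self_eq_zero: "x \<in> carrier A \<Longrightarrow> adj A x \<otimes> x = \<zero> \<Longrightarrow> x = \<zero>"
  using cstar_identity[of x] nrm_eq_0_iff by simp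

definition projection :: "'a \<Rightarrow> bool" where
  "projection p \<longleftrightarrow> p \<in> carrier A \<and> p \<otimes> p = p \<and> adj A p = p"

lemma projection_nrm: "projection p \<Longrightarrow> nrm A p \<le> 1"
proof -
  assume p: "projection p"
  then have "nrm A p = nrm A p * nrm A p"
    using cstar_identity[of p] by (simp add: projection_def power2_eq_square)
  then show "nrm A p \<le> 1" by (metis mult_cancel_left1 order_refl zero_le_one)
qed

end

section \<open>Extremality of the unit of a corner\<close>

locale corner_element = cstar_algebra A for A :: "'a cstar" (structure) +
  fixes p y
  assumes p: "p \<in> carrier A" "p \<otimes> p = p" and y: "y \<in> carrier A" "p \<otimes> y = y" "y \<otimes> p = y"
begin

text \<open>With \<open>p\<close> in the role of \<open>1\<close>, recording only coefficients turns the identities between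
  polynomials in \<open>y\<close> into arithmetic.\<close>

definition cubic :: "complex \<Rightarrow> complex \<Rightarrow> complex \<Rightarrow> complex \<Rightarrow> 'a" where
  "cubic a b c d = a \<odot> p \<oplus> (b \<odot> y \<oplus> (c \<odot> (y \<otimes> y) \<oplus> d \<odot> (y \<otimes> y \<otimes> y)))"

lemma cubic_closed [simp]: "cubic a b c d \<in> carrier A"
  using p y by (simp add: cubic_def)

lemma cubic_add: "cubic a b c d \<oplus> cubic a' b' c' d' = cubic (a + a') (b + b') (c + c') (d + d')"
  using p y by (simp add: cubic_def scale_add_left a_ac)

lemma cubic_scale: "k \<odot> cubic a b c d = cubic (k * a) (k * b) (k * c) (k * d)"
  using p y by (simp add: cubic_def scale_add_right scale_scale)

lemma cubic_diff: "cubic a b c d \<ominus> cubic a' b' c' d' = cubic (a - a') (b - b') (c - c') (d - d')"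
  using cubic_scale[of "-1" a' b' c' d'] by (simp add: a_minus_def cubic_add flip: scale_minus_one)

text \<open>A quadratic polynomial times a linear one stays cubic, which covers every product needed
  below.\<close>

lemma cubic_mult: "cubic a b c 0 \<otimes> cubic a' b' 0 0 = cubic (a * a') (a * b' + b * a') (b * b' + c * a') (c * b')"
proof -
  have "p \<otimes> (y \<otimes> y) = y \<otimes> y" "y \<otimes> y \<otimes> p = y \<otimes> y"
    using p y by (simp_all add: mult_assoc flip: mult_assoc[of p])
  then show ?thesis
    using p y by (simp add: cubic_def distrib_left distrib_right smult_mult_left smult_mult_right scale_scale
        scale_add_left scale_add_right a_ac mult.commute)
qed

lemma cubic_p: "cubic 1 0 0 0 = p" and cubic_y: "cubic 0 1 0 0 = y"
  and cubic_yyy: "cubic 0 0 0 1 = y \<otimes> y \<otimes> y"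
  using p y by (simp_all add: cubic_def)

definition small :: bool where
  "small \<longleftrightarrow> nrm A (p \<oplus> y) \<le> 1 \<and> nrm A (p \<ominus> y) \<le> 1"

lemma small_iff: "small \<longleftrightarrow> nrm A (cubic 1 1 0 0) \<le> 1 \<and> nrm A (cubic 1 (-1) 0 0) \<le> 1"
  using cubic_add[of 1 0 0 0 0 1 0 0] cubic_diff[of 1 0 0 0 0 1 0 0]
  by (simp add: small_def cubic_p cubic_y)

lemma nrm_cubic_mult_le:
  assumes "nrm A (cubic a b c 0) \<le> k" "nrm A (cubic a' b' 0 0) \<le> l"
  shows "nrm A (cubic (a * a') (a * b' + b * a') (b * b' + c * a') (c * b')) \<le> k * l"
proof -
  have k: "0 \<le> k" using assms(1) nrm_nonneg[of "cubic a b c 0"] by simp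
  have "nrm A (cubic a b c 0 \<otimes> cubic a' b' 0 0) \<le> nrm A (cubic a b c 0) * nrm A (cubic a' b' 0 0)"
    by (simp add: nrm_mult)
  also have "\<dots> \<le> k * l" using assms k nrm_nonneg by (intro mult_mono) auto
  finally show ?thesis by (simp add: cubic_mult)
qed

lemma small_squares:
  assumes small
  shows "nrm A (cubic 1 2 1 0) \<le> 1" "nrm A (cubic 1 (-2) 1 0) \<le> 1"
  using nrm_cubic_mult_le[of 1 1 0 1 1 1 1] nrm_cubic_mult_le[of 1 "-1" 0 1 1 "-1" 1] assms
  by (auto simp: small_iff)

text \<open>The difference of the squares of \<open>p + y\<close> and \<open>p - y\<close> is
  \<open>4 y\<close>, and both squares have norm at most 1.\<close>

lemma small_nrm_le:
  assumes small
  shows "nrm A y \<le> 1 / 2"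
proof -
  have "4 * nrm A y = nrm A (4 \<odot> y)" using y by (simp add: nrm_smult)
  also have "4 \<odot> y = cubic 1 2 1 0 \<ominus> cubic 1 (-2) 1 0"
    using cubic_scale[of 4 0 1 0 0] by (simp add: cubic_diff cubic_y)
  also have "nrm A \<dots> \<le> 2" using small_squares[OF assms] nrm_diff[of "cubic 1 2 1 0" "cubic 1 (-2) 1 0"] by simp
  finally show ?thesis by simp
qed

text \<open>The new element is \<open>z = (3 y - y^3) / 2\<close>. From
  \<open>3 y = 2 z + y^3\<close> and the bound 1/2 on the norm of \<open>y\<close>, the cube costs
  at most a quarter of that norm. So twice the norm of \<open>z\<close> is at least
  \<open>3 - 1/4 = 11/4\<close> times the norm of \<open>y\<close>.\<close>

lemma small_grows:
  assumes small
  obtains z where "z \<in> carrier A" "p \<otimes> z = z" "z \<otimes> p = z" "nrm A (p \<oplus> z) \<le> 1" "nrm A (p \<ominus> z) \<le> 1"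
    "11 / 8 * nrm A y \<le> nrm A z"
proof -
  let ?z = "cubic 0 (3 / 2) 0 (- 1 / 2)"
  have two: "nrm A (cubic 2 (-1) 0 0) \<le> 2" "nrm A (cubic 2 1 0 0) \<le> 2"
  proof -
    have "cubic 2 (-1) 0 0 = p \<oplus> cubic 1 (-1) 0 0" "cubic 2 1 0 0 = p \<oplus> cubic 1 1 0 0"
      using cubic_add[of 1 0 0 0 1 "-1" 0 0] cubic_add[of 1 0 0 0 1 1 0 0] by (simp_all add: cubic_p)
    \<comment> \<open>Here \<open>p\<close> is merely idempotent, so its norm is bounded by writing
      it as the average of \<open>p + y\<close> and \<open>p - y\<close>.\<close>
    moreover have "nrm A p \<le> 1"
    proof -
      have "2 \<odot> p = cubic 1 1 0 0 \<oplus> cubic 1 (-1) 0 0"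
        using cubic_scale[of 2 1 0 0 0] by (simp add: cubic_add cubic_p)
      then have "2 * nrm A p \<le> nrm A (cubic 1 1 0 0) + nrm A (cubic 1 (-1) 0 0)"
        using nrm_smult[OF p(1), of 2] nrm_add[of "cubic 1 1 0 0" "cubic 1 (-1) 0 0"] by simp
      then show ?thesis using assms by (simp add: small_iff)
    qed
    ultimately show "nrm A (cubic 2 (-1) 0 0) \<le> 2" "nrm A (cubic 2 1 0 0) \<le> 2"
      using nrm_add[OF p(1), of "cubic 1 (-1) 0 0"] nrm_add[OF p(1), of "cubic 1 1 0 0"] assms
      by (auto simp: small_iff)
  qed
  have "nrm A (cubic 2 3 0 (-1)) \<le> 2" "nrm A (cubic 2 (-3) 0 1) \<le> 2"
    using nrm_cubic_mult_le[OF small_squares(1)[OF assms] two(1)]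
      nrm_cubic_mult_le[OF small_squares(2)[OF assms] two(2)] by simp_all
  moreover have "p \<oplus> ?z = (1 / 2) \<odot> cubic 2 3 0 (-1)" "p \<ominus> ?z = (1 / 2) \<odot> cubic 2 (-3) 0 1"
    using cubic_add[of 1 0 0 0 0 "3/2" 0 "-1/2"] cubic_diff[of 1 0 0 0 0 "3/2" 0 "-1/2"]
    by (simp_all add: cubic_scale cubic_p)
  ultimately have 1: "nrm A (p \<oplus> ?z) \<le> 1" "nrm A (p \<ominus> ?z) \<le> 1"
    by (simp_all add: nrm_smult norm_divide)
  have "3 * nrm A y = nrm A (3 \<odot> y)" using y by (simp add: nrm_smult)
  also have "3 \<odot> y = 2 \<odot> ?z \<oplus> y \<otimes> y \<otimes> y"
    using cubic_scale[of 3 0 1 0 0] cubic_scale[of 2 0 "3/2" 0 "-1/2"] cubic_add[of 0 3 0 "-1" 0 0 0 1]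
    by (simp add: cubic_y cubic_yyy)
  also have "nrm A \<dots> \<le> 2 * nrm A ?z + nrm A (y \<otimes> y \<otimes> y)"
    using nrm_add[of "2 \<odot> ?z" "y \<otimes> y \<otimes> y"] y by (simp add: nrm_smult)
  also have "nrm A (y \<otimes> y \<otimes> y) \<le> nrm A y * nrm A y * nrm A y"
    using nrm_mult[of "y \<otimes> y" y] nrm_mult[of y y] nrm_nonneg[of y] y
    by (meson mult_closed mult_right_mono order_trans)
  also have "\<dots> \<le> 1 / 4 * nrm A y"
    using mult_mono[of "nrm A y" "1/2" "nrm A y" "1/2"] small_nrm_le[OF assms] nrm_nonneg[OF y(1)]
    by (intro mult_right_mono) auto
  finally have "11 / 8 * nrm A y \<le> nrm A ?z" by simp
  moreover have "p \<otimes> ?z = ?z" "?z \<otimes> p = ?z"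
  proof -
    have "p \<otimes> (y \<otimes> y \<otimes> y) = y \<otimes> y \<otimes> y" "y \<otimes> y \<otimes> y \<otimes> p = y \<otimes> y \<otimes> y"
      using p y by (simp_all add: mult_assoc flip: mult_assoc[of p])
    then show "p \<otimes> ?z = ?z" "?z \<otimes> p = ?z"
      using p y by (simp_all add: cubic_def distrib_left distrib_right smult_mult_left smult_mult_right)
  qed
  ultimately show ?thesis using that[of ?z] 1 by simp
qed

end

context cstar_algebra
begin

text \<open>The map \<open>y \<mapsto> (3y - y\<^sup>3) / 2\<close> preserves the two norm bounds, because \<open>2 \<plusminus> (3y - y\<^sup>3) = (1 \<plusminus> y)\<^sup>2 (2 \<minusplus> y)\<close>,
  but it expands norms by a factor \<open>11/8\<close>.\<close>

lemma corner_unit_extreme: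
  assumes "p \<in> carrier A" "p \<otimes> p = p" "y \<in> carrier A" "p \<otimes> y = y" "y \<otimes> p = y"
    and "nrm A (p \<oplus> y) \<le> 1" "nrm A (p \<ominus> y) \<le> 1"
  shows "y = \<zero>"
proof -
  \<comment> \<open>The bound is proved for all admissible elements at once, because the induction
    hypothesis is applied to the enlarged element \<open>z\<close> and not to
    \<open>y\<close>.\<close>
  have bound: "nrm A y \<le> (8 / 11) ^ n" if "y \<in> carrier A" "p \<otimes> y = y" "y \<otimes> p = y"
    "nrm A (p \<oplus> y) \<le> 1" "nrm A (p \<ominus> y) \<le> 1" for n y
    using that
  proof (induction n arbitrary: y)
    case 0
    interpret corner_element A p y using assms 0 by unfold_locales auto
    show ?case using small_nrm_le 0 by (simp add: small_def)
  next
    case (Suc n)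
    interpret corner_element A p y using assms Suc by unfold_locales auto
    obtain z where z: "z \<in> carrier A" "p \<otimes> z = z" "z \<otimes> p = z" "nrm A (p \<oplus> z) \<le> 1" "nrm A (p \<ominus> z) \<le> 1"
      "11 / 8 * nrm A y \<le> nrm A z"
      using small_grows Suc.prems by (auto simp: small_def)
    then have "11 / 8 * nrm A y \<le> (8 / 11) ^ n" using Suc.IH[of z] by linarith
    then show ?case by simp
  qed
  have "(\<lambda>n. (8 / 11 :: real) ^ n) \<longlonglongrightarrow> 0" by (rule LIMSEQ_power_zero) simp
  then have "nrm A y \<le> 0" by (rule LIMSEQ_le_const) (use bound[of y] assms in blast)
  then show ?thesis using nrm_eq_0_iff nrm_nonneg assms by fastforce
qed

lemma corner_unit_extreme_scaled:
  assumes "p \<in> carrier A" "p \<otimes> p = p" "x \<in> carrier A" "p \<otimes> x = x" "x \<otimes> p = x" and r: "0 < r"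
    and "nrm A (of_real r \<odot> p \<oplus> x) \<le> r" "nrm A (of_real r \<odot> p \<ominus> x) \<le> r"
  shows "x = \<zero>"
proof -
  let ?y = "of_real (1 / r) \<odot> x"
  have rr: "of_real (1 / r) * of_real r = (1 :: complex)" using r by simp
  have "of_real (1 / r) \<odot> (of_real r \<odot> p \<oplus> x) = p \<oplus> ?y"
    using assms rr by (simp only: scale_add_right scale_scale scale_closed scale_one)
  moreover have "of_real (1 / r) \<odot> (of_real r \<odot> p \<ominus> x) = p \<ominus> ?y"
    using assms rr scale_scale[of x "-1" "of_real (1 / r)"] scale_scale[of x "of_real (1 / r)" "-1"]
    by (simp add: a_minus_def scale_add_right scale_scale flip: scale_minus_one)
  ultimately have "nrm A (p \<oplus> ?y) \<le> 1" "nrm A (p \<ominus> ?y) \<le> 1"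
    using nrm_smult[of "of_real r \<odot> p \<oplus> x" "of_real (1 / r)"] nrm_smult[of "of_real r \<odot> p \<ominus> x" "of_real (1 / r)"]
      assms by (simp_all add: norm_divide pos_divide_le_eq)
  then have "?y = \<zero>"
    using assms by (intro corner_unit_extreme[of p ?y]) (auto simp: smult_mult_left smult_mult_right)
  then have "of_real r \<odot> ?y = \<zero>" using smult_r_null by simp
  then show ?thesis using assms r by (simp add: scale_scale)
qed

text \<open>Banach's fixed point argument for the contraction that sends \<open>x\<close> to
  \<open>b + h x\<close>. The iterates from 0 are partial sums of the Neumann series applied to
  \<open>b\<close>, so the inverse of \<open>1 - h\<close> is never formed and no unit is
  assumed.\<close>

lemma fixpoint_affine:
  assumes b: "b \<in> carrier A" and h: "h \<in> carrier A" and lt: "nrm A h < 1"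
  obtains g where "g \<in> carrier A" "g = b \<oplus> h \<otimes> g"
proof -
  define f where "f = rec_nat \<zero> (\<lambda>_ x. b \<oplus> h \<otimes> x)"
  have f0: "f 0 = \<zero>" and fS: "f (Suc n) = b \<oplus> h \<otimes> f n" for n by (simp_all add: f_def)
  have fc [simp]: "f n \<in> carrier A" for n by (induction n) (use b h in \<open>auto simp: f0 fS\<close>)
  let ?c = "nrm A h" and ?B = "nrm A b / (1 - nrm A h)"
  have c0: "0 \<le> ?c" using nrm_nonneg h by simp
  have B0: "0 \<le> ?B" using nrm_nonneg b lt by simp
  have step: "f (Suc m) \<ominus> f (Suc n) = h \<otimes> (f m \<ominus> f n)" for m n
    using b h by (simp add: fS mult_diff_right) (simp add: a_minus_def minus_add a_ac r_neg1 r_neg2)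
  have fB: "nrm A (f n) \<le> ?B" for n
  proof (induction n)
    case 0
    show ?case using B0 by (simp add: f0)
  next
    case (Suc n)
    have "nrm A (f (Suc n)) \<le> nrm A b + nrm A (h \<otimes> f n)" using nrm_add b h by (simp add: fS)
    also have "\<dots> \<le> nrm A b + ?c * ?B"
      using nrm_mult[of h "f n"] Suc mult_left_mono[OF Suc c0] h by simp
    also have "\<dots> = ?B" using lt by (simp add: field_simps)
    finally show ?case .
  qed
  have fd: "nrm A (f (n + d) \<ominus> f n) \<le> ?c ^ n * ?B" for n d
  proof (induction n)
    case 0
    show ?case using fB[of d] by (simp add: f0 a_minus_def)
  next
    case (Suc n)
    have "nrm A (f (Suc n + d) \<ominus> f (Suc n)) \<le> ?c * nrm A (f (n + d) \<ominus> f n)"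
      using step[of "n + d" n] nrm_mult[of h "f (n + d) \<ominus> f n"] h by simp
    also have "\<dots> \<le> ?c * (?c ^ n * ?B)" using Suc c0 by (intro mult_left_mono)
    finally show ?case by (simp add: mult_ac)
  qed
  have lim: "(\<lambda>n. ?c ^ n * ?B) \<longlonglongrightarrow> 0"
    using tendsto_mult_left_zero[OF LIMSEQ_power_zero[of ?c], of ?B] c0 lt by simp
  have "\<exists>g\<in>carrier A. (\<lambda>n. nrm A (f n \<ominus> g)) \<longlonglongrightarrow> 0"
  proof (rule complete)
    fix e :: real assume "0 < e"
    then obtain N where N: "\<And>n. n \<ge> N \<Longrightarrow> ?c ^ n * ?B < e"
      using order_tendstoD(2)[OF lim] by (auto simp: eventually_sequentially)
    have ord: "nrm A (f m \<ominus> f n) < e" if "n \<ge> N" "m \<ge> n" for m n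
      using fd[of n "m - n"] N[OF that(1)] that(2) by simp
    have "nrm A (f m \<ominus> f n) < e" if "n \<ge> N" "m \<ge> N" for m n
    proof (cases "n \<le> m")
      case False
      then have "nrm A (f n \<ominus> f m) < e" using ord that by simp
      then show ?thesis using nrm_diff_commute[of "f m" "f n"] by simp
    qed (use ord that in simp)
    then show "\<exists>N. \<forall>m\<ge>N. \<forall>n\<ge>N. nrm A (f m \<ominus> f n) < e" by blast
  qed simp
  then obtain g where g: "g \<in> carrier A" "(\<lambda>n. nrm A (f n \<ominus> g)) \<longlonglongrightarrow> 0" by blast
  let ?d = "g \<ominus> (b \<oplus> h \<otimes> g)"
  have "nrm A ?d \<le> nrm A (f (Suc n) \<ominus> g) + ?c * nrm A (f n \<ominus> g)" for n
  proof -
    have "f (Suc n) \<ominus> (b \<oplus> h \<otimes> g) = h \<otimes> (f n \<ominus> g)"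
      using b h g by (simp add: fS mult_diff_right) (simp add: a_minus_def minus_add a_ac r_neg1 r_neg2)
    then have "nrm A ?d \<le> nrm A (g \<ominus> f (Suc n)) + nrm A (h \<otimes> (f n \<ominus> g))"
      using nrm_triangle_diff[of g "f (Suc n)" "b \<oplus> h \<otimes> g"] b h g by simp
    also have "\<dots> \<le> nrm A (f (Suc n) \<ominus> g) + ?c * nrm A (f n \<ominus> g)"
      using nrm_mult[of h "f n \<ominus> g"] nrm_diff_commute[of g "f (Suc n)"] h g by simp
    finally show ?thesis .
  qed
  moreover have "(\<lambda>n. nrm A (f (Suc n) \<ominus> g) + ?c * nrm A (f n \<ominus> g)) \<longlonglongrightarrow> 0 + ?c * 0"
    by (intro tendsto_intros g LIMSEQ_Suc)
  ultimately have "nrm A ?d \<le> 0 + ?c * 0" by (intro LIMSEQ_le_const) auto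
  then have "?d = \<zero>" using nrm_eq_0_iff[of ?d] nrm_nonneg[of ?d] b h g by simp
  then have "g = b \<oplus> h \<otimes> g" using diff_eq_zero_iff b h g by simp
  then show ?thesis using that g by blast
qed

end

locale unital_cstar_algebra = cstar_algebra A for A :: "'a cstar" (structure) +
  fixes e
  assumes unit: "is_unit_of A e"
begin

lemma unit_closed [simp, intro]: "e \<in> carrier A" and unit_mult [simp]: "x \<in> carrier A \<Longrightarrow> e \<otimes> x = x"
  "x \<in> carrier A \<Longrightarrow> x \<otimes> e = x"
  using unit by (auto simp: is_unit_of_def)

lemma unit_of_eq: "unit_of A = e"
  unfolding unit_of_def
proof (rule the_equality)
  show "is_unit_of A e" by (rule unit)
  fix f assume "is_unit_of A f"
  then have "f \<otimes> e = e" "f \<in> carrier A" using unit_closed unfolding is_unit_of_def by blast+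
  then show "f = e" using unit_mult(2) by simp
qed

lemma adj_unit [simp]: "adj A e = e"
  by (metis adj_adj adj_closed adj_mult unit_closed unit_mult(1) unit_mult(2))

lemma projection_complement: "projection p \<Longrightarrow> projection (e \<ominus> p)"
  by (auto simp: projection_def mult_diff_left mult_diff_right adj_diff)
    (simp add: a_minus_def minus_add a_ac r_neg)

text \<open>Compress everything to the corner of \<open>p = q i\<close>. The hypothesis makes the
  compressions \<open>x k\<close> sum to \<open>p\<close>, and \<open>x i\<close> is
  \<open>p\<close> already, so the others sum to zero. Positivity would finish here. Instead let
  \<open>N\<close> count the indices other than \<open>i\<close>. Then \<open>N p + x j\<close> is
  the sum of \<open>p\<close> and of all \<open>p - x k\<close> with \<open>k\<close> different from
  \<open>i\<close> and \<open>j\<close>, and \<open>N p - x j\<close> is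
  \<open>(N - 1) p + (p - x j)\<close>. Each \<open>p - x k\<close> has norm at most 1, so both have
  norm at most \<open>N\<close>, and extremality gives \<open>x j = 0\<close>.\<close>

lemma sum_of_projections_orthogonal:
  assumes fin: "finite I" and q: "\<And>i. i \<in> I \<Longrightarrow> projection (q i)"
    and i: "i \<in> I" and j: "j \<in> I" "i \<noteq> j" and s: "finsum A q I \<otimes> q i = q i"
  shows "q j \<otimes> q i = \<zero>"
proof -
  let ?p = "q i" and ?J = "I - {i}"
  have qc [simp]: "q k \<in> carrier A" "q k \<otimes> q k = q k" "adj A (q k) = q k" if "k \<in> I" for k
    using q[OF that] by (auto simp: projection_def)
  define x where "x k = q i \<otimes> q k \<otimes> q i" for k
  have xc [simp]: "x k \<in> carrier A" if "k \<in> I" for k using that i by (simp add: x_def)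
  have "?p = ?p \<otimes> (finsum A q I \<otimes> ?p)" using s i by simp
  also have "\<dots> = finsum A x I"
  proof -
    have "?p \<otimes> (finsum A q I \<otimes> ?p) = finsum A (\<lambda>k. ?p \<otimes> (q k \<otimes> ?p)) I"
      using fin i by (simp add: finsum_mult_right finsum_mult_left Pi_def)
    also have "\<dots> = finsum A x I" using i by (intro finsum_cong') (auto simp: x_def mult_assoc)
    finally show ?thesis .
  qed
  also have "\<dots> = x i \<oplus> finsum A x ?J"
    using fin i finsum_insert[of ?J i x] by (auto simp: Pi_def insert_absorb)
  also have "x i = ?p" using i by (simp add: x_def)
  finally have "?p = ?p \<oplus> finsum A x ?J" .
  moreover have "finsum A x ?J \<in> carrier A" by (intro finsum_closed) auto
  ultimately have sum0: "finsum A x ?J = \<zero>" using add.l_cancel_one' qc(1)[OF i] by blast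
  have px: "nrm A (?p \<ominus> x k) \<le> 1" if "k \<in> I" for k
  proof -
    have "?p \<ominus> x k = ?p \<otimes> (e \<ominus> q k) \<otimes> ?p"
      using that i by (simp add: x_def mult_diff_left mult_diff_right)
    then have "nrm A (?p \<ominus> x k) \<le> nrm A (?p \<otimes> (e \<ominus> q k)) * nrm A ?p"
      using nrm_mult[of "?p \<otimes> (e \<ominus> q k)" ?p] that i by simp
    also have "\<dots> \<le> (nrm A ?p * nrm A (e \<ominus> q k)) * nrm A ?p"
      using nrm_mult[of ?p "e \<ominus> q k"] that i nrm_nonneg[of ?p] by (intro mult_right_mono) auto
    also have "\<dots> \<le> 1"
      using projection_nrm[OF q[OF i]] projection_nrm[OF projection_complement[OF q[OF that]]] that i
      by (intro mult_le_one mult_nonneg_nonneg nrm_nonneg) auto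
    finally show ?thesis .
  qed
  let ?K = "?J - {j}"
  have finK: "finite ?K" using fin by simp
  have Ksum: "finsum A (\<lambda>k. ?p \<ominus> x k) F = of_nat (card F) \<odot> ?p \<ominus> finsum A x F" if "finite F" "F \<subseteq> I" for F
    using that
  proof (induction F rule: finite_induct)
    case empty
    then show ?case using i by (simp add: a_minus_def)
  next
    case (insert k F)
    have "finsum A (\<lambda>k. ?p \<ominus> x k) (insert k F) = (?p \<ominus> x k) \<oplus> finsum A (\<lambda>k. ?p \<ominus> x k) F"
      using insert i by (intro finsum_insert) auto
    moreover have "finsum A x (insert k F) = x k \<oplus> finsum A x F" using insert by (intro finsum_insert) auto
    moreover have "finsum A x F \<in> carrier A" using insert by (intro finsum_closed) auto
    ultimately show ?case using insert i
      by (simp add: scale_add_left) (simp add: a_minus_def minus_add a_ac)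
  qed
  let ?N = "real (card ?J)"
  have "Suc (card ?K) = card ?J" using fin j by (intro card_Suc_Diff1) auto
  then have N: "?N = real (card ?K) + 1" by (metis add.commute of_nat_Suc)
  then have Npos: "0 < ?N" by simp
  have xj: "finsum A x ?K = \<ominus> x j"
  proof -
    have "finsum A x ?J = x j \<oplus> finsum A x ?K"
      using fin j finsum_insert[of ?K j x] by (auto simp: Pi_def insert_absorb)
    moreover have "finsum A x ?K \<in> carrier A" by (rule finsum_closed) auto
    ultimately show ?thesis using sum0 j minus_equality[of "finsum A x ?K" "x j"] by (simp add: a_comm)
  qed
  have "x j = \<zero>"
  proof (rule corner_unit_extreme_scaled[of ?p "x j" ?N])
    show "?p \<otimes> x j = x j" "x j \<otimes> ?p = x j" using i j by (simp_all add: x_def mult_assoc flip: mult_assoc[of "q i" "q i"])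
    have "of_real ?N \<odot> ?p \<oplus> x j = finsum A (\<lambda>k. ?p \<ominus> x k) ?K \<oplus> ?p"
    proof -
      have "finsum A (\<lambda>k. ?p \<ominus> x k) ?K = of_nat (card ?K) \<odot> ?p \<oplus> x j"
      proof -
        have "?K \<subseteq> I" by auto
        from Ksum[OF finK this] show ?thesis unfolding xj using i j by (simp add: diff_minus_eq)
      qed
      moreover have "of_real ?N \<odot> ?p = of_nat (card ?K) \<odot> ?p \<oplus> ?p"
        using i by (simp only: N of_real_add of_real_of_nat_eq of_real_1) (simp add: scale_add_left)
      ultimately show ?thesis using i j by (simp add: a_ac)
    qed
    also have "nrm A \<dots> \<le> nrm A (finsum A (\<lambda>k. ?p \<ominus> x k) ?K) + nrm A ?p"
      using i by (intro nrm_add finsum_closed) auto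
    also have "\<dots> \<le> (\<Sum>k\<in>?K. nrm A (?p \<ominus> x k)) + 1"
      using nrm_finsum[OF finK, of "\<lambda>k. ?p \<ominus> x k"] projection_nrm[OF q[OF i]] i by (force intro: add_mono)
    also have "\<dots> \<le> (\<Sum>k\<in>?K. 1) + 1" using px by (intro add_mono sum_mono) auto
    also have "\<dots> = ?N" by (simp add: N)
    finally show "nrm A (of_real ?N \<odot> ?p \<oplus> x j) \<le> ?N" .
    have "of_real ?N \<odot> ?p \<ominus> x j = of_real (real (card ?K)) \<odot> ?p \<oplus> (?p \<ominus> x j)"
      using i j by (simp only: N) (simp add: scale_add_left a_minus_def a_ac)
    also have "nrm A \<dots> \<le> real (card ?K) * nrm A ?p + nrm A (?p \<ominus> x j)"
      using nrm_add[of "of_real (real (card ?K)) \<odot> ?p" "?p \<ominus> x j"] i j by (simp add: nrm_smult)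
    also have "\<dots> \<le> real (card ?K) * 1 + 1"
      using px[OF j(1)] projection_nrm[OF q[OF i]] by (intro add_mono mult_left_mono) auto
    finally show "nrm A (of_real ?N \<odot> ?p \<ominus> x j) \<le> ?N" by (simp add: N)
  qed (use i j Npos in auto)
  \<comment> \<open>This product is \<open>x j\<close>, so the \<open>C*\<close>-identity removes
    the compression.\<close>
  have "adj A (q j \<otimes> q i) \<otimes> (q j \<otimes> q i) = q i \<otimes> (q j \<otimes> (q j \<otimes> q i))"
    using i j by (simp add: adj_mult mult_assoc)
  also have "q j \<otimes> (q j \<otimes> q i) = q j \<otimes> q i"
    using mult_assoc[of "q j" "q j" "q i"] i j by simp
  also have "q i \<otimes> (q j \<otimes> q i) = \<zero>"
    using \<open>x j = \<zero>\<close> i j by (simp add: x_def mult_assoc)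
  finally have "adj A (q j \<otimes> q i) \<otimes> (q j \<otimes> q i) = \<zero>" .
  then show ?thesis by (rule adj_mult_self_eq_zero[rotated]) (use i j in simp)
qed

end

section \<open>Sequences of isometries with orthogonal ranges\<close>

locale orthogonal_isometries = unital_cstar_algebra A e for A :: "'a cstar" (structure) and e +
  fixes S :: "nat \<Rightarrow> 'a"
  assumes S_closed [simp]: "S i \<in> carrier A"
    and S_orthogonal: "adj A (S i) \<otimes> S j = (if i = j then e else \<zero>)"
begin

definition range_proj :: "nat \<Rightarrow> 'a" where
  "range_proj n = finsum A (\<lambda>i. S i \<otimes> adj A (S i)) {..<n}"

lemma range_proj_closed [simp]: "range_proj n \<in> carrier A"
  by (simp add: range_proj_def Pi_def)

lemma adj_S_finsum:
  assumes "\<And>i. i < n \<Longrightarrow> f i \<in> carrier A" "i < n"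
  shows "adj A (S i) \<otimes> finsum A (\<lambda>j. S j \<otimes> f j) {..<n} = f i"
proof -
  have "adj A (S i) \<otimes> (S j \<otimes> f j) = (if i = j then f j else \<zero>)" if "j < n" for j
    using assms(1)[OF that] by (simp add: S_orthogonal flip: mult_assoc)
  then have "adj A (S i) \<otimes> finsum A (\<lambda>j. S j \<otimes> f j) {..<n} = finsum A (\<lambda>j. if i = j then f j else \<zero>) {..<n}"
    using assms by (subst finsum_mult_left) (auto intro!: finsum_cong')
  then show ?thesis using finsum_singleton[of i "{..<n}" f] assms by auto
qed

lemma range_proj_finsum:
  assumes "\<And>i. i < n \<Longrightarrow> f i \<in> carrier A"
  shows "range_proj n \<otimes> finsum A (\<lambda>j. S j \<otimes> f j) {..<n} = finsum A (\<lambda>j. S j \<otimes> f j) {..<n}"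
proof -
  let ?x = "finsum A (\<lambda>j. S j \<otimes> f j) {..<n}"
  have x: "?x \<in> carrier A" using assms by (intro finsum_closed) auto
  have "range_proj n \<otimes> ?x = finsum A (\<lambda>i. S i \<otimes> adj A (S i) \<otimes> ?x) {..<n}"
    unfolding range_proj_def using x by (intro finsum_mult_right) auto
  also have "\<dots> = ?x"
    using assms x by (intro finsum_cong') (auto simp: mult_assoc adj_S_finsum)
  finally show ?thesis .
qed

lemma projection_range_proj: "projection (range_proj n)"
  unfolding projection_def
proof (intro conjI)
  show "range_proj n \<otimes> range_proj n = range_proj n"
    using range_proj_finsum[of n "\<lambda>i. adj A (S i)"] by (simp flip: range_proj_def)
  show "adj A (range_proj n) = range_proj n"
    unfolding range_proj_def by (simp add: adj_finsum adj_mult Pi_def)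
qed simp

lemma range_proj_S:
  assumes "n \<le> m"
  shows "range_proj n \<otimes> S m = \<zero>"
proof -
  have "range_proj n \<otimes> S m = finsum A (\<lambda>i. S i \<otimes> adj A (S i) \<otimes> S m) {..<n}"
    unfolding range_proj_def by (intro finsum_mult_right) auto
  also have "\<dots> = finsum A (\<lambda>_. \<zero>) {..<n}"
    using assms by (intro finsum_cong') (auto simp: mult_assoc S_orthogonal)
  finally show ?thesis by simp
qed

lemma S_range_proj:
  assumes "m < n"
  shows "range_proj n \<otimes> S m = S m" "adj A (S m) \<otimes> range_proj n = adj A (S m)"
proof -
  show "adj A (S m) \<otimes> range_proj n = adj A (S m)"
    unfolding range_proj_def using assms by (intro adj_S_finsum) auto
  then show "range_proj n \<otimes> S m = S m"
    using adj_mult[of "adj A (S m)" "range_proj n"] projection_range_proj[of n] by (simp add: projection_def)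
qed

lemma nrm_S: "nrm A (S i) \<le> 1"
proof -
  have "projection e" by (simp add: projection_def)
  then have "(nrm A (S i))\<^sup>2 \<le> 1" using cstar_identity[of "S i"] projection_nrm[of e] by (simp add: S_orthogonal)
  then show ?thesis by (simp add: power_le_one_iff nrm_nonneg)
qed

text \<open>The row \<open>(S\<^sub>0, S\<^sub>1, r)\<close> implements the equivalence, where \<open>r\<close> is the defect of the first
  two isometries.\<close>

lemma properly_infinite: "properly_infinite A"
proof -
  define r where "r = e \<ominus> range_proj 2"
  have r: "r \<in> carrier A" "r \<otimes> r = r" "adj A r = r"
    using projection_complement[OF projection_range_proj[of 2]] by (auto simp: projection_def r_def)
  have rS: "r \<otimes> S m = \<zero>" "adj A (S m) \<otimes> r = \<zero>" if "m < 2" for m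
    using S_range_proj[OF that] by (simp_all add: r_def mult_diff_left mult_diff_right diff_eq_zero_iff)
  define T where "T i = (if i < 2 then S i else r)" for i :: nat
  have T [simp]: "T i \<in> carrier A" for i using r by (simp add: T_def)
  have TT: "adj A (T i) \<otimes> T j = (if i = j then (if i < 2 then e else r) else \<zero>)" if "i < 3" "j < 3" for i j
    using that rS r by (auto simp: T_def S_orthogonal)
  have sum1: "finsum A f {..<1} = f 0" if "f 0 \<in> carrier A" for f :: "nat \<Rightarrow> 'a"
    using that by (simp add: lessThan_Suc)
  have sum3: "finsum A f {..<3} = f 0 \<oplus> f 1 \<oplus> f 2" if "\<And>i. i < 3 \<Longrightarrow> f i \<in> carrier A" for f :: "nat \<Rightarrow> 'a"
    using that by (simp add: numeral_3_eq_3 lessThan_Suc a_ac numeral_2_eq_2)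
  let ?R = "restrict (\<lambda>_. r) ({..<1} \<times> {..<1})"
  define D where "D = mat_diag A (1 + 1) 1 (mat_diag A 1 1 (one_mat A) (one_mat A)) ?R"
  have D: "D = restrict (\<lambda>(i, j). if i = j then (if i < 2 then e else r) else \<zero>) ({..<3} \<times> {..<3})"
  proof
    fix ij :: "nat \<times> nat"
    obtain i j where ij: "ij = (i, j)" by force
    have "i < 3 \<Longrightarrow> i = 0 \<or> i = 1 \<or> i = 2" "j < 3 \<Longrightarrow> j = 0 \<or> j = 1 \<or> j = 2" by auto
    then show "D ij = restrict (\<lambda>(i, j). if i = j then (if i < 2 then e else r) else \<zero>) ({..<3} \<times> {..<3}) ij"
      unfolding ij D_def mat_diag_def one_mat_def unit_of_eq by auto
  qed
  have R: "mat_proj A 1 ?R"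
    using r sum1 unfolding mat_proj_def mats_def mat_mul_def mat_adj_def
    by (auto simp: fun_eq_iff restrict_def PiE_def extensional_def)
  have O: "mat_proj A 1 (one_mat A)"
    using sum1 unfolding mat_proj_def mats_def mat_mul_def mat_adj_def one_mat_def unit_of_eq
    by (auto simp: fun_eq_iff restrict_def PiE_def extensional_def)
  have PD: "mat_proj A 3 D"
    unfolding mat_proj_def
  proof (intro conjI)
    show "D \<in> mats A 3 3" unfolding D mats_def using r by auto
    show "mat_adj A 3 3 D = D" unfolding D mat_adj_def using r by (auto simp: fun_eq_iff)
    show "mat_mul A 3 3 3 D D = D"
    proof
      fix ij :: "nat \<times> nat"
      obtain i j where ij: "ij = (i, j)" by force
      show "mat_mul A 3 3 3 D D ij = D ij"
      proof (cases "i < 3 \<and> j < 3")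
        case True
        have "mat_mul A 3 3 3 D D ij = finsum A (\<lambda>k. D (i, k) \<otimes> D (k, j)) {..<3}"
          using True by (simp add: mat_mul_def ij)
        also have "\<dots> = D (i, i) \<otimes> D (i, j)"
          using True r by (intro finsum_single) (auto simp: D)
        also have "\<dots> = D (i, j)" using True r by (auto simp: D)
        finally show ?thesis by (simp add: ij)
      next
        case False
        then show ?thesis unfolding D mat_mul_def ij by auto
      qed
    qed
  qed
  define V where "V = restrict (\<lambda>(i :: nat, j). T j) ({..<1} \<times> {..<3})"
  have "V \<in> mats A 1 3" by (auto simp: V_def mats_def)
  moreover have "mat_mul A 3 1 3 (mat_adj A 1 3 V) V = D"
  proof
    fix ij :: "nat \<times> nat"
    obtain i j where ij: "ij = (i, j)" by force
    show "mat_mul A 3 1 3 (mat_adj A 1 3 V) V ij = D ij"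
    proof (cases "i < 3 \<and> j < 3")
      case True
      have "mat_mul A 3 1 3 (mat_adj A 1 3 V) V ij =
          finsum A (\<lambda>k. mat_adj A 1 3 V (i, k) \<otimes> V (k, j)) {..<1}"
        using True by (simp add: mat_mul_def ij)
      also have "\<dots> = adj A (T i) \<otimes> T j"
        using True by (subst sum1) (auto simp: mat_adj_def V_def)
      finally show ?thesis using True TT by (simp add: ij D)
    next
      case False
      then show ?thesis unfolding D mat_mul_def ij by auto
    qed
  qed
  moreover have "mat_mul A 1 3 1 V (mat_adj A 1 3 V) = one_mat A"
  proof -
    have "range_proj 2 = S 0 \<otimes> adj A (S 0) \<oplus> S 1 \<otimes> adj A (S 1)"
      by (simp add: range_proj_def numeral_2_eq_2 lessThan_Suc a_ac)
    then have "S 0 \<otimes> adj A (S 0) \<oplus> S 1 \<otimes> adj A (S 1) \<oplus> r \<otimes> adj A r = range_proj 2 \<oplus> (e \<ominus> range_proj 2)"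
      using r by (simp add: r_def)
    also have "\<dots> = e" by (simp add: a_minus_def a_ac r_neg2 r_neg1 r_neg)
    finally have "finsum A (\<lambda>k. T k \<otimes> adj A (T k)) {..<3} = e"
      by (subst sum3) (auto simp: T_def r(1))
    moreover have "finsum A (\<lambda>k. V (0, k) \<otimes> mat_adj A 1 3 V (k, 0)) {..<3} = finsum A (\<lambda>k. T k \<otimes> adj A (T k)) {..<3}"
      by (intro finsum_cong') (auto simp: V_def mat_adj_def)
    ultimately show ?thesis
      unfolding mat_mul_def one_mat_def unit_of_eq by (auto simp: fun_eq_iff restrict_def)
  qed
  ultimately have "mvn_equiv A 3 D 1 (one_mat A)"
    unfolding mvn_equiv_def using PD O by blast
  moreover have "(3 :: nat) = 1 + 1 + 1" by simp
  ultimately have "mvn_equiv A (1 + 1 + 1) D 1 (one_mat A)" by metis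
  moreover have "unital A" using unit unital_def by blast
  ultimately show ?thesis
    unfolding properly_infinite_def using R D_def by blast
qed

text \<open>The column \<open>(S\<^sub>0\<^sup>*, \<dots>, S\<^sub>n\<^sub>-\<^sub>1\<^sup>*)\<close> is not a limit of left invertible columns: a left invertible
  column \<open>z\<close> near it yields the left invertible element \<open>w = \<Sum> S\<^sub>i z\<^sub>i\<close> near the projection
  \<open>P = \<Sum> S\<^sub>i S\<^sub>i\<^sup>*\<close> with \<open>P w = w\<close>. By a Neumann series \<open>w\<close> is then also right invertible relative
  to \<open>P\<close>, which forces \<open>P = 1\<close>, contradicting \<open>P S\<^sub>n = 0\<close>.\<close>

lemma not_Lg_dense:
  assumes "e \<noteq> \<zero>"
  shows "\<not> Lg_dense A n"
proof
  assume dense: "Lg_dense A n"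
  let ?P = "range_proj n"
  note P = projection_range_proj[of n, unfolded projection_def]
  have "restrict (\<lambda>i. adj A (S i)) {..<n} \<in> {..<n} \<rightarrow>\<^sub>E carrier A" by auto
  \<comment> \<open>Each of the \<open>n\<close> entries contributes less than
    \<open>1 / (n + 1)\<close>, so the total deviation stays below 1, also for
    \<open>n = 0\<close>.\<close>
  moreover have "0 < 1 / (real n + 1)" by simp
  ultimately have "\<exists>z\<in>Lg A n. \<forall>i<n. nrm A (z i \<ominus> restrict (\<lambda>i. adj A (S i)) {..<n} i) < 1 / (real n + 1)"
    using dense unfolding Lg_dense_def by blast
  then obtain z where z: "z \<in> Lg A n"
    "\<And>i. i < n \<Longrightarrow> nrm A (z i \<ominus> adj A (S i)) < 1 / (real n + 1)"
    by auto
  then obtain y where y: "y \<in> {..<n} \<rightarrow>\<^sub>E carrier A" "finsum A (\<lambda>i. y i \<otimes> z i) {..<n} = e"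
    and zc: "z \<in> {..<n} \<rightarrow>\<^sub>E carrier A" by (auto simp: Lg_def unit_of_eq)
  have yc [simp]: "y i \<in> carrier A" and zi [simp]: "z i \<in> carrier A" if "i < n" for i
    using y zc that by auto
  define w where "w = finsum A (\<lambda>i. S i \<otimes> z i) {..<n}"
  \<comment> \<open>Orthogonality of the ranges makes this row a left inverse of \<open>w\<close>:
    it collapses \<open>u w\<close> to the given sum of the \<open>y i z i\<close>.\<close>
  define u where "u = finsum A (\<lambda>i. y i \<otimes> adj A (S i)) {..<n}"
  have wc [simp]: "w \<in> carrier A" and uc [simp]: "u \<in> carrier A"
    unfolding w_def u_def by (auto intro!: finsum_closed)
  have uw: "u \<otimes> w = e"
  proof -
    have "u \<otimes> w = finsum A (\<lambda>i. y i \<otimes> adj A (S i) \<otimes> w) {..<n}"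
      unfolding u_def by (intro finsum_mult_right) auto
    also have "\<dots> = finsum A (\<lambda>i. y i \<otimes> z i) {..<n}"
      by (intro finsum_cong') (auto simp: mult_assoc, auto simp: w_def adj_S_finsum)
    finally show ?thesis using y by simp
  qed
  have Pw: "?P \<otimes> w = w" unfolding w_def by (rule range_proj_finsum) simp
  have "nrm A (w \<ominus> ?P) < 1"
  proof -
    have "w \<ominus> ?P = finsum A (\<lambda>i. S i \<otimes> (z i \<ominus> adj A (S i))) {..<n}"
    proof -
      have "finsum A (\<lambda>i. S i \<otimes> (z i \<ominus> adj A (S i)) \<oplus> S i \<otimes> adj A (S i)) {..<n} = w"
        unfolding w_def by (intro finsum_cong') (auto simp: a_minus_def distrib_left mult_minus a_ac r_neg1 r_neg2 r_neg)
      moreover have "finsum A (\<lambda>i. S i \<otimes> (z i \<ominus> adj A (S i)) \<oplus> S i \<otimes> adj A (S i)) {..<n} =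
        finsum A (\<lambda>i. S i \<otimes> (z i \<ominus> adj A (S i))) {..<n} \<oplus> ?P"
        unfolding range_proj_def by (intro finsum_addf) auto
      moreover have "finsum A (\<lambda>i. S i \<otimes> (z i \<ominus> adj A (S i))) {..<n} \<in> carrier A"
        by (intro finsum_closed) auto
      ultimately show ?thesis by (metis a_minus_def add.inv_solve_right' range_proj_closed wc)
    qed
    then have "nrm A (w \<ominus> ?P) \<le> (\<Sum>i<n. nrm A (S i \<otimes> (z i \<ominus> adj A (S i))))"
      by (simp add: nrm_finsum)
    also have "\<dots> \<le> (\<Sum>i<n. 1 / (real n + 1))"
    proof (rule sum_mono)
      fix i assume "i \<in> {..<n}"
      then have i: "i < n" by simp
      have "nrm A (S i \<otimes> (z i \<ominus> adj A (S i))) \<le> nrm A (S i) * nrm A (z i \<ominus> adj A (S i))"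
        using i by (intro nrm_mult) auto
      also have "\<dots> \<le> 1 * (1 / (real n + 1))"
        using i z(2)[OF i] nrm_S by (intro mult_mono nrm_nonneg) auto
      finally show "nrm A (S i \<otimes> (z i \<ominus> adj A (S i))) \<le> 1 / (real n + 1)" by simp
    qed
    also have "\<dots> < 1" by simp
    finally show ?thesis .
  qed
  \<comment> \<open>\<open>w\<close> itself need not lie in the corner of \<open>P\<close>, but
    \<open>w P\<close> does, and it equals \<open>P - h\<close>. Solving \<open>g = P + h g\<close>
    inverts it on the right within the corner.\<close>
  define h where "h = ?P \<ominus> w \<otimes> ?P"
  have hc [simp]: "h \<in> carrier A" by (simp add: h_def)
  have "h = (?P \<ominus> w) \<otimes> ?P" using P by (simp add: h_def mult_diff_left)
  then have "nrm A h \<le> nrm A (w \<ominus> ?P) * nrm A ?P"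
    using nrm_mult[of "?P \<ominus> w" ?P] nrm_diff_commute[of w ?P] by simp
  also have "\<dots> \<le> nrm A (w \<ominus> ?P) * 1"
    by (intro mult_left_mono projection_nrm projection_range_proj nrm_nonneg) auto
  finally have "nrm A h < 1" using \<open>nrm A (w \<ominus> ?P) < 1\<close> by simp
  then obtain g where gc [simp]: "g \<in> carrier A" and g: "g = ?P \<oplus> h \<otimes> g"
    using fixpoint_affine[of ?P h] by auto
  have Ph: "?P \<otimes> h = h"
    using P Pw by (simp add: h_def mult_diff_right flip: mult_assoc)
  have "?P \<otimes> g = ?P \<otimes> (?P \<oplus> h \<otimes> g)" using g by simp
  also have "\<dots> = ?P \<oplus> h \<otimes> g" using P Ph by (simp add: distrib_left flip: mult_assoc)
  finally have Pg: "?P \<otimes> g = g" using g by simp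
  have "w \<otimes> g = w \<otimes> ?P \<otimes> g" using Pg by (simp add: mult_assoc)
  also have "w \<otimes> ?P = ?P \<ominus> h"
    by (simp add: h_def a_minus_def minus_add a_ac r_neg1 r_neg2)
  also have "(?P \<ominus> h) \<otimes> g = g \<ominus> h \<otimes> g" using Pg by (simp add: mult_diff_left)
  also have "\<dots> = ?P"
    by (metis a_minus_def add.inv_solve_right' g gc hc mult_closed range_proj_closed)
  finally have wg: "w \<otimes> g = ?P" .
  \<comment> \<open>The left inverse \<open>u\<close> and the relative right inverse
    \<open>g\<close> are played against each other: \<open>g = u P\<close>, hence
    \<open>g w = u w = 1\<close>. As \<open>P\<close> fixes \<open>g\<close>, it must fix 1.\<close>
  have "g = u \<otimes> w \<otimes> g" using uw by simp
  also have "\<dots> = u \<otimes> ?P" using wg by (simp add: mult_assoc)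
  finally have "g \<otimes> w = u \<otimes> (?P \<otimes> w)" by (simp add: mult_assoc)
  then have gw: "g \<otimes> w = e" using Pw uw by simp
  have "?P = ?P \<otimes> (g \<otimes> w)" using gw by simp
  also have "\<dots> = ?P \<otimes> g \<otimes> w" by (simp add: mult_assoc)
  also have "\<dots> = e" by (simp only: Pg gw)
  finally have "S n = \<zero>" using range_proj_S[of n n] by simp
  then have "e = \<zero>" using S_orthogonal[of n n] by simp
  then show False using assms by simp
qed

lemma stable_rank_infinite: "e \<noteq> \<zero> \<Longrightarrow> stable_rank A = \<infinity>"
  using not_Lg_dense by (auto simp: stable_rank_def)

end

section \<open>The $C^*$-algebra of a cofinal $k$-graph\<close>

lemma (in k_graph) paths_deg_subset_paths_le: "paths_deg \<Lambda> n \<subseteq> paths_le \<Lambda> n"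
  by (auto simp: paths_deg_def paths_le_self)

locale CK_algebra = k_graph \<Lambda> + cstar_algebra A
  for \<Lambda> :: "('p, 'k::finite) kgraph" and A :: "'a cstar" (structure) +
  fixes s :: "'p \<Rightarrow> 'a"
  assumes CK: "CK_family \<Lambda> A s" and fin: "finite_kgraph \<Lambda>"
begin

lemma s_closed [simp]: "f \<in> Mor \<Lambda> \<Longrightarrow> s f \<in> carrier A"
  and s_vertex: "v \<in> vertices \<Lambda> \<Longrightarrow> s v \<otimes> s v = s v" "v \<in> vertices \<Lambda> \<Longrightarrow> adj A (s v) = s v"
  and s_vertex_orthogonal: "v \<in> vertices \<Lambda> \<Longrightarrow> w \<in> vertices \<Lambda> \<Longrightarrow> v \<noteq> w \<Longrightarrow> s v \<otimes> s w = \<zero>"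
  and s_cmp: "f \<in> Mor \<Lambda> \<Longrightarrow> g \<in> Mor \<Lambda> \<Longrightarrow> src \<Lambda> f = rng \<Lambda> g \<Longrightarrow> s f \<otimes> s g = s (cmp \<Lambda> f g)"
  and s_star: "f \<in> Mor \<Lambda> \<Longrightarrow> adj A (s f) \<otimes> s f = s (src \<Lambda> f)"
  and s_sum: "v \<in> vertices \<Lambda> \<Longrightarrow>
    s v = finsum A (\<lambda>f. s f \<otimes> adj A (s f)) (with_range \<Lambda> v (paths_le \<Lambda> n))"
  using CK by (auto simp: CK_family_def)

lemma s_vertex_closed [simp]: "v \<in> vertices \<Lambda> \<Longrightarrow> s v \<in> carrier A"
  by (simp add: vertex_id)

lemma s_rng: "f \<in> Mor \<Lambda> \<Longrightarrow> s (rng \<Lambda> f) \<otimes> s f = s f"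
  by (simp add: s_cmp rng_closed src_rng cmp_id_left)

lemma s_src: "f \<in> Mor \<Lambda> \<Longrightarrow> s f \<otimes> s (src \<Lambda> f) = s f"
  by (simp add: s_cmp src_closed rng_src cmp_id_right)

lemma finite_vertices: "finite (vertices \<Lambda>)"
  using fin by (auto simp: finite_kgraph_def)

definition vertex_sum :: 'a where
  "vertex_sum = finsum A s (vertices \<Lambda>)"

lemma vertex_sum_closed [simp]: "vertex_sum \<in> carrier A"
  unfolding vertex_sum_def by (intro finsum_closed) auto

lemma vertex_sum_adj: "adj A vertex_sum = vertex_sum"
  unfolding vertex_sum_def using finite_vertices
  by (subst adj_finsum) (auto simp: s_vertex intro!: finsum_cong')

lemma vertex_sum_s:
  assumes f: "f \<in> Mor \<Lambda>"
  shows "vertex_sum \<otimes> s f = s f" "s f \<otimes> vertex_sum = s f"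
proof -
  have "s v \<otimes> s f = \<zero>" if v: "v \<in> vertices \<Lambda>" "v \<noteq> rng \<Lambda> f" for v
  proof -
    have "s v \<otimes> s f = s v \<otimes> s (rng \<Lambda> f) \<otimes> s f"
      using f v by (simp add: mult_assoc s_rng rng_closed)
    then show ?thesis using s_vertex_orthogonal[OF v(1) rng_vertex[OF f] v(2)] f by simp
  qed
  then have "finsum A (\<lambda>v. s v \<otimes> s f) (vertices \<Lambda>) = s (rng \<Lambda> f) \<otimes> s f"
    using f finite_vertices by (intro finsum_single) auto
  then show "vertex_sum \<otimes> s f = s f"
    unfolding vertex_sum_def using f finite_vertices by (subst finsum_mult_right) (auto simp: s_rng)
  have "s f \<otimes> s v = \<zero>" if v: "v \<in> vertices \<Lambda>" "v \<noteq> src \<Lambda> f" for v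
  proof -
    have "s f \<otimes> s v = s f \<otimes> (s (src \<Lambda> f) \<otimes> s v)"
      using f v by (simp add: s_src src_closed flip: mult_assoc)
    then show ?thesis using s_vertex_orthogonal[OF src_vertex[OF f] v(1) v(2)[symmetric]] f by simp
  qed
  then have "finsum A (\<lambda>v. s f \<otimes> s v) (vertices \<Lambda>) = s f \<otimes> s (src \<Lambda> f)"
    using f finite_vertices by (intro finsum_single) auto
  then show "s f \<otimes> vertex_sum = s f"
    unfolding vertex_sum_def using f finite_vertices by (subst finsum_mult_left) (auto simp: s_src)
qed

text \<open>The elements on which \<open>vertex_sum\<close> acts as an identity from both sides form
  a closed *-subalgebra that contains the generators.\<close>

lemma vertex_sum_unit:
  assumes gen: "\<And>S. closed_star_subalgebra A S \<Longrightarrow> s ` Mor \<Lambda> \<subseteq> S \<Longrightarrow> S = carrier A"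
  shows "is_unit_of A vertex_sum"
proof -
  let ?e = vertex_sum
  let ?S = "{x \<in> carrier A. ?e \<otimes> x = x \<and> x \<otimes> ?e = x}"
  have "closed_star_subalgebra A ?S"
    unfolding closed_star_subalgebra_def
  proof (intro conjI ballI allI impI)
    fix x y assume x: "x \<in> ?S" and y: "y \<in> ?S"
    show "x \<oplus> y \<in> ?S" using x y by (simp add: distrib_left distrib_right)
    have "?e \<otimes> (x \<otimes> y) = x \<otimes> y" using x y mult_assoc[of ?e x y] by simp
    moreover have "x \<otimes> y \<otimes> ?e = x \<otimes> y" using x y by (simp add: mult_assoc)
    ultimately show "x \<otimes> y \<in> ?S" using x y by simp
  next
    fix x assume x: "x \<in> ?S"
    show "c \<odot> x \<in> ?S" for c using x by (simp add: smult_mult_left smult_mult_right)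
    have xe: "x \<in> carrier A" "x \<otimes> ?e = x" "?e \<otimes> x = x" using x by auto
    have "?e \<otimes> adj A x = adj A x" "adj A x \<otimes> ?e = adj A x"
      using sym[OF adj_mult[OF xe(1) vertex_sum_closed]] sym[OF adj_mult[OF vertex_sum_closed xe(1)]]
      unfolding xe(2,3) vertex_sum_adj .
    then show "adj A x \<in> ?S" using x by simp
  next
    fix f :: "nat \<Rightarrow> 'a" and a
    assume H: "(\<forall>n. f n \<in> ?S) \<and> a \<in> carrier A \<and> (\<lambda>n. nrm A (f n \<ominus> a)) \<longlonglongrightarrow> 0"
    have a: "a \<in> carrier A" and f [simp]: "f n \<in> carrier A" "?e \<otimes> f n = f n" "f n \<otimes> ?e = f n" for n
      using H by auto
    \<comment> \<open>Uniqueness of limits: a candidate approached at a comparable rate by the same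
      sequence is \<open>a\<close>.\<close>
    have eqI: "b = a" if "b \<in> carrier A" "\<And>n. nrm A (f n \<ominus> b) \<le> c * nrm A (f n \<ominus> a)" for b c
    proof -
      have "nrm A (b \<ominus> a) \<le> c * nrm A (f n \<ominus> a) + nrm A (f n \<ominus> a)" for n
        using nrm_triangle_diff[of b "f n" a] that(1) that(2)[of n] nrm_diff_commute[of b "f n"] a by simp
      moreover have "(\<lambda>n. c * nrm A (f n \<ominus> a) + nrm A (f n \<ominus> a)) \<longlonglongrightarrow> c * 0 + 0"
        using H by (intro tendsto_intros) auto
      ultimately have "nrm A (b \<ominus> a) \<le> c * 0 + 0" by (intro LIMSEQ_le_const) auto
      then have "b \<ominus> a = \<zero>" using nrm_nonneg[of "b \<ominus> a"] nrm_eq_0_iff[of "b \<ominus> a"] that(1) a by simp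
      then show ?thesis using diff_eq_zero_iff that(1) a by simp
    qed
    have "f n \<ominus> ?e \<otimes> a = ?e \<otimes> (f n \<ominus> a)" "f n \<ominus> a \<otimes> ?e = (f n \<ominus> a) \<otimes> ?e" for n
      using a by (simp_all add: mult_diff_left mult_diff_right)
    then have "nrm A (f n \<ominus> ?e \<otimes> a) \<le> nrm A ?e * nrm A (f n \<ominus> a)"
      "nrm A (f n \<ominus> a \<otimes> ?e) \<le> nrm A ?e * nrm A (f n \<ominus> a)" for n
      using nrm_mult[of ?e "f n \<ominus> a"] nrm_mult[of "f n \<ominus> a" ?e] a by (simp_all add: mult.commute)
    then show "a \<in> ?S" using eqI[of "?e \<otimes> a" "nrm A ?e"] eqI[of "a \<otimes> ?e" "nrm A ?e"] a by simp
  qed auto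
  moreover have "s ` Mor \<Lambda> \<subseteq> ?S" using vertex_sum_s by auto
  ultimately have "?S = carrier A" by (rule gen)
  then show ?thesis unfolding is_unit_of_def by auto
qed

end

locale unital_CK_algebra = CK_algebra +
  assumes unit: "is_unit_of A vertex_sum"
begin

sublocale unital_cstar_algebra A vertex_sum
  by unfold_locales (rule unit)

text \<open>Paths of equal degree \<open>n\<close> and equal range occur together in one vertex
  relation, whose range projections add up to a projection and are therefore orthogonal. Multiplying
  by the partial isometries on the outside recovers the statement about \<open>f\<close> and
  \<open>g\<close>.\<close>

lemma s_orthogonal:
  assumes f: "f \<in> paths_deg \<Lambda> n" and g: "g \<in> paths_deg \<Lambda> n" and "rng \<Lambda> f = rng \<Lambda> g" "f \<noteq> g"
  shows "adj A (s f) \<otimes> s g = \<zero>"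
proof -
  let ?q = "\<lambda>f. s f \<otimes> adj A (s f)" and ?I = "with_range \<Lambda> (rng \<Lambda> g) (paths_le \<Lambda> n)"
  have M: "f \<in> Mor \<Lambda>" "g \<in> Mor \<Lambda>" using f g by (auto simp: paths_deg_def)
  have proj: "projection (?q h)" if h: "h \<in> Mor \<Lambda>" for h
  proof -
    have "?q h \<otimes> ?q h = s h \<otimes> (adj A (s h) \<otimes> s h) \<otimes> adj A (s h)"
      using h by (simp add: mult_assoc)
    then show ?thesis using h by (simp add: projection_def adj_mult s_star s_src)
  qed
  have "?q f \<otimes> ?q g = \<zero>"
  proof (rule sum_of_projections_orthogonal[where q = ?q and I = ?I and i = g and j = f])
    show "finite ?I" using finite_paths_le[OF fin] by (simp add: with_range_def)
    show "\<And>h. h \<in> ?I \<Longrightarrow> projection (?q h)" by (rule proj) (auto simp: with_range_def paths_le_def)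
    show "g \<in> ?I" "f \<in> ?I" using f g assms(3) paths_deg_subset_paths_le[of n] by (auto simp: with_range_def)
    have "finsum A ?q ?I = s (rng \<Lambda> g)" using s_sum[OF rng_vertex[OF M(2)]] by simp
    then show "finsum A ?q ?I \<otimes> ?q g = ?q g"
      using M by (simp add: s_rng rng_closed flip: mult_assoc)
  qed (use assms in auto)
  then have "adj A (s f) \<otimes> (?q f \<otimes> ?q g) \<otimes> s g = \<zero>" using M by simp
  moreover have "adj A (s f) \<otimes> (?q f \<otimes> ?q g) \<otimes> s g =
    (adj A (s f) \<otimes> s f) \<otimes> adj A (s f) \<otimes> (s g \<otimes> (adj A (s g) \<otimes> s g))"
    using M by (simp add: mult_assoc)
  moreover have "(adj A (s f) \<otimes> s f) \<otimes> adj A (s f) = adj A (s f)"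
  proof -
    have "adj A (s f \<otimes> s (src \<Lambda> f)) = s (src \<Lambda> f) \<otimes> adj A (s f)"
      using M by (simp add: adj_mult s_vertex src_closed)
    then show ?thesis using M by (simp add: s_star s_src)
  qed
  moreover have "s g \<otimes> (adj A (s g) \<otimes> s g) = s g" using M by (simp add: s_star s_src)
  ultimately show ?thesis by simp
qed

lemma exists_orthogonal_isometries:
  assumes cof: "kgraph_cofinal \<Lambda>"
    and a: "a \<in> Mor \<Lambda>" "rng \<Lambda> a = v" "src \<Lambda> a = v" and t: "t \<in> Mor \<Lambda>" "rng \<Lambda> t = v"
    and at: "adj A (s t) \<otimes> s a = \<zero>"
  shows "\<exists>S. orthogonal_isometries A vertex_sum S"
proof -
  define w where "w = src \<Lambda> t"
  have w: "w \<in> vertices \<Lambda>" using src_vertex[OF t(1)] by (simp add: w_def)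
  define x where "x i = rec_nat (s t) (\<lambda>_ y. s a \<otimes> y) i" for i :: nat
  have x0: "x 0 = s t" and xS: "x (Suc i) = s a \<otimes> x i" for i by (simp_all add: x_def)
  have xc [simp]: "x i \<in> carrier A" for i by (induction i) (use a t in \<open>auto simp: x0 xS\<close>)
  have vx: "s v \<otimes> x i = x i" for i
  proof (cases i)
    case 0
    then show ?thesis using s_rng[OF t(1)] t by (simp add: x0)
  next
    case (Suc j)
    have "s v \<otimes> (s a \<otimes> x j) = s v \<otimes> s a \<otimes> x j"
      using a rng_closed[OF a(1)] by (simp add: mult_assoc)
    then show ?thesis using s_rng[OF a(1)] a by (simp add: Suc xS)
  qed
  \<comment> \<open>Common factors \<open>s a\<close> cancel from the left until the shorter word is
    \<open>s t\<close> alone; any \<open>s a\<close> then left over meets \<open>s t\<close> and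
    gives zero. The case of \<open>i\<close> above \<open>j\<close> follows by taking
    adjoints.\<close>
  have xx: "adj A (x i) \<otimes> x j = (if i = j then s w else \<zero>)" if "i \<le> j" for i j
    using that
  proof (induction i arbitrary: j)
    case 0
    show ?case
    proof (cases j)
      case 0
      then show ?thesis using t by (simp add: x0 s_star w_def)
    next
      case (Suc k)
      have "adj A (s t) \<otimes> (s a \<otimes> x k) = adj A (s t) \<otimes> s a \<otimes> x k" using a t by (simp add: mult_assoc)
      then show ?thesis using at by (simp add: x0 xS Suc)
    qed
  next
    case (Suc i)
    then obtain k where k: "j = Suc k" "i \<le> k" by (metis Suc_le_D Suc_le_mono)
    have "adj A (x (Suc i)) \<otimes> x (Suc k) = adj A (x i) \<otimes> (adj A (s a) \<otimes> s a \<otimes> x k)"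
      using a by (simp add: xS adj_mult mult_assoc)
    also have "\<dots> = adj A (x i) \<otimes> x k" using a vx by (simp add: s_star)
    finally show ?case using Suc.IH[OF k(2)] k by simp
  qed
  have xx: "adj A (x i) \<otimes> x j = (if i = j then s w else \<zero>)" for i j
  proof (cases "i \<le> j")
    case False
    then have "adj A (adj A (x j) \<otimes> x i) = \<zero>" using xx[of j i] by simp
    then show ?thesis using False by (simp add: adj_mult)
  qed (rule xx)
  \<comment> \<open>Each vertex may take its own degree, since the vertex relations are used for one
    vertex at a time.\<close>
  have "\<exists>n. \<forall>u\<in>vertices \<Lambda>.
      src \<Lambda> ` with_range \<Lambda> u (paths_le \<Lambda> (n u)) \<subseteq> src \<Lambda> ` with_range \<Lambda> w (Mor \<Lambda>)"
    using cof w unfolding kgraph_cofinal_def by (intro bchoice) blast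
  then obtain n where n: "\<And>u. u \<in> vertices \<Lambda> \<Longrightarrow>
      src \<Lambda> ` with_range \<Lambda> u (paths_le \<Lambda> (n u)) \<subseteq> src \<Lambda> ` with_range \<Lambda> w (Mor \<Lambda>)" by blast
  define B where "B u = with_range \<Lambda> u (paths_le \<Lambda> (n u))" for u
  define M where "M = (\<Union>u\<in>vertices \<Lambda>. B u)"
  have finB: "finite (B u)" for u using finite_paths_le[OF fin] by (simp add: B_def with_range_def)
  have finM: "finite M" using finB finite_vertices by (simp add: M_def)
  have MM [simp]: "m \<in> Mor \<Lambda>" if "m \<in> M" for m
    using that by (auto simp: M_def B_def with_range_def paths_le_def)
  have "\<exists>b. \<forall>m\<in>M. b m \<in> Mor \<Lambda> \<and> rng \<Lambda> (b m) = w \<and> src \<Lambda> (b m) = src \<Lambda> m"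
  proof (rule bchoice, rule ballI)
    fix m assume "m \<in> M"
    then obtain u where "u \<in> vertices \<Lambda>" "m \<in> with_range \<Lambda> u (paths_le \<Lambda> (n u))" by (auto simp: M_def B_def)
    then have "src \<Lambda> m \<in> src \<Lambda> ` with_range \<Lambda> w (Mor \<Lambda>)" using n by blast
    then show "\<exists>b. b \<in> Mor \<Lambda> \<and> rng \<Lambda> b = w \<and> src \<Lambda> b = src \<Lambda> m" by (auto simp: with_range_def)
  qed
  then obtain b where b [simp]: "\<And>m. m \<in> M \<Longrightarrow> b m \<in> Mor \<Lambda>" and rb: "\<And>m. m \<in> M \<Longrightarrow> rng \<Lambda> (b m) = w"
    and sb: "\<And>m. m \<in> M \<Longrightarrow> src \<Lambda> (b m) = src \<Lambda> m" by blast
  \<comment> \<open>Pairing \<open>j\<close> with the number of \<open>m\<close> gives every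
    combination its own exponent, so the words belonging to different \<open>j\<close> or different
    \<open>m\<close> have orthogonal ranges.\<close>
  define y where "y j m = x (prod_encode (j, to_nat_on M m)) \<otimes> s (b m)" for j m
  have yc [simp]: "y j m \<in> carrier A" if "m \<in> M" for j m using that by (simp add: y_def)
  have yy: "adj A (y j m) \<otimes> y l m' = (if j = l \<and> m = m' then s (src \<Lambda> m) else \<zero>)"
    if m: "m \<in> M" "m' \<in> M" for j l m m'
  proof -
    have "prod_encode (j, to_nat_on M m) = prod_encode (l, to_nat_on M m') \<longleftrightarrow> j = l \<and> m = m'"
      using m inj_on_to_nat_on[OF countable_finite[OF finM]] by (auto simp: inj_on_def)
    then have "adj A (y j m) \<otimes> y l m' =
      adj A (s (b m)) \<otimes> ((if j = l \<and> m = m' then s w else \<zero>) \<otimes> s (b m'))"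
      using m xx by (simp add: y_def adj_mult mult_assoc flip: mult_assoc[of "adj A (x _)" "x _"])
    also have "\<dots> = (if j = l \<and> m = m' then s (src \<Lambda> m) else \<zero>)"
      using m s_rng[of "b m"] s_star[of "b m"] by (auto simp: rb sb)
    finally show ?thesis .
  qed
  define S where "S j = finsum A (\<lambda>m. y j m \<otimes> adj A (s m)) M" for j
  have Sc: "S j \<in> carrier A" for j unfolding S_def by (intro finsum_closed) auto
  have yS: "adj A (y j m) \<otimes> S l = (if j = l then adj A (s m) else \<zero>)" if m: "m \<in> M" for j l m
  proof -
    have z: "adj A (y j m) \<otimes> (y l m' \<otimes> adj A (s m')) = (if j = l \<and> m = m' then s (src \<Lambda> m) \<otimes> adj A (s m) else \<zero>)"
      if "m' \<in> M" for m'
      using that m by (simp add: yy src_closed flip: mult_assoc)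
    have "adj A (y j m) \<otimes> S l = finsum A (\<lambda>m'. adj A (y j m) \<otimes> (y l m' \<otimes> adj A (s m'))) M"
      unfolding S_def using finM m by (intro finsum_mult_left) auto
    also have "\<dots> = adj A (y j m) \<otimes> (y l m \<otimes> adj A (s m))"
      using finM m z by (intro finsum_single) auto
    also have "\<dots> = (if j = l then s (src \<Lambda> m) \<otimes> adj A (s m) else \<zero>)" using z[OF m] by simp
    also have "s (src \<Lambda> m) \<otimes> adj A (s m) = adj A (s m \<otimes> s (src \<Lambda> m))"
      using m by (simp add: adj_mult s_vertex src_closed)
    finally show ?thesis using m by (simp add: s_src)
  qed
  \<comment> \<open>Summing the vertex relations over all vertices gives the unit; the sets
    \<open>B u\<close> are disjoint because their members have different ranges.\<close>
  have sumM: "finsum A (\<lambda>m. s m \<otimes> adj A (s m)) M = vertex_sum"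
  proof -
    have "finsum A (\<lambda>m. s m \<otimes> adj A (s m)) M =
      finsum A (\<lambda>u. finsum A (\<lambda>m. s m \<otimes> adj A (s m)) (B u)) (vertices \<Lambda>)"
      unfolding M_def using finite_vertices finB MM
      by (intro add.finprod_UN_disjoint) (auto simp: M_def B_def with_range_def disjnt_def pairwise_def)
    also have "\<dots> = vertex_sum"
      unfolding vertex_sum_def B_def using s_sum by (intro finsum_cong') auto
    finally show ?thesis .
  qed
  have SS: "adj A (S j) \<otimes> S l = (if j = l then vertex_sum else \<zero>)" for j l
  proof -
    have "adj A (S j) = finsum A (\<lambda>m. s m \<otimes> adj A (y j m)) M"
      unfolding S_def using finM by (subst adj_finsum) (auto simp: adj_mult intro!: finsum_cong')
    then have "adj A (S j) \<otimes> S l = finsum A (\<lambda>m. s m \<otimes> adj A (y j m) \<otimes> S l) M"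
      using finM Sc by (simp add: finsum_mult_right Pi_def)
    also have "\<dots> = finsum A (\<lambda>m. if j = l then s m \<otimes> adj A (s m) else \<zero>) M"
      using Sc by (intro finsum_cong') (auto simp: mult_assoc yS)
    also have "\<dots> = (if j = l then vertex_sum else \<zero>)" using sumM by simp
    finally show ?thesis .
  qed
  have "orthogonal_isometries A vertex_sum S"
    by unfold_locales (auto simp: Sc SS)
  then show ?thesis by blast
qed

end

theorem theorem4p4:
  fixes \<Lambda> :: "('p, 'k::finite) kgraph"
    and A :: "'a cstar"
    and s :: "'p \<Rightarrow> 'a"
  assumes "k_graph \<Lambda>"
    and "kgraph_cofinal \<Lambda>"
    and "finite_kgraph \<Lambda>"
    and "locally_convex \<Lambda>"
    and "\<exists>\<kappa>. is_cycle \<Lambda> \<kappa> \<and> has_entrance \<Lambda> \<kappa>"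
    and "is_graph_algebra \<Lambda> A s"
  shows "properly_infinite A \<and> stable_rank A = \<infinity>"
proof -
  interpret k_graph \<Lambda> by fact
  have A: "cstar_algebra A" "CK_family \<Lambda> A s"
    "\<And>S. closed_star_subalgebra A S \<Longrightarrow> s ` Mor \<Lambda> \<subseteq> S \<Longrightarrow> S = carrier A"
    and univ: "\<And>(B :: (nat \<Rightarrow> nat \<Rightarrow> complex) cstar) t. cstar_algebra B \<Longrightarrow> CK_family \<Lambda> B t \<Longrightarrow>
        \<exists>\<phi>. star_hom A B \<phi> \<and> (\<forall>\<kappa>\<in>Mor \<Lambda>. \<phi> (s \<kappa>) = t \<kappa>)"
    using assms(6) unfolding is_graph_algebra_def by blast+
  interpret cstar_algebra A by fact
  interpret CK_algebra \<Lambda> A s using A assms(3) by unfold_locales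
  interpret unital_CK_algebra \<Lambda> A s using vertex_sum_unit[OF A(3)] by unfold_locales
  obtain f where "is_cycle \<Lambda> f" "has_entrance \<Lambda> f" using assms(5) by blast
  then obtain a t b c where *: "a \<in> Mor \<Lambda>" "rng \<Lambda> a = rng \<Lambda> f" "src \<Lambda> a = rng \<Lambda> f" "t \<in> Mor \<Lambda>" "rng \<Lambda> t = rng \<Lambda> f"
    "b \<in> Mor \<Lambda>" "c \<in> Mor \<Lambda>" "src \<Lambda> b = rng \<Lambda> c" "a = cmp \<Lambda> b c" "deg \<Lambda> b = deg \<Lambda> t" "b \<noteq> t"
    by (rule entrance_branching)
  have "adj A (s t) \<otimes>\<^bsub>A\<^esub> s b = \<zero>\<^bsub>A\<^esub>"
    using * by (intro s_orthogonal[of _ "deg \<Lambda> t"]) (auto simp: paths_deg_def rng_cmp)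
  \<comment> \<open>The distinct paths \<open>t\<close> and \<open>b\<close> have the same degree,
    and \<open>a\<close> begins with \<open>b\<close>, so the orthogonality extends to
    \<open>a\<close>.\<close>
  moreover have "adj A (s t) \<otimes>\<^bsub>A\<^esub> s a = adj A (s t) \<otimes>\<^bsub>A\<^esub> s b \<otimes>\<^bsub>A\<^esub> s c"
    using * s_cmp[of b c] by (simp add: mult_assoc)
  ultimately have "adj A (s t) \<otimes>\<^bsub>A\<^esub> s a = \<zero>\<^bsub>A\<^esub>" using * by simp
  then obtain S where "orthogonal_isometries A vertex_sum S"
    using exists_orthogonal_isometries[OF assms(2) *(1-5)] by blast
  then interpret orthogonal_isometries A vertex_sum S .
  have "vertex_sum \<noteq> \<zero>\<^bsub>A\<^esub>"
  proof
    assume "vertex_sum = \<zero>\<^bsub>A\<^esub>"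
    then have s0: "s g = \<zero>\<^bsub>A\<^esub>" if "g \<in> Mor \<Lambda>" for g using vertex_sum_s(1)[OF that] that by simp
    obtain t g where t: "CK_family \<Lambda> l2_algebra t" "g \<in> Mor \<Lambda>" "t g \<noteq> \<zero>\<^bsub>l2_algebra\<^esub>"
      using exists_nonzero_CK_family assms(3,4) by blast
    obtain \<phi> where \<phi>: "star_hom A l2_algebra \<phi>" "\<phi> (s g) = t g"
      using univ[OF cstar_algebra_l2_algebra t(1)] t(2) by blast
    \<comment> \<open>That \<open>\<phi>\<close> preserves zero is obtained from its compatibility
      with the scalar 0.\<close>
    have "\<phi> (0 \<odot>\<^bsub>A\<^esub> s g) = 0 \<odot>\<^bsub>l2_algebra\<^esub> \<phi> (s g)"
      using \<phi>(1) t(2) s_closed unfolding star_hom_def by blast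
    then show False using \<phi>(2) t(2,3) s0[OF t(2)] by simp
  qed
  then show ?thesis using properly_infinite stable_rank_infinite by blast
qed

end
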